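(* Let $\ast\in\{R,L\}$; let $\hat c_n$ be the risk-based estimator if $\ast=R$ and the likelihood-based estimator if $\ast=L$, and write $D_{i,n}=D_{i,n}^\ast$, $D_n=D_{1,n}+D_{2,n}$, $R_{i,n}=R^\ast_{i,n}$ ($i=1,2$). Let $f$ be a function, and suppose: 1. $\sup_{c\in I_n}\frac{|R_{1,n}(c,f)|+|R_{2,n}(c)|}{D_n(c,f)}\to0$ and $\sup_{c\in I_n}\frac{|R_{3,n}(c,f)|+|R_{4,n}(c)|}{D_n(c,f)}\to0$ in $P_f$-probability; 2. $\sup_{c\in I_n}\bigl|\frac{N_n(c)}{s_n^2(c)}-1\bigr|\to0$ in probability; 3. $D_{2,n}^R(c)\asymp D_{2,n}^L(c)\asymp s_n^2(c)$ uniformly in $c\in I_n$; 4. $f$ satisfies the good bias condition relative to $D_{1,n}$, and $\sum_{j=1}^nf_{j,n}^2\le\sup_{c\in I_n}D_{2,n}(c)$. Then for all sufficiently large $M$ and $\eta\in(0,1)$ the empirical Bayes credible sets $\hat C_{n,\eta,M}=\{f:\|\vec f_n-\hat f_{n,\hat c_n}\|<Mr_n(\hat c_n,\eta)\}$ satisfy $P_f(f\in\hat C_{n,\eta,M})\to1$. In particular, this is true if the polynomial, the product or the Sobolev-type eigenvalue condition (see context) holds together with assumption 4 above.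
   Context: Setting. $\mathcal X$ is a set and for each $n$, $x_{1,n},\dots,x_{n,n}\in\mathcal X$ are known design points. For $f:\mathcal X\to\mathbb R$ write $\vec f_n=(f(x_{1,n}),\dots,f(x_{n,n}))^T$. Under $P_f$ one observes $\vec Y_n=\vec f_n+\vec\varepsilon_n$ with $\vec\varepsilon_n\sim\mathcal N_n(0,I)$. $W^1$ is a mean-zero Gaussian process on $\mathcal X$; given $c>0$ the prior for $f$ is the law of $\sqrt c\,W^1$. $U_n$ is the covariance matrix of $(W^1_{x_{1,n}},\dots,W^1_{x_{n,n}})$, with orthonormal eigenbasis $e_{1,n},\dots,e_{n,n}$ and eigenvalues $\lambda_{1,n},\dots,\lambda_{n,n}$; $f_{j,n}=\vec f_n^Te_{j,n}$, $Z_{j,n}=\vec\varepsilon_n^Te_{j,n}$ (i.i.d. standard normal); $\Sigma_{n,c}=I+cU_n$. Given $c$, the posterior law of $\vec f_n$ is $\mathcal N_n(\hat f_{n,c},I-\Sigma_{n,c}^{-1})$, $\hat f_{n,c}=(I-\Sigma_{n,c}^{-1})\vec Y_n$. $I_n=[\log n/n,n^{m-1}]$ for a fixed constant $m\ge1$ (the exponent in the eigenvalue condition when one is assumed). $r_n(c,\eta)$ is the number such that the centered Euclidean ball of radius $r_n(c,\eta)$ has probability $\eta$ under $\mathcal N_n(0,I-\Sigma_{n,c}^{-1})$. Estimators: likelihood-based $\hat c_n=\operatorname{argmin}_{c\in I_n}[\log\det\Sigma_{n,c}+\vec Y_n^T\Sigma_{n,c}^{-1}\vec Y_n]$; risk-based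 $\hat c_n=\operatorname{argmin}_{c\in I_n}[\operatorname{tr}((I-\Sigma_{n,c}^{-1})^2)-\operatorname{tr}(\Sigma_{n,c}^{-2})+\vec Y_n^T\Sigma_{n,c}^{-2}\vec Y_n]$. Risk-based functions: $D_{1,n}^R(c,f)=\sum_{j=1}^n\frac{f_{j,n}^2}{(1+c\lambda_{j,n})^2}$, $D_{2,n}^R(c)=\sum_{j=1}^n\frac{(c\lambda_{j,n})^2}{(1+c\lambda_{j,n})^2}$, $R_{1,n}^R(c,f)=2\sum_{j=1}^n\frac{Z_{j,n}f_{j,n}}{(1+c\lambda_{j,n})^2}$, $R_{2,n}^R(c)=\sum_{j=1}^n(Z_{j,n}^2-1)\bigl[\frac1{(1+c\lambda_{j,n})^2}-1\bigr]$. Likelihood-based functions: $D_{1,n}^L(c,f)=\sum_{j=1}^n\frac{f_{j,n}^2}{1+c\lambda_{j,n}}$, $D_{2,n}^L(c)=\sum_{j=1}^n\bigl[\log(1+c\lambda_{j,n})-\frac{c\lambda_{j,n}}{1+c\lambda_{j,n}}\bigr]$, $R_{1,n}^L(c,f)=2\sum_{j=1}^n\frac{Z_{j,n}f_{j,n}}{1+c\lambda_{j,n}}$, $R_{2,n}^L(c)=-\sum_{j=1}^n\frac{(Z_{j,n}^2-1)c\lambda_{j,n}}{1+c\lambda_{j,n}}$. Further: $R_{3,n}(c,f)=-2\sum_{j=1}^n\frac{c\lambda_{j,n}Z_{j,n}f_{j,n}}{(1+c\lambda_{j,n})^2}$, $R_{4,n}(c)=\sum_{j=1}^n\frac{(c\lambda_{j,n})^2(Z_{j,n}^2-1)}{(1+c\lambda_{j,n})^2}$,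 $s_n^2(c)=\sum_{j=1}^n\frac{c\lambda_{j,n}}{1+c\lambda_{j,n}}$ and $N_n(c)=\sum_{j=1}^n\frac{c\lambda_{j,n}Z_{j,n}^2}{1+c\lambda_{j,n}}$. Good bias condition relative to $D_{1,n}$: there is $a>0$ (independent of $n$) with $D_{1,n}(Kc,f)\le K^{-a}D_{1,n}(c,f)$ for all $c\in I_n$ and all $K>1$. Eigenvalue conditions. Polynomial: $\underline\delta n/j^m\le\lambda_{j,n}\le\overline\delta n/j^m$ for all $n$, $1\le j\le n$, with constants $0<\underline\delta\le\overline\delta<\infty$, $m\ge1$. Product: there are $n^2$ design points, the eigenvalues are indexed by $(i,j)\in\{1,\dots,n\}^2$ and $\lambda_{i,j,n}\asymp n^2/(i^mj^m)$, uniformly in $i,j$ and $n$. Sobolev-type: same with $\lambda_{i,j,n}\asymp n^2/(i^2+j^2)^m$. In the last two cases $m\ge1$ and everywhere $n$ is replaced by $n^2$ (in particular $I_n$ by $I_{n^2}$) and single sums by double sums. $a_n\asymp b_n$ uniformly means that $a_n/b_n$ is bounded away from $0$ and $\infty$ by the same constants over the domain, for large $n$. *)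

theory Defs
  imports
    "HOL-Probability.Probability"
    "Jordan_Normal_Form.Determinant"
    "Jordan_Normal_Form.Gauss_Jordan_Elimination"
begin

unbundle no inner_syntax
unbundle no vec_syntax
hide_type (open) Finite_Cartesian_Product.vec
hide_const (open) Finite_Cartesian_Product.vec Determinants.det Finite_Cartesian_Product.mat
  Determinants.trace

definition normal_rv :: "'a measure \<Rightarrow> ('a \<Rightarrow> real) \<Rightarrow> real \<Rightarrow> real \<Rightarrow> bool" where
  "normal_rv M X \<mu> \<sigma> \<longleftrightarrow>
     (if \<sigma> = 0 then X \<in> borel_measurable M \<and> (AE \<omega> in M. X \<omega> = \<mu>)
      else \<sigma> > 0 \<and> distributed M lborel X (normal_density \<mu> \<sigma>))"

definition centered_gaussian_process :: "'a measure \<Rightarrow> ('x \<Rightarrow> 'a \<Rightarrow> real) \<Rightarrow> bool" where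
  "centered_gaussian_process M W \<longleftrightarrow>
     prob_space M \<and> (\<forall>t. W t \<in> borel_measurable M) \<and>
     (\<forall>T a. finite T \<longrightarrow> (\<exists>\<sigma>. normal_rv M (\<lambda>\<omega>. \<Sum>t\<in>T. a t * W t \<omega>) 0 \<sigma>))"

definition covariance :: "'a measure \<Rightarrow> ('a \<Rightarrow> real) \<Rightarrow> ('a \<Rightarrow> real) \<Rightarrow> real" where
  "covariance M X Y =
     (\<integral>\<omega>. (X \<omega> - (\<integral>\<omega>'. X \<omega>' \<partial>M)) * (Y \<omega> - (\<integral>\<omega>'. Y \<omega>' \<partial>M)) \<partial>M)"

definition vnorm :: "real vec \<Rightarrow> real" where
  "vnorm v = sqrt (v \<bullet> v)"

definition mtrace :: "real mat \<Rightarrow> real" where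
  "mtrace A = (\<Sum>i<dim_row A. A $$ (i, i))"

definition minv :: "real mat \<Rightarrow> real mat" where
  "minv A = the (mat_inverse A)"

definition psd_sqrt :: "nat \<Rightarrow> real mat \<Rightarrow> real mat" where
  "psd_sqrt N C = (SOME B. B \<in> carrier_mat N N \<and> transpose_mat B = B \<and>
     (\<forall>v\<in>carrier_vec N. 0 \<le> v \<bullet> (B *\<^sub>v v)) \<and> B * B = C)"

definition std_normal_vec :: "nat \<Rightarrow> (nat \<Rightarrow> real) measure" where
  "std_normal_vec N = (\<Pi>\<^sub>M i\<in>{..<N}. density lborel (\<lambda>t. ennreal (std_normal_density t)))"

text \<open>The law of \<open>\<mu> + C\<^sup>1\<^sup>/\<^sup>2 z\<close> for a standard normal vector \<open>z\<close>; this allows the covariance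
  matrix \<open>C\<close> to be singular.  Type \<open>real vec\<close> carries no \<open>\<sigma>\<close>-algebra, hence the coordinate functions.\<close>

definition mv_normal :: "nat \<Rightarrow> real vec \<Rightarrow> real mat \<Rightarrow> (nat \<Rightarrow> real) measure" where
  "mv_normal N \<mu> C = distr (std_normal_vec N) (\<Pi>\<^sub>M i\<in>{..<N}. borel)
     (\<lambda>z. \<lambda>i\<in>{..<N}. (\<mu> + psd_sqrt N C *\<^sub>v vec N z) $ i)"

text \<open>For every \<open>n\<close> there are \<open>npts S n\<close> observations at the points \<open>design S n i\<close>,
  \<open>i < npts S n\<close> (positions start at 0, as in the matrix library).  The eigenvectors and eigenvalues
  are indexed by the finite set \<open>idx S n\<close>, which is either \<open>{1..n}\<close> or \<open>{1..n} \<times> {1..n}\<close>.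
  The probability \<open>P\<^sub>f\<close> is the one of \<open>noise_space S n\<close>, with data \<open>obs S f n\<close> below.\<close>

record ('x, 'v, 'w, 'j) regression =
  npts :: "nat \<Rightarrow> nat"
  idx :: "nat \<Rightarrow> 'j set"
  design :: "nat \<Rightarrow> nat \<Rightarrow> 'x"
  prior_space :: "'v measure"
  prior_process :: "'x \<Rightarrow> 'v \<Rightarrow> real"
  noise_space :: "nat \<Rightarrow> 'w measure"
  noise :: "nat \<Rightarrow> nat \<Rightarrow> 'w \<Rightarrow> real"
  eigvec :: "nat \<Rightarrow> 'j \<Rightarrow> real vec"
  eigval :: "nat \<Rightarrow> 'j \<Rightarrow> real"

definition Umat :: "('x, 'v, 'w, 'j) regression \<Rightarrow> nat \<Rightarrow> real mat" where
  "Umat S n = mat (npts S n) (npts S n) (\<lambda>(i, k). covariance (prior_space S)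
     (prior_process S (design S n i)) (prior_process S (design S n k)))"

definition fvec :: "('x, 'v, 'w, 'j) regression \<Rightarrow> ('x \<Rightarrow> real) \<Rightarrow> nat \<Rightarrow> real vec" where
  "fvec S f n = vec (npts S n) (\<lambda>i. f (design S n i))"

definition noise_vec :: "('x, 'v, 'w, 'j) regression \<Rightarrow> nat \<Rightarrow> 'w \<Rightarrow> real vec" where
  "noise_vec S n \<omega> = vec (npts S n) (\<lambda>i. noise S n i \<omega>)"

definition obs :: "('x, 'v, 'w, 'j) regression \<Rightarrow> ('x \<Rightarrow> real) \<Rightarrow> nat \<Rightarrow> 'w \<Rightarrow> real vec" where
  "obs S f n \<omega> = fvec S f n + noise_vec S n \<omega>"

definition regression_model :: "('x, 'v, 'w, 'j) regression \<Rightarrow> bool" where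
  "regression_model S \<longleftrightarrow>
     centered_gaussian_process (prior_space S) (prior_process S) \<and>
     (\<forall>n. prob_space (noise_space S n) \<and>
        prob_space.indep_vars (noise_space S n) (\<lambda>_. borel) (noise S n) {..<npts S n} \<and>
        (\<forall>i<npts S n. distributed (noise_space S n) lborel (noise S n i) std_normal_density)) \<and>
     (\<forall>n. finite (idx S n) \<and> card (idx S n) = npts S n \<and>
        (\<forall>j\<in>idx S n. eigvec S n j \<in> carrier_vec (npts S n) \<and>
           Umat S n *\<^sub>v eigvec S n j = eigval S n j \<cdot>\<^sub>v eigvec S n j) \<and>
        (\<forall>j\<in>idx S n. \<forall>k\<in>idx S n. eigvec S n j \<bullet> eigvec S n k = (if j = k then 1 else 0)))"

definition fcoef :: "('x, 'v, 'w, 'j) regression \<Rightarrow> ('x \<Rightarrow> real) \<Rightarrow> nat \<Rightarrow> 'j \<Rightarrow> real" where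
  "fcoef S f n j = fvec S f n \<bullet> eigvec S n j"

definition zcoef :: "('x, 'v, 'w, 'j) regression \<Rightarrow> nat \<Rightarrow> 'w \<Rightarrow> 'j \<Rightarrow> real" where
  "zcoef S n \<omega> j = noise_vec S n \<omega> \<bullet> eigvec S n j"

definition SigmaMat :: "('x, 'v, 'w, 'j) regression \<Rightarrow> nat \<Rightarrow> real \<Rightarrow> real mat" where
  "SigmaMat S n c = 1\<^sub>m (npts S n) + c \<cdot>\<^sub>m Umat S n"

definition post_cov :: "('x, 'v, 'w, 'j) regression \<Rightarrow> nat \<Rightarrow> real \<Rightarrow> real mat" where
  "post_cov S n c = 1\<^sub>m (npts S n) - minv (SigmaMat S n c)"

definition post_mean :: "('x, 'v, 'w, 'j) regression \<Rightarrow> nat \<Rightarrow> real \<Rightarrow> real vec \<Rightarrow> real vec" where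
  "post_mean S n c y = post_cov S n c *\<^sub>v y"

definition c_range :: "real \<Rightarrow> nat \<Rightarrow> real set" where
  "c_range m N = {ln (real N) / real N .. real N powr (m - 1)}"

definition Iset :: "('x, 'v, 'w, 'j) regression \<Rightarrow> real \<Rightarrow> nat \<Rightarrow> real set" where
  "Iset S m n = c_range m (npts S n)"

datatype est = Risk | Likelihood

fun criterion ::
  "est \<Rightarrow> ('x, 'v, 'w, 'j) regression \<Rightarrow> nat \<Rightarrow> real vec \<Rightarrow> real \<Rightarrow> real" where
  "criterion Likelihood S n y c =
     ln (det (SigmaMat S n c)) + y \<bullet> (minv (SigmaMat S n c) *\<^sub>v y)"
| "criterion Risk S n y c =
     mtrace (post_cov S n c * post_cov S n c)
     - mtrace (minv (SigmaMat S n c) * minv (SigmaMat S n c))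
     + y \<bullet> ((minv (SigmaMat S n c) * minv (SigmaMat S n c)) *\<^sub>v y)"

text \<open>A minimiser need not be unique: \<open>chat\<close> may be any random variable selecting one.\<close>

definition is_estimator ::
  "est \<Rightarrow> ('x, 'v, 'w, 'j) regression \<Rightarrow> real \<Rightarrow> ('x \<Rightarrow> real) \<Rightarrow> (nat \<Rightarrow> 'w \<Rightarrow> real) \<Rightarrow> bool" where
  "is_estimator k S m f chat \<longleftrightarrow> (\<forall>n\<ge>1.
     chat n \<in> borel_measurable (noise_space S n) \<and>
     (\<forall>\<omega>\<in>space (noise_space S n).
        is_arg_min (criterion k S n (obs S f n \<omega>)) (\<lambda>c. c \<in> Iset S m n) (chat n \<omega>)))"

definition radius :: "('x, 'v, 'w, 'j) regression \<Rightarrow> nat \<Rightarrow> real \<Rightarrow> real \<Rightarrow> real" where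
  "radius S n c \<eta> = (THE r. 0 \<le> r \<and>
     measure (mv_normal (npts S n) (0\<^sub>v (npts S n)) (post_cov S n c))
       {y \<in> space (\<Pi>\<^sub>M i\<in>{..<npts S n}. borel). vnorm (vec (npts S n) y) < r} = \<eta>)"

definition credible_set ::
  "('x, 'v, 'w, 'j) regression \<Rightarrow> nat \<Rightarrow> real \<Rightarrow> real \<Rightarrow> real \<Rightarrow> real vec \<Rightarrow> ('x \<Rightarrow> real) set" where
  "credible_set S n \<eta> M c y =
     {g. vnorm (fvec S g n - post_mean S n c y) < M * radius S n c \<eta>}"

text \<open>The threshold for \<open>M\<close> does not depend on \<open>\<eta>\<close>.\<close>

definition covers ::
  "('x, 'v, 'w, 'j) regression \<Rightarrow> ('x \<Rightarrow> real) \<Rightarrow> (nat \<Rightarrow> 'w \<Rightarrow> real) \<Rightarrow> bool" where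
  "covers S f chat \<longleftrightarrow> (\<forall>\<^sub>F M in at_top. \<forall>\<eta>\<in>{0<..<1}.
     (\<lambda>n. measure (noise_space S n) {\<omega> \<in> space (noise_space S n).
        f \<in> credible_set S n \<eta> M (chat n \<omega>) (obs S f n \<omega>)}) \<longlonglongrightarrow> 1)"

fun D1 :: "est \<Rightarrow> ('x, 'v, 'w, 'j) regression \<Rightarrow> nat \<Rightarrow> real \<Rightarrow> ('x \<Rightarrow> real) \<Rightarrow> real" where
  "D1 Risk S n c f = (\<Sum>j\<in>idx S n. (fcoef S f n j)\<^sup>2 / (1 + c * eigval S n j)\<^sup>2)"
| "D1 Likelihood S n c f = (\<Sum>j\<in>idx S n. (fcoef S f n j)\<^sup>2 / (1 + c * eigval S n j))"

fun D2 :: "est \<Rightarrow> ('x, 'v, 'w, 'j) regression \<Rightarrow> nat \<Rightarrow> real \<Rightarrow> real" where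
  "D2 Risk S n c = (\<Sum>j\<in>idx S n. (c * eigval S n j)\<^sup>2 / (1 + c * eigval S n j)\<^sup>2)"
| "D2 Likelihood S n c = (\<Sum>j\<in>idx S n.
     ln (1 + c * eigval S n j) - c * eigval S n j / (1 + c * eigval S n j))"

definition Dtot :: "est \<Rightarrow> ('x, 'v, 'w, 'j) regression \<Rightarrow> nat \<Rightarrow> real \<Rightarrow> ('x \<Rightarrow> real) \<Rightarrow> real" where
  "Dtot k S n c f = D1 k S n c f + D2 k S n c"

fun R1 ::
  "est \<Rightarrow> ('x, 'v, 'w, 'j) regression \<Rightarrow> nat \<Rightarrow> real \<Rightarrow> ('x \<Rightarrow> real) \<Rightarrow> 'w \<Rightarrow> real" where
  "R1 Risk S n c f \<omega> =
     2 * (\<Sum>j\<in>idx S n. zcoef S n \<omega> j * fcoef S f n j / (1 + c * eigval S n j)\<^sup>2)"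
| "R1 Likelihood S n c f \<omega> =
     2 * (\<Sum>j\<in>idx S n. zcoef S n \<omega> j * fcoef S f n j / (1 + c * eigval S n j))"

fun R2 :: "est \<Rightarrow> ('x, 'v, 'w, 'j) regression \<Rightarrow> nat \<Rightarrow> real \<Rightarrow> 'w \<Rightarrow> real" where
  "R2 Risk S n c \<omega> =
     (\<Sum>j\<in>idx S n. ((zcoef S n \<omega> j)\<^sup>2 - 1) * (1 / (1 + c * eigval S n j)\<^sup>2 - 1))"
| "R2 Likelihood S n c \<omega> =
     - (\<Sum>j\<in>idx S n. ((zcoef S n \<omega> j)\<^sup>2 - 1) * (c * eigval S n j) / (1 + c * eigval S n j))"

definition R3 ::
  "('x, 'v, 'w, 'j) regression \<Rightarrow> nat \<Rightarrow> real \<Rightarrow> ('x \<Rightarrow> real) \<Rightarrow> 'w \<Rightarrow> real" where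
  "R3 S n c f \<omega> = - 2 * (\<Sum>j\<in>idx S n.
     c * eigval S n j * zcoef S n \<omega> j * fcoef S f n j / (1 + c * eigval S n j)\<^sup>2)"

definition R4 :: "('x, 'v, 'w, 'j) regression \<Rightarrow> nat \<Rightarrow> real \<Rightarrow> 'w \<Rightarrow> real" where
  "R4 S n c \<omega> = (\<Sum>j\<in>idx S n.
     (c * eigval S n j)\<^sup>2 * ((zcoef S n \<omega> j)\<^sup>2 - 1) / (1 + c * eigval S n j)\<^sup>2)"

definition s2 :: "('x, 'v, 'w, 'j) regression \<Rightarrow> nat \<Rightarrow> real \<Rightarrow> real" where
  "s2 S n c = (\<Sum>j\<in>idx S n. c * eigval S n j / (1 + c * eigval S n j))"

definition Nstat :: "('x, 'v, 'w, 'j) regression \<Rightarrow> nat \<Rightarrow> real \<Rightarrow> 'w \<Rightarrow> real" where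
  "Nstat S n c \<omega> = (\<Sum>j\<in>idx S n.
     c * eigval S n j * (zcoef S n \<omega> j)\<^sup>2 / (1 + c * eigval S n j))"

definition tends_to_0_in_prob ::
  "(nat \<Rightarrow> 'w measure) \<Rightarrow> (nat \<Rightarrow> 'w \<Rightarrow> ereal) \<Rightarrow> bool" where
  "tends_to_0_in_prob P X \<longleftrightarrow> (\<forall>\<delta>::real. \<delta> > 0 \<longrightarrow>
     (\<lambda>n. measure (P n) {\<omega> \<in> space (P n). \<bar>X n \<omega>\<bar> > ereal \<delta>}) \<longlonglongrightarrow> 0)"

definition uniformly_asymp ::
  "(nat \<Rightarrow> 'a set) \<Rightarrow> (nat \<Rightarrow> 'a \<Rightarrow> real) \<Rightarrow> (nat \<Rightarrow> 'a \<Rightarrow> real) \<Rightarrow> bool" where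
  "uniformly_asymp A a b \<longleftrightarrow> (\<exists>l u. 0 < l \<and>
     (\<forall>\<^sub>F n in sequentially. \<forall>p\<in>A n. l \<le> a n p / b n p \<and> a n p / b n p \<le> u))"

definition remainder_cond ::
  "est \<Rightarrow> ('x, 'v, 'w, 'j) regression \<Rightarrow> real \<Rightarrow> ('x \<Rightarrow> real) \<Rightarrow> bool" where
  "remainder_cond k S m f \<longleftrightarrow>
     tends_to_0_in_prob (noise_space S) (\<lambda>n \<omega>. SUP c\<in>Iset S m n.
       ereal ((\<bar>R1 k S n c f \<omega>\<bar> + \<bar>R2 k S n c \<omega>\<bar>) / Dtot k S n c f)) \<and>
     tends_to_0_in_prob (noise_space S) (\<lambda>n \<omega>. SUP c\<in>Iset S m n.
       ereal ((\<bar>R3 S n c f \<omega>\<bar> + \<bar>R4 S n c \<omega>\<bar>) / Dtot k S n c f))"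

definition radius_cond :: "('x, 'v, 'w, 'j) regression \<Rightarrow> real \<Rightarrow> bool" where
  "radius_cond S m \<longleftrightarrow>
     tends_to_0_in_prob (noise_space S) (\<lambda>n \<omega>. SUP c\<in>Iset S m n.
       ereal \<bar>Nstat S n c \<omega> / s2 S n c - 1\<bar>)"

definition variance_cond :: "('x, 'v, 'w, 'j) regression \<Rightarrow> real \<Rightarrow> bool" where
  "variance_cond S m \<longleftrightarrow>
     uniformly_asymp (Iset S m) (D2 Risk S) (D2 Likelihood S) \<and>
     uniformly_asymp (Iset S m) (D2 Likelihood S) (s2 S)"

text \<open>The value \<open>n = 1\<close> is left out because \<open>c_range m 1\<close> contains the degenerate point \<open>c = 0\<close>, at
  which the inequality would force the bias to vanish.\<close>

definition good_bias ::
  "est \<Rightarrow> ('x, 'v, 'w, 'j) regression \<Rightarrow> real \<Rightarrow> ('x \<Rightarrow> real) \<Rightarrow> bool" where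
  "good_bias k S m f \<longleftrightarrow> (\<exists>a>0. \<forall>n\<ge>2. \<forall>c\<in>Iset S m n. \<forall>K>1.
     D1 k S n (K * c) f \<le> K powr (- a) * D1 k S n c f)"

definition bias_cond ::
  "est \<Rightarrow> ('x, 'v, 'w, 'j) regression \<Rightarrow> real \<Rightarrow> ('x \<Rightarrow> real) \<Rightarrow> bool" where
  "bias_cond k S m f \<longleftrightarrow> good_bias k S m f \<and>
     (\<forall>n\<ge>2. (\<Sum>j\<in>idx S n. (fcoef S f n j)\<^sup>2) \<le> (SUP c\<in>Iset S m n. D2 k S n c))"

definition single_indexed :: "('x, 'v, 'w, nat) regression \<Rightarrow> bool" where
  "single_indexed S \<longleftrightarrow> (\<forall>n. npts S n = n \<and> idx S n = {1..n})"

definition double_indexed :: "('x, 'v, 'w, nat \<times> nat) regression \<Rightarrow> bool" where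
  "double_indexed S \<longleftrightarrow> (\<forall>n. npts S n = n\<^sup>2 \<and> idx S n = {1..n} \<times> {1..n})"

definition polynomial_eigenvalues :: "('x, 'v, 'w, nat) regression \<Rightarrow> real \<Rightarrow> bool" where
  "polynomial_eigenvalues S m \<longleftrightarrow> (\<exists>l u. 0 < l \<and> l \<le> u \<and> (\<forall>n. \<forall>j\<in>{1..n}.
     l * real n / real j powr m \<le> eigval S n j \<and> eigval S n j \<le> u * real n / real j powr m))"

definition product_eigenvalues :: "('x, 'v, 'w, nat \<times> nat) regression \<Rightarrow> real \<Rightarrow> bool" where
  "product_eigenvalues S m \<longleftrightarrow> uniformly_asymp (\<lambda>n. {1..n} \<times> {1..n}) (eigval S)
     (\<lambda>n (i, j). (real n)\<^sup>2 / (real i powr m * real j powr m))"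

definition sobolev_eigenvalues :: "('x, 'v, 'w, nat \<times> nat) regression \<Rightarrow> real \<Rightarrow> bool" where
  "sobolev_eigenvalues S m \<longleftrightarrow> uniformly_asymp (\<lambda>n. {1..n} \<times> {1..n}) (eigval S)
     (\<lambda>n (i, j). (real n)\<^sup>2 / ((real i)\<^sup>2 + (real j)\<^sup>2) powr m)"

end

theory Submission
  imports Defs
begin

text \<open>In the eigenbasis all quantities are sums over the eigenvalues, and either criterion equals
  \<open>Dtot + R1 + R2\<close> up to a term that does not involve \<open>c\<close>.  Where the remainders are small compared with
  \<open>Dtot\<close>, the estimator therefore nearly minimises \<open>Dtot\<close>; comparing it with a fixed multiple of
  itself, the good bias condition gives \<open>D1 \<le> C * D2 \<le> C' * s2\<close> at the estimator, so the squared error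
  of the posterior mean is at most a constant times \<open>s2\<close>.  The squared radius is the \<open>\<eta>\<close>-quantile of a
  quadratic form in a Gaussian vector with the law of \<open>Nstat\<close>, which concentrates at \<open>s2\<close>.

  Under an eigenvalue condition the remainders are controlled on dyadic blocks \<open>[a, 2a]\<close> by a maximal
  inequality for sums of uncorrelated variables, with failure probability of order \<open>1 / Dtot a\<close>.  As
  \<open>Dtot\<close> grows at least like \<open>(c N)\<^sup>1\<^sup>/\<^sup>m\<close>, \<open>N\<close> being the number of observations, these probabilities
  add up to at most \<open>(log N)\<^sup>-\<^sup>1\<^sup>/\<^sup>m\<close> times a constant.  This does not go through assumption 3, which
  fails for polynomial eigenvalues with \<open>m = 1\<close>, where \<open>s2\<close> exceeds \<open>D2 Risk\<close> by a logarithmic factor;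
  the one-sided bound \<open>D2 \<le> C * s2\<close> is enough.\<close>

section \<open>Functional calculus in an orthonormal basis\<close>

text \<open>A set outside the sigma-algebra has \<open>measure\<close> 0. So a hypothesis that an
  exceptional event has vanishing probability carries information only once the event is known to be
  measurable, and a coverage probability can approach 1 only for measurable events. This is why
  suprema over \<open>c\<close> are reduced to countable ones by continuity, and why the radius, for
  which there is no formula, is shown to be monotone in \<open>c\<close>.

  The fixed multiple in the comparison is \<open>K = 4 powr (1 / a)\<close>, chosen so that the good
  bias condition divides \<open>D1\<close> by 4. Minimality of the criterion holds for
  \<open>Dtot\<close> up to a factor 2 only; a quarter still leaves half of \<open>D1\<close> on the
  left, while \<open>D2\<close> grows by at most \<open>K\<^sup>2\<close>.

  For coverage the radius has to be bounded from below only, so of the law of \<open>Nstat\<close>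
  just the lower tail enters, at each deterministic \<open>c\<close> in the range. The randomness of
  the estimator is harmless because these bounds are uniform over the range.\<close>

locale onb =
  fixes N :: nat and J :: "'j set" and e :: "'j \<Rightarrow> real vec"
  assumes finite_J: "finite J" and card_J: "card J = N"
    and e_carrier: "\<And>j. j \<in> J \<Longrightarrow> e j \<in> carrier_vec N"
    and e_orth: "\<And>j k. j \<in> J \<Longrightarrow> k \<in> J \<Longrightarrow> e j \<bullet> e k = (if j = k then 1 else 0)"
begin

text \<open>The spectral calculus: the sum of \<open>g j\<close> times the orthogonal projection
  onto \<open>e j\<close>, by entries. The covariance matrix and all matrices built from it have
  this form in one common basis, so their algebra becomes pointwise algebra of coefficient
  functions.\<close>

definition spec :: "('j \<Rightarrow> real) \<Rightarrow> real mat" where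
  "spec g = mat N N (\<lambda>(i, k). \<Sum>j\<in>J. g j * (e j $ i * e j $ k))"

lemma spec_carrier [simp]: "spec g \<in> carrier_mat N N"
  by (simp add: spec_def)

lemma spec_index: "i < N \<Longrightarrow> k < N \<Longrightarrow> spec g $$ (i, k) = (\<Sum>j\<in>J. g j * (e j $ i * e j $ k))"
  by (simp add: spec_def)

lemma spec_dim [simp]: "dim_row (spec g) = N" "dim_col (spec g) = N"
  by (simp_all add: spec_def)

lemma e_dim: "j \<in> J \<Longrightarrow> dim_vec (e j) = N"
  using e_carrier carrier_vecD by blast

lemma sum_e: "j \<in> J \<Longrightarrow> k \<in> J \<Longrightarrow> (\<Sum>i<N. e j $ i * e k $ i) = (if j = k then 1 else 0)"
  using e_orth[of j k] e_carrier[of k] by (simp add: scalar_prod_def lessThan_atLeast0)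

lemma spec_cong: "(\<And>j. j \<in> J \<Longrightarrow> g j = h j) \<Longrightarrow> spec g = spec h"
  by (rule eq_matI) (auto simp: spec_index intro!: sum.cong)

lemma spec_mult: "spec g * spec h = spec (\<lambda>j. g j * h j)"
proof (rule eq_matI)
  fix i k assume "i < dim_row (spec (\<lambda>j. g j * h j))" "k < dim_col (spec (\<lambda>j. g j * h j))"
  then have ik: "i < N" "k < N" by simp_all
  have "(spec g * spec h) $$ (i, k) = (\<Sum>l<N. spec g $$ (i, l) * spec h $$ (l, k))"
    using ik by (simp add: scalar_prod_def lessThan_atLeast0)
  also have "\<dots> = (\<Sum>l<N. \<Sum>j\<in>J. \<Sum>j'\<in>J. (g j * h j' * e j $ i * e j' $ k) * (e j $ l * e j' $ l))"
    using ik by (intro sum.cong refl) (simp add: spec_index sum_product mult_ac)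
  also have "\<dots> = (\<Sum>j\<in>J. \<Sum>j'\<in>J. \<Sum>l<N. (g j * h j' * e j $ i * e j' $ k) * (e j $ l * e j' $ l))"
    by (subst sum.swap) (intro sum.cong refl sum.swap)
  also have "\<dots> = (\<Sum>j\<in>J. \<Sum>j'\<in>J. (g j * h j' * e j $ i * e j' $ k) * (if j = j' then 1 else 0))"
    by (intro sum.cong refl) (simp add: sum_distrib_left[symmetric] sum_e)
  also have "\<dots> = (\<Sum>j\<in>J. g j * h j * (e j $ i * e j $ k))"
    by (intro sum.cong refl) (simp add: finite_J mult_ac if_distrib cong: if_cong)
  finally show "(spec g * spec h) $$ (i, k) = spec (\<lambda>j. g j * h j) $$ (i, k)"
    using ik by (simp add: spec_index)
qed simp_all

text \<open>The determinant cannot be read off the entries of \<open>spec g\<close>, but it can be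
  read off a diagonalisation. Since \<open>card_J\<close> makes \<open>Q\<close> square,
  orthonormality of its columns also yields the reverse product, which is the completeness of the
  basis.\<close>

lemma spec_factor:
  obtains Q h where "Q \<in> carrier_mat N N" "bij_betw h {..<N} J"
    "\<And>g. spec g = Q * (mat N N (\<lambda>(a, b). if a = b then g (h a) else 0) * transpose_mat Q)"
    "Q * transpose_mat Q = 1\<^sub>m N"
proof -
  obtain h where h: "bij_betw h {..<N} J"
    using finite_J card_J by (metis bij_betw_from_nat_into_finite)
  define Q where "Q = mat N N (\<lambda>(i, a). e (h a) $ i)"
  have Q: "Q \<in> carrier_mat N N" by (simp add: Q_def)
  have hJ: "a < N \<Longrightarrow> h a \<in> J" for a using h by (auto simp: bij_betw_def)
  have hinj: "a < N \<Longrightarrow> b < N \<Longrightarrow> h a = h b \<longleftrightarrow> a = b" for a b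
    using h by (auto simp: bij_betw_def inj_on_def)
  have "transpose_mat Q * Q = 1\<^sub>m N"
  proof (rule eq_matI)
    fix a b assume "a < dim_row (1\<^sub>m N :: real mat)" "b < dim_col (1\<^sub>m N :: real mat)"
    then have ab: "a < N" "b < N" by simp_all
    have "(transpose_mat Q * Q) $$ (a, b) = (\<Sum>i<N. e (h a) $ i * e (h b) $ i)"
      using ab by (simp add: scalar_prod_def lessThan_atLeast0 Q_def)
    then show "(transpose_mat Q * Q) $$ (a, b) = (1\<^sub>m N :: real mat) $$ (a, b)"
      using ab sum_e[OF hJ hJ, of a b] hinj[of a b] by simp
  qed (simp_all add: Q_def)
  then have QQ: "Q * transpose_mat Q = 1\<^sub>m N"
    using mat_mult_left_right_inverse[of "transpose_mat Q" N Q] Q by simp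
  have "spec g = Q * (mat N N (\<lambda>(a, b). if a = b then g (h a) else 0) * transpose_mat Q)" for g
  proof (rule eq_matI)
    fix i k assume "i < dim_row (Q * (mat N N (\<lambda>(a, b). if a = b then g (h a) else 0) * transpose_mat Q))"
      "k < dim_col (Q * (mat N N (\<lambda>(a, b). if a = b then g (h a) else 0) * transpose_mat Q))"
    then have ik: "i < N" "k < N" using Q by simp_all
    have D: "(mat N N (\<lambda>(a, b). if a = b then g (h a) else 0) * transpose_mat Q) $$ (a, k) = g (h a) * e (h a) $ k"
      if "a < N" for a
    proof -
      have "(mat N N (\<lambda>(a, b). if a = b then g (h a) else 0) * transpose_mat Q) $$ (a, k)
          = (\<Sum>b<N. (if a = b then g (h a) else 0) * e (h b) $ k)"
        using that ik by (simp add: scalar_prod_def lessThan_atLeast0 Q_def)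
      also have "\<dots> = (\<Sum>b<N. if a = b then g (h a) * e (h b) $ k else 0)"
        by (intro sum.cong) auto
      finally show ?thesis using that by simp
    qed
    have "(Q * (mat N N (\<lambda>(a, b). if a = b then g (h a) else 0) * transpose_mat Q)) $$ (i, k)
       = (\<Sum>a<N. Q $$ (i, a) * (mat N N (\<lambda>(a, b). if a = b then g (h a) else 0) * transpose_mat Q) $$ (a, k))"
      using ik Q by (simp add: scalar_prod_def lessThan_atLeast0)
    also have "\<dots> = (\<Sum>a<N. g (h a) * (e (h a) $ i * e (h a) $ k))"
      using ik by (intro sum.cong refl) (simp only: D lessThan_iff, simp add: Q_def)
    also have "\<dots> = spec g $$ (i, k)"
      using sum.reindex_bij_betw[OF h, of "\<lambda>j. g j * (e j $ i * e j $ k)"] ik by (simp add: spec_index)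
    finally show "spec g $$ (i, k) = (Q * (mat N N (\<lambda>(a, b). if a = b then g (h a) else 0) * transpose_mat Q)) $$ (i, k)" ..
  qed (simp_all add: Q_def)
  with Q h QQ that show thesis by blast
qed

lemma spec_one: "spec (\<lambda>_. 1) = 1\<^sub>m N"
proof (rule spec_factor)
  fix Q h
  assume Q: "Q \<in> carrier_mat N N" and QQ: "Q * transpose_mat Q = 1\<^sub>m N"
    and s: "\<And>g. spec g = Q * (mat N N (\<lambda>(a, b). if a = b then g (h a :: 'j) else 0) * transpose_mat Q)"
  have "mat N N (\<lambda>(a, b). if a = b then 1 else 0) = (1\<^sub>m N :: real mat)"
    by (rule eq_matI) auto
  then show ?thesis using s[of "\<lambda>_. 1"] Q QQ by simp
qed

lemma det_spec: "det (spec g) = (\<Prod>j\<in>J. g j)"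
proof (rule spec_factor)
  fix Q h
  assume Q: "Q \<in> carrier_mat N N" and h: "bij_betw h {..<N} J" and QQ: "Q * transpose_mat Q = 1\<^sub>m N"
    and s: "\<And>g. spec g = Q * (mat N N (\<lambda>(a, b). if a = b then g (h a) else 0) * transpose_mat Q)"
  let ?D = "mat N N (\<lambda>(a, b). if a = b then g (h a) else 0)"
  have D: "?D \<in> carrier_mat N N" by simp
  have "det Q * det (transpose_mat Q) = 1"
    using det_mult[of Q N "transpose_mat Q"] Q QQ by simp
  moreover have "det (spec g) = det Q * (det ?D * det (transpose_mat Q))"
    unfolding s using Q D det_mult[of Q N "?D * transpose_mat Q"] det_mult[of ?D N "transpose_mat Q"]
      mult_carrier_mat[OF D, of "transpose_mat Q" N]
    by simp
  moreover have "det ?D = (\<Prod>a<N. g (h a))"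
  proof -
    have "det ?D = prod_list (diag_mat ?D)"
      by (rule det_upper_triangular[of _ N]) auto
    also have "diag_mat ?D = map (\<lambda>a. g (h a)) [0..<N]"
      by (simp add: diag_mat_def)
    also have "prod_list \<dots> = (\<Prod>a<N. g (h a))"
      by (simp add: prod.distinct_set_conv_list[symmetric] lessThan_atLeast0)
    finally show ?thesis .
  qed
  ultimately show ?thesis using prod.reindex_bij_betw[OF h, of g] by (simp add: algebra_simps)
qed

lemma trace_spec: "mtrace (spec g) = (\<Sum>j\<in>J. g j)"
proof -
  have "mtrace (spec g) = (\<Sum>i<N. \<Sum>j\<in>J. g j * (e j $ i * e j $ i))"
    by (simp add: mtrace_def spec_index)
  also have "\<dots> = (\<Sum>j\<in>J. g j * (\<Sum>i<N. e j $ i * e j $ i))"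
    by (subst sum.swap) (simp add: sum_distrib_left)
  finally show ?thesis by (simp add: sum_e)
qed

lemma spec_add: "spec g + spec h = spec (\<lambda>j. g j + h j)"
  by (rule eq_matI) (simp_all add: spec_index sum.distrib distrib_right)

lemma spec_diff: "spec g - spec h = spec (\<lambda>j. g j - h j)"
  by (rule eq_matI) (simp_all add: spec_index sum_subtractf left_diff_distrib)

lemma spec_smult: "c \<cdot>\<^sub>m spec g = spec (\<lambda>j. c * g j)"
  by (rule eq_matI) (simp_all add: spec_index sum_distrib_left mult_ac)

lemma spec_transpose: "transpose_mat (spec g) = spec g"
  by (rule eq_matI) (simp_all add: spec_index mult_ac)

lemma spec_mult_vec:
  assumes v: "v \<in> carrier_vec N" and i: "i < N"
  shows "(spec g *\<^sub>v v) $ i = (\<Sum>j\<in>J. g j * (v \<bullet> e j) * e j $ i)"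
proof -
  have "(spec g *\<^sub>v v) $ i = (\<Sum>k<N. \<Sum>j\<in>J. g j * (e j $ i * e j $ k) * v $ k)"
    using v i by (simp add: scalar_prod_def lessThan_atLeast0[symmetric] spec_index sum_distrib_right)
  also have "\<dots> = (\<Sum>j\<in>J. \<Sum>k<N. g j * (e j $ i * e j $ k) * v $ k)"
    by (rule sum.swap)
  also have "\<dots> = (\<Sum>j\<in>J. g j * (v \<bullet> e j) * e j $ i)"
    by (intro sum.cong refl)
      (simp add: e_dim scalar_prod_def lessThan_atLeast0[symmetric] sum_distrib_left sum_distrib_right mult_ac)
  finally show ?thesis .
qed

lemma quad_spec:
  assumes v: "v \<in> carrier_vec N" and w: "w \<in> carrier_vec N"
  shows "v \<bullet> (spec g *\<^sub>v w) = (\<Sum>j\<in>J. g j * (v \<bullet> e j) * (w \<bullet> e j))"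
proof -
  have "v \<bullet> (spec g *\<^sub>v w) = (\<Sum>i<N. v $ i * (\<Sum>j\<in>J. g j * (w \<bullet> e j) * e j $ i))"
    using w by (simp add: scalar_prod_def[of v] lessThan_atLeast0[symmetric] spec_mult_vec del: index_mult_mat_vec)
  also have "\<dots> = (\<Sum>j\<in>J. \<Sum>i<N. v $ i * (g j * (w \<bullet> e j) * e j $ i))"
    by (simp add: sum_distrib_left, rule sum.swap)
  also have "\<dots> = (\<Sum>j\<in>J. g j * (v \<bullet> e j) * (w \<bullet> e j))"
    by (intro sum.cong refl)
      (simp add: e_dim scalar_prod_def[of v] lessThan_atLeast0[symmetric] sum_distrib_left sum_distrib_right mult_ac)
  finally show ?thesis .
qed

lemma parseval:
  assumes v: "v \<in> carrier_vec N"
  shows "v \<bullet> v = (\<Sum>j\<in>J. (v \<bullet> e j)\<^sup>2)"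
  using quad_spec[OF v v, of "\<lambda>_. 1"] v by (simp add: spec_one power2_eq_square)

lemma spec_mult_vec_coef:
  assumes v: "v \<in> carrier_vec N" and j: "j \<in> J"
  shows "(spec g *\<^sub>v v) \<bullet> e j = g j * (v \<bullet> e j)"
proof -
  have e: "e j \<in> carrier_vec N" using e_carrier[OF j] .
  have "(spec g *\<^sub>v v) \<bullet> e j = e j \<bullet> (spec g *\<^sub>v v)"
    using e mult_mat_vec_carrier[OF spec_carrier v] by (intro comm_scalar_prod[of _ N])
  also have "\<dots> = (\<Sum>k\<in>J. g k * (e j \<bullet> e k) * (v \<bullet> e k))"
    by (rule quad_spec[OF e v])
  also have "\<dots> = (\<Sum>k\<in>J. if k = j then g j * (v \<bullet> e j) else 0)"
    using j by (intro sum.cong refl) (simp add: e_orth)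
  finally show ?thesis using j finite_J by simp
qed

text \<open>Multiplying \<open>U\<close> by the resolution of the identity
  \<open>spec (\<lambda>_. 1)\<close> brings in the vectors \<open>e j\<close>, on which
  \<open>U\<close> is known.\<close>

lemma spec_eigenI:
  assumes U: "U \<in> carrier_mat N N" and ev: "\<And>j. j \<in> J \<Longrightarrow> U *\<^sub>v e j = lam j \<cdot>\<^sub>v e j"
  shows "U = spec lam"
proof -
  have "U * spec (\<lambda>_. 1) = spec lam"
  proof (rule eq_matI)
    fix i k assume "i < dim_row (spec lam)" "k < dim_col (spec lam)"
    then have ik: "i < N" "k < N" by simp_all
    have Ue: "(\<Sum>l<N. U $$ (i, l) * e j $ l) = lam j * e j $ i" if "j \<in> J" for j
    proof -
      have "(U *\<^sub>v e j) $ i = (\<Sum>l<N. U $$ (i, l) * e j $ l)"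
        using U ik e_carrier[OF that] by (simp add: scalar_prod_def lessThan_atLeast0)
      then show ?thesis using ev[OF that] e_carrier[OF that] ik by simp
    qed
    have "(U * spec (\<lambda>_. 1)) $$ (i, k) = (\<Sum>l<N. \<Sum>j\<in>J. U $$ (i, l) * (e j $ l * e j $ k))"
      using U ik by (simp add: scalar_prod_def lessThan_atLeast0[symmetric] spec_index sum_distrib_left)
    also have "\<dots> = (\<Sum>j\<in>J. \<Sum>l<N. U $$ (i, l) * (e j $ l * e j $ k))"
      by (rule sum.swap)
    also have "\<dots> = (\<Sum>j\<in>J. (\<Sum>l<N. U $$ (i, l) * e j $ l) * e j $ k)"
      by (simp add: sum_distrib_right mult.assoc)
    also have "\<dots> = spec lam $$ (i, k)"
      using ik Ue by (simp add: spec_index mult.assoc)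
    finally show "(U * spec (\<lambda>_. 1)) $$ (i, k) = spec lam $$ (i, k)" .
  qed (use U in simp_all)
  then show ?thesis using U by (simp add: spec_one)
qed

text \<open>\<open>mat_inverse\<close> returns an option: invertibility excludes
  \<open>None\<close>, and uniqueness of inverses then identifies the matrix it returns.\<close>

lemma minv_spec:
  assumes "\<And>j. j \<in> J \<Longrightarrow> g j \<noteq> 0"
  shows "minv (spec g) = spec (\<lambda>j. 1 / g j)"
proof -
  have L: "spec g * spec (\<lambda>j. 1 / g j) = 1\<^sub>m N"
    using assms by (simp add: spec_mult spec_one[symmetric] cong: spec_cong)
  then have R: "spec (\<lambda>j. 1 / g j) * spec g = 1\<^sub>m N"
    by (intro mat_mult_left_right_inverse[of "spec g" N]) simp_all
  have "spec g \<in> Units (ring_mat TYPE(real) N ())"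
    unfolding Units_def using L R spec_carrier by (auto simp: ring_mat_simps)
  then obtain B where B: "mat_inverse (spec g) = Some B"
    using mat_inverse(1)[OF spec_carrier] by (metis option.exhaust)
  note B' = mat_inverse(2)[OF spec_carrier B]
  have "B = (spec (\<lambda>j. 1 / g j) * spec g) * B"
    using R B' left_mult_one_mat[of B N N] by simp
  also have "\<dots> = spec (\<lambda>j. 1 / g j) * (spec g * B)"
    using B' by (intro assoc_mult_mat[of _ N N _ N _ N]) auto
  also have "\<dots> = spec (\<lambda>j. 1 / g j)"
    using B' right_mult_one_mat[OF spec_carrier] by simp
  finally show ?thesis using B by (simp add: minv_def)
qed

lemma psd_sqrt_spec:
  assumes "\<And>j. j \<in> J \<Longrightarrow> 0 \<le> g j"
  shows "psd_sqrt N (spec g) \<in> carrier_mat N N"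
    "transpose_mat (psd_sqrt N (spec g)) = psd_sqrt N (spec g)"
    "psd_sqrt N (spec g) * psd_sqrt N (spec g) = spec g"
proof -
  define P where "P B \<longleftrightarrow> B \<in> carrier_mat N N \<and> transpose_mat B = B \<and>
     (\<forall>v\<in>carrier_vec N. 0 \<le> v \<bullet> (B *\<^sub>v v)) \<and> B * B = spec g" for B
  \<comment> \<open>The principal root witnesses that the choice in \<open>psd_sqrt\<close> is made
    from a nonempty set.\<close>
  have "spec (\<lambda>j. sqrt (g j)) * spec (\<lambda>j. sqrt (g j)) = spec g"
    unfolding spec_mult by (rule spec_cong) (simp add: assms)
  then have "P (spec (\<lambda>j. sqrt (g j)))"
    unfolding P_def using assms
    by (auto simp: spec_transpose quad_spec mult.assoc intro!: sum_nonneg mult_nonneg_nonneg[OF real_sqrt_ge_zero])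
  then have "P (psd_sqrt N (spec g))"
    unfolding psd_sqrt_def P_def[symmetric] by (rule someI)
  then show "psd_sqrt N (spec g) \<in> carrier_mat N N"
    "transpose_mat (psd_sqrt N (spec g)) = psd_sqrt N (spec g)"
    "psd_sqrt N (spec g) * psd_sqrt N (spec g) = spec g"
    by (simp_all add: P_def)
qed

text \<open>Only the square of the symmetric root enters, so it does not matter which root \<open>psd_sqrt\<close> picks.\<close>

lemma norm_psd_sqrt_mult_vec:
  assumes g: "\<And>j. j \<in> J \<Longrightarrow> 0 \<le> g j" and v: "v \<in> carrier_vec N"
  shows "(psd_sqrt N (spec g) *\<^sub>v v) \<bullet> (psd_sqrt N (spec g) *\<^sub>v v) = (\<Sum>j\<in>J. g j * (v \<bullet> e j)\<^sup>2)"
proof -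
  let ?B = "psd_sqrt N (spec g)"
  note B = psd_sqrt_spec[of g, OF g]
  have Bv: "?B *\<^sub>v v \<in> carrier_vec N" using B(1) v by simp
  have "(?B *\<^sub>v v) \<bullet> (?B *\<^sub>v v) = (transpose_mat ?B *\<^sub>v (?B *\<^sub>v v)) \<bullet> v"
    using transpose_vec_mult_scalar[OF B(1) v Bv] by simp
  also have "\<dots> = (?B *\<^sub>v (?B *\<^sub>v v)) \<bullet> v" using B(2) by simp
  also have "?B *\<^sub>v (?B *\<^sub>v v) = spec g *\<^sub>v v"
    using assoc_mult_mat_vec[OF B(1) B(1) v] B(3) by simp
  also have "(spec g *\<^sub>v v) \<bullet> v = v \<bullet> (spec g *\<^sub>v v)"
    using v mult_mat_vec_carrier[OF spec_carrier v] by (intro comm_scalar_prod[of _ N])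
  finally show ?thesis by (simp add: quad_spec[OF v v] power2_eq_square mult.assoc)
qed

end

section \<open>Moments of linear forms in a standard Gaussian vector\<close>

locale gaussian_noise = prob_space M for M :: "'w measure" +
  fixes N :: nat and \<epsilon> :: "nat \<Rightarrow> 'w \<Rightarrow> real"
  assumes indep: "indep_vars (\<lambda>_. borel) \<epsilon> {..<N}"
    and std_normal: "\<And>i. i < N \<Longrightarrow> distributed M lborel (\<epsilon> i) std_normal_density"
begin

definition lin :: "(nat \<Rightarrow> real) \<Rightarrow> 'w \<Rightarrow> real" where
  "lin u \<omega> = (\<Sum>i<N. u i * \<epsilon> i \<omega>)"

abbreviation sq :: "(nat \<Rightarrow> real) \<Rightarrow> real" where
  "sq u \<equiv> \<Sum>i<N. (u i)\<^sup>2"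

lemma eps_measurable [measurable]: "i < N \<Longrightarrow> \<epsilon> i \<in> borel_measurable M"
  using std_normal[of i] by (auto simp: distributed_def)

lemma lin_measurable [measurable]: "lin u \<in> borel_measurable M"
  unfolding lin_def[abs_def] by (intro borel_measurable_sum borel_measurable_times) auto

lemma lin_add: "lin u \<omega> + lin v \<omega> = lin (\<lambda>i. u i + v i) \<omega>"
  by (simp add: lin_def sum.distrib distrib_right)

lemma lin_diff: "lin u \<omega> - lin v \<omega> = lin (\<lambda>i. u i - v i) \<omega>"
  by (simp add: lin_def sum_subtractf left_diff_distrib)

lemma lin_normal:
  assumes "sq u \<noteq> 0"
  shows "distributed M lborel (lin u) (normal_density 0 (sqrt (sq u)))"
proof -
  \<comment> \<open>A normal density requires a positive standard deviation, so terms with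
    coefficient 0 are dropped before the independent normals are added.\<close>
  define I where "I = {i. i < N \<and> u i \<noteq> 0}"
  have I: "finite I" "I \<subseteq> {..<N}" by (auto simp: I_def)
  have "I \<noteq> {}" using assms by (auto simp: I_def intro!: sum.neutral)
  have "indep_vars (\<lambda>_. borel) (\<lambda>i \<omega>. u i * \<epsilon> i \<omega>) I"
    by (rule indep_vars_compose2[OF indep_vars_subset[OF indep I(2)]]) simp
  moreover have "distributed M lborel (\<lambda>\<omega>. u i * \<epsilon> i \<omega>) (normal_density 0 \<bar>u i\<bar>)" if "i \<in> I" for i
  proof -
    have "i < N" "u i \<noteq> 0" using that by (auto simp: I_def)
    then show ?thesis
      using normal_density_affine[OF std_normal[of i], of "u i" 0] by simp
  qed
  ultimately have "distributed M lborel (\<lambda>\<omega>. \<Sum>i\<in>I. u i * \<epsilon> i \<omega>)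
      (normal_density (\<Sum>i\<in>I. 0) (sqrt (\<Sum>i\<in>I. \<bar>u i\<bar>\<^sup>2)))"
    using I \<open>I \<noteq> {}\<close> by (intro sum_indep_normal) (auto simp: I_def)
  moreover have "(\<Sum>i\<in>I. u i * \<epsilon> i \<omega>) = lin u \<omega>" for \<omega>
    unfolding lin_def using I by (intro sum.mono_neutral_left) (auto simp: I_def)
  moreover have "(\<Sum>i\<in>I. \<bar>u i\<bar>\<^sup>2) = sq u"
    unfolding power2_abs using I by (intro sum.mono_neutral_left) (auto simp: I_def)
  ultimately show ?thesis by (simp add: lin_def[abs_def])
qed

lemma sq_eq_0: "sq u = 0 \<Longrightarrow> lin u \<omega> = 0"
  by (simp add: lin_def sum_nonneg_eq_0_iff)

lemma sq_nonneg: "0 \<le> sq u" by (simp add: sum_nonneg)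

lemma integrable_lin_power [intro, simp]: "integrable M (\<lambda>\<omega>. lin u \<omega> ^ k)"
proof (cases "sq u = 0")
  case True
  then show ?thesis by (simp add: sq_eq_0)
next
  case False
  then have "0 < sqrt (sq u)" using sq_nonneg[of u] by simp
  then show ?thesis
    using distributed_integrable[OF lin_normal[OF False], of "\<lambda>x. x ^ k"]
      integrable_normal_moment[of "sqrt (sq u)" 0 k] by simp
qed

lemma expectation_lin_even_power:
  assumes "0 < k"
  shows "expectation (\<lambda>\<omega>. lin u \<omega> ^ (2 * k)) = fact (2 * k) / (2 ^ k * fact k) * sq u ^ k"
proof (cases "sq u = 0")
  case True
  then have "lin u = (\<lambda>_. 0)" by (intro ext sq_eq_0)
  then show ?thesis using assms True by (simp add: power_0_left)
next
  case False
  then have p: "0 < sqrt (sq u)" using sq_nonneg[of u] by simp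
  have "expectation (\<lambda>\<omega>. lin u \<omega> ^ (2 * k)) = fact (2 * k) / ((2 / (sqrt (sq u))\<^sup>2) ^ k * fact k)"
    using distributed_integral[OF lin_normal[OF False], of "\<lambda>x. x ^ (2 * k)"]
      integral_normal_moment_even[OF p, of 0 k] by simp
  also have "(sqrt (sq u))\<^sup>2 = sq u" using sq_nonneg by simp
  finally show ?thesis using False by (simp add: power_divide field_simps)
qed

lemma expectation_lin_sq: "expectation (\<lambda>\<omega>. (lin u \<omega>)\<^sup>2) = sq u"
  using expectation_lin_even_power[of 1 u] by (simp add: fact_numeral)

lemma expectation_lin_4: "expectation (\<lambda>\<omega>. lin u \<omega> ^ 4) = 3 * (sq u)\<^sup>2"
  using expectation_lin_even_power[of 2 u] by (simp add: fact_numeral)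

lemma sq_polar:
  "sq (\<lambda>i. u i + v i) = sq u + sq v + 2 * (\<Sum>i<N. u i * v i)"
  "sq (\<lambda>i. u i - v i) = sq u + sq v - 2 * (\<Sum>i<N. u i * v i)"
  by (simp_all add: power2_sum power2_diff sum.distrib sum_subtractf sum_distrib_left mult.assoc)

lemma lin_prod_polar: "lin u \<omega> * lin v \<omega> =
  ((lin (\<lambda>i. u i + v i) \<omega>)\<^sup>2 - (lin (\<lambda>i. u i - v i) \<omega>)\<^sup>2) / 4"
  unfolding lin_add[symmetric] lin_diff[symmetric] by (simp add: power2_eq_square algebra_simps)

lemma integrable_lin_prod: "integrable M (\<lambda>\<omega>. lin u \<omega> * lin v \<omega>)"
  unfolding lin_prod_polar by simp

lemma expectation_lin_prod: "expectation (\<lambda>\<omega>. lin u \<omega> * lin v \<omega>) = (\<Sum>i<N. u i * v i)"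
  unfolding lin_prod_polar by (simp add: expectation_lin_sq sq_polar)

text \<open>The fourth-order identity (x+y)^4 + (x-y)^4 - 2x^4 - 2y^4 = 12 x^2 y^2 expresses mixed
  moments by fourth moments of single linear forms, so the joint law of two forms never has to be
  described.\<close>

lemma lin_sq_prod_polar: "(lin u \<omega>)\<^sup>2 * (lin v \<omega>)\<^sup>2 =
  (lin (\<lambda>i. u i + v i) \<omega> ^ 4 + lin (\<lambda>i. u i - v i) \<omega> ^ 4 - 2 * lin u \<omega> ^ 4 - 2 * lin v \<omega> ^ 4) / 12"
  unfolding lin_add[symmetric] lin_diff[symmetric] by (simp add: eval_nat_numeral algebra_simps)

lemma integrable_lin_sq_prod: "integrable M (\<lambda>\<omega>. (lin u \<omega>)\<^sup>2 * (lin v \<omega>)\<^sup>2)"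
  unfolding lin_sq_prod_polar by simp

lemma expectation_lin_sq_prod:
  "expectation (\<lambda>\<omega>. (lin u \<omega>)\<^sup>2 * (lin v \<omega>)\<^sup>2) = sq u * sq v + 2 * (\<Sum>i<N. u i * v i)\<^sup>2"
proof -
  have "expectation (\<lambda>\<omega>. (lin u \<omega>)\<^sup>2 * (lin v \<omega>)\<^sup>2)
     = (3 * (sq (\<lambda>i. u i + v i))\<^sup>2 + 3 * (sq (\<lambda>i. u i - v i))\<^sup>2 - 6 * (sq u)\<^sup>2 - 6 * (sq v)\<^sup>2) / 12"
    unfolding lin_sq_prod_polar by (simp add: expectation_lin_4)
  also have "\<dots> = sq u * sq v + 2 * (\<Sum>i<N. u i * v i)\<^sup>2"
    unfolding sq_polar by (simp add: power2_eq_square algebra_simps)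
  finally show ?thesis .
qed

text \<open>By polarisation the centred squares of orthonormal linear forms are uncorrelated, which makes the
  rotation invariance of the Gaussian law unnecessary.\<close>

lemma expectation_centred_sq_prod:
  "expectation (\<lambda>\<omega>. ((lin u \<omega>)\<^sup>2 - sq u) * ((lin v \<omega>)\<^sup>2 - sq v)) = 2 * (\<Sum>i<N. u i * v i)\<^sup>2"
  "integrable M (\<lambda>\<omega>. ((lin u \<omega>)\<^sup>2 - sq u) * ((lin v \<omega>)\<^sup>2 - sq v))"
proof -
  have *: "((lin u \<omega>)\<^sup>2 - sq u) * ((lin v \<omega>)\<^sup>2 - sq v)
     = (lin u \<omega>)\<^sup>2 * (lin v \<omega>)\<^sup>2 - sq v * (lin u \<omega>)\<^sup>2 - sq u * (lin v \<omega>)\<^sup>2 + sq u * sq v" for \<omega>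
    by (simp add: algebra_simps)
  show "expectation (\<lambda>\<omega>. ((lin u \<omega>)\<^sup>2 - sq u) * ((lin v \<omega>)\<^sup>2 - sq v)) = 2 * (\<Sum>i<N. u i * v i)\<^sup>2"
    unfolding * by (simp add: integrable_lin_sq_prod expectation_lin_sq_prod expectation_lin_sq prob_space)
  show "integrable M (\<lambda>\<omega>. ((lin u \<omega>)\<^sup>2 - sq u) * ((lin v \<omega>)\<^sup>2 - sq v))"
    unfolding * by (simp add: integrable_lin_sq_prod)
qed

text \<open>Links the abstract noise space to the Gaussian product measure through which
  \<open>radius\<close> is defined.\<close>

lemma distr_eps:
  assumes "0 < N"
  shows "distr M (\<Pi>\<^sub>M i\<in>{..<N}. borel) (\<lambda>\<omega>. \<lambda>i\<in>{..<N}. \<epsilon> i \<omega>) = std_normal_vec N"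
proof -
  have "distr M (\<Pi>\<^sub>M i\<in>{..<N}. borel) (\<lambda>\<omega>. \<lambda>i\<in>{..<N}. \<epsilon> i \<omega>) = (\<Pi>\<^sub>M i\<in>{..<N}. distr M borel (\<epsilon> i))"
    using assms indep by (subst indep_vars_iff_distr_eq_PiM'[symmetric]) auto
  also have "\<dots> = std_normal_vec N"
    unfolding std_normal_vec_def
  proof (rule PiM_cong)
    fix i assume "i \<in> {..<N}"
    then have "distr M lborel (\<epsilon> i) = density lborel std_normal_density"
      using std_normal[of i] by (simp add: distributed_def)
    moreover have "distr M borel (\<epsilon> i) = distr M lborel (\<epsilon> i)"
      by (rule distr_cong) simp_all
    ultimately show "distr M borel (\<epsilon> i) = density lborel std_normal_density" by simp
  qed simp
  finally show ?thesis .
qed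

end

section \<open>The law of a quadratic form\<close>

text \<open>Without atoms the distribution function is continuous, and the intermediate value
  theorem gives existence; positive mass on every interval of the half line makes it strictly
  increasing there, which gives uniqueness. This is what gives meaning to the definite description
  in \<open>radius\<close>.\<close>

lemma unique_quantile:
  fixes \<nu> :: "real measure"
  assumes "real_distribution \<nu>" and atom: "\<And>x. measure \<nu> {x} = 0" and neg: "measure \<nu> {..<0} = 0"
    and pos: "\<And>s t. 0 \<le> s \<Longrightarrow> s < t \<Longrightarrow> 0 < measure \<nu> {s<..<t}" and \<eta>: "0 < \<eta>" "\<eta> < 1"
  shows "\<exists>!r. 0 \<le> r \<and> measure \<nu> {..<r} = \<eta>"
proof -
  interpret real_distribution \<nu> by fact
  have cdf: "cdf \<nu> x = measure \<nu> {..<x}" for x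
  proof -
    have "cdf \<nu> x = measure \<nu> {..<x} + measure \<nu> {x}"
      unfolding cdf_def ivl_disj_un(2)[symmetric] by (subst finite_measure_Union) auto
    then show ?thesis by (simp add: atom)
  qed
  have less: "measure \<nu> {..<s} < measure \<nu> {..<t}" if "0 \<le> s" "s < t" for s t
  proof -
    have "measure \<nu> {..<s} + measure \<nu> {s<..<t} = measure \<nu> ({..<s} \<union> {s<..<t})"
      by (subst finite_measure_Union) auto
    also have "\<dots> \<le> measure \<nu> {..<t}"
      using that by (intro finite_measure_mono) auto
    finally show ?thesis using pos[OF that] by simp
  qed
  have "eventually (\<lambda>x. cdf \<nu> x > \<eta>) at_top"
    using order_tendstoD(1)[OF cdf_lim_at_top_prob \<eta>(2)] .
  then obtain b where b: "\<And>x. x \<ge> b \<Longrightarrow> cdf \<nu> x > \<eta>"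
    by (auto simp: eventually_at_top_linorder)
  have "\<exists>r. 0 \<le> r \<and> r \<le> max b 0 \<and> cdf \<nu> r = \<eta>"
  proof (rule IVT')
    show "cdf \<nu> 0 \<le> \<eta>" using neg \<eta> by (simp add: cdf)
    show "\<eta> \<le> cdf \<nu> (max b 0)" using b[of "max b 0"] by simp
    show "continuous_on {0..max b 0} (cdf \<nu>)"
      by (intro continuous_at_imp_continuous_on ballI) (simp add: isCont_cdf atom)
  qed simp
  then obtain r where r: "0 \<le> r" "measure \<nu> {..<r} = \<eta>" by (auto simp: cdf)
  moreover have "r' = r" if "0 \<le> r'" "measure \<nu> {..<r'} = \<eta>" for r'
    using less[of r r'] less[of r' r] r that by (cases r r' rule: linorder_cases) auto
  ultimately show ?thesis by blast
qed

lemma std_normal_open_pos: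
  assumes "open X" "x \<in> X"
  shows "0 < emeasure (density lborel (\<lambda>t. ennreal (std_normal_density t))) (X::real set)"
proof -
  obtain d where d: "0 < d" "ball x d \<subseteq> X" using assms open_contains_ball by blast
  have "\<not> (AE t in lborel. t \<notin> {x - d<..<x + d})"
  proof
    assume "AE t in lborel. t \<notin> {x - d<..<x + d}"
    then have "emeasure lborel {x - d<..<x + d} = 0"
      by (subst (asm) AE_iff_measurable[where N = "{x - d<..<x + d}"]) auto
    then show False using d by simp
  qed
  moreover have "(AE t in lborel. t \<notin> {x - d<..<x + d})"
    if "emeasure (density lborel (\<lambda>t. ennreal (std_normal_density t))) X = 0"
  proof -
    have "X \<in> null_sets (density lborel (\<lambda>t. ennreal (std_normal_density t)))"
      using that assms by (auto simp: null_sets_def)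
    then have "AE t in lborel. t \<in> X \<longrightarrow> ennreal (std_normal_density t) = 0"
      by (subst (asm) null_sets_density_iff) auto
    then show ?thesis
    proof eventually_elim
      case (elim t)
      have "0 < std_normal_density t" by (simp add: normal_density_pos)
      with elim have "t \<notin> X" by (auto simp: ennreal_eq_0_iff)
      moreover have "{x - d<..<x + d} \<subseteq> X" using d(2) by (auto simp: ball_def dist_real_def subset_iff abs_if)
      ultimately show ?case by blast
    qed
  qed
  ultimately show ?thesis by (metis zero_less_iff_neq_zero)
qed

context onb
begin

text \<open>For standard normal \<open>z\<close> this is the squared norm of a centred Gaussian
  vector with covariance \<open>spec g\<close>. The argument is a function rather than a vector, so
  that product measures and the product topology apply to it.\<close>

definition qform :: "('j \<Rightarrow> real) \<Rightarrow> (nat \<Rightarrow> real) \<Rightarrow> real" where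
  "qform g z = (\<Sum>j\<in>J. g j * (vec N z \<bullet> e j)\<^sup>2)"

abbreviation \<gamma> :: "(nat \<Rightarrow> real) measure" where
  "\<gamma> \<equiv> std_normal_vec N"

abbreviation qcdf :: "('j \<Rightarrow> real) \<Rightarrow> real \<Rightarrow> real" where
  "qcdf g r \<equiv> measure \<gamma> {z \<in> space \<gamma>. sqrt (qform g z) < r}"

lemma vec_inner_e: "j \<in> J \<Longrightarrow> vec N z \<bullet> e j = (\<Sum>i<N. z i * e j $ i)"
  by (simp add: scalar_prod_def e_dim lessThan_atLeast0)

lemma qform_alt: "qform g z = (\<Sum>j\<in>J. g j * (\<Sum>i<N. z i * e j $ i)\<^sup>2)"
  unfolding qform_def by (intro sum.cong refl) (simp add: vec_inner_e)

lemma qform_continuous: "continuous_on UNIV (qform g)"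
  unfolding qform_alt[abs_def] by (intro continuous_intros continuous_on_product_coordinates)

lemma qform_scale: "qform g (\<lambda>i. t * z i) = t\<^sup>2 * qform g z"
proof -
  have *: "(\<Sum>i<N. t * z i * e j $ i)\<^sup>2 = t\<^sup>2 * (\<Sum>i<N. z i * e j $ i)\<^sup>2" for j
    by (simp add: sum_distrib_left[symmetric] mult.assoc power_mult_distrib)
  show ?thesis
    unfolding qform_alt * by (simp add: sum_distrib_left mult_ac)
qed

lemma qform_cong: "(\<And>i. i < N \<Longrightarrow> z i = z' i) \<Longrightarrow> qform g z = qform g z'"
  unfolding qform_alt by simp

lemma sets_std_normal_vec: "sets \<gamma> = sets (\<Pi>\<^sub>M i\<in>{..<N}. borel :: real measure)"
  unfolding std_normal_vec_def by (intro sets_PiM_cong) simp_all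

lemma space_std_normal_vec: "space \<gamma> = space (\<Pi>\<^sub>M i\<in>{..<N}. borel :: real measure)"
  by (rule sets_eq_imp_space_eq[OF sets_std_normal_vec])

lemma qform_measurable [measurable]: "qform g \<in> borel_measurable (\<Pi>\<^sub>M i\<in>{..<N}. borel)"
  unfolding qform_alt[abs_def] by measurable

lemma qform_measurable' [measurable]: "qform g \<in> borel_measurable \<gamma>"
  using qform_measurable measurable_cong_sets[OF sets_std_normal_vec refl] by blast

lemma prob_space_std_normal_vec: "prob_space \<gamma>"
  unfolding std_normal_vec_def by (intro prob_space_PiM prob_space_normal_density) simp

end

section \<open>Absence of atoms and full support for the law of a quadratic form\<close>

lemma finite_quadratic_roots:
  fixes a b c :: real
  assumes "a \<noteq> 0"
  shows "finite {y. a * y\<^sup>2 + b * y + c = 0}"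
proof (rule finite_subset)
  show "{y. a * y\<^sup>2 + b * y + c = 0} \<subseteq> {y. poly [:c, b, a:] y = 0}"
    by (auto simp: algebra_simps power2_eq_square)
  show "finite {y. poly [:c, b, a:] y = 0}"
    using assms by (intro poly_roots_finite) auto
qed

context onb
begin

lemma qform_nonneg: "(\<And>j. j \<in> J \<Longrightarrow> 0 \<le> g j) \<Longrightarrow> 0 \<le> qform g z"
  unfolding qform_def by (intro sum_nonneg mult_nonneg_nonneg) auto

text \<open>In a coordinate \<open>i0\<close> where \<open>e j0\<close> does not vanish, the form is
  a genuine quadratic polynomial, with leading coefficient at least
  \<open>g j0 * (e j0 $ i0)\<^sup>2\<close>. For fixed other coordinates it takes the value
  \<open>t\<close> at finitely many points, and Fubini gives a null set.\<close>

lemma qform_atom: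
  assumes g: "\<And>j. j \<in> J \<Longrightarrow> 0 \<le> g j" and j0: "j0 \<in> J" "0 < g j0"
  shows "measure \<gamma> {z \<in> space \<gamma>. qform g z = t} = 0"
proof -
  define D where "D = density lborel (\<lambda>t. ennreal (std_normal_density t))"
  have \<mu>: "\<gamma> = PiM {..<N} (\<lambda>_. D)" by (simp add: std_normal_vec_def D_def)
  have "prob_space D" unfolding D_def by (rule prob_space_normal_density) simp
  then interpret product_sigma_finite "\<lambda>_. D"
    by (simp add: product_sigma_finite_def prob_space_imp_sigma_finite)
  have [measurable_cong]: "sets D = sets borel" by (simp add: D_def)
  have "\<exists>i<N. e j0 $ i \<noteq> 0"
  proof (rule ccontr)
    assume "\<not> ?thesis"
    then have "e j0 \<bullet> e j0 = 0" using e_dim[OF j0(1)] by (simp add: scalar_prod_def)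
    then show False using e_orth[OF j0(1) j0(1)] by simp
  qed
  then obtain i0 where i0: "i0 < N" "e j0 $ i0 \<noteq> 0" by blast
  define A where "A = (\<Sum>j\<in>J. g j * (e j $ i0)\<^sup>2)"
  have "0 < g j0 * (e j0 $ i0)\<^sup>2" using j0 i0 by simp
  also have "\<dots> \<le> A" unfolding A_def
    by (rule member_le_sum) (use j0 g finite_J in auto)
  finally have A: "A \<noteq> 0" by simp
  define I where "I = {..<N} - {i0}"
  have I: "finite I" "i0 \<notin> I" "insert i0 I = {..<N}" using i0 by (auto simp: I_def)
  have q: "qform g (x(i0 := y)) = A * y\<^sup>2 + (\<Sum>j\<in>J. 2 * g j * e j $ i0 * (\<Sum>i\<in>I. x i * e j $ i)) * y
      + (\<Sum>j\<in>J. g j * (\<Sum>i\<in>I. x i * e j $ i)\<^sup>2)" for x y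
  proof -
    have "(\<Sum>i<N. (x(i0 := y)) i * e j $ i) = y * e j $ i0 + (\<Sum>i\<in>I. x i * e j $ i)" for j
    proof -
      have "(\<Sum>i<N. (x(i0 := y)) i * e j $ i) = y * e j $ i0 + (\<Sum>i\<in>I. (x(i0 := y)) i * e j $ i)"
        unfolding I(3)[symmetric] using I(1,2) by simp
      also have "(\<Sum>i\<in>I. (x(i0 := y)) i * e j $ i) = (\<Sum>i\<in>I. x i * e j $ i)"
        using I(2) by (intro sum.cong) auto
      finally show ?thesis .
    qed
    then show ?thesis
      unfolding qform_alt A_def
      by (simp add: power2_sum sum.distrib[symmetric] sum_distrib_right, intro sum.cong refl)
        (simp add: algebra_simps power2_eq_square)
  qed
  have null: "emeasure D F = 0" if "finite F" for F
  proof -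
    have "AE x in lborel. x \<in> F \<longrightarrow> ennreal (std_normal_density x) = 0"
      using AE_not_in[OF finite_imp_null_set_lborel[OF that]] by eventually_elim auto
    then have "F \<in> null_sets D" unfolding D_def
      using that by (subst null_sets_density_iff) (auto intro: borel_closed finite_imp_closed)
    then show ?thesis by auto
  qed
  have S: "{z \<in> space \<gamma>. qform g z = t} \<in> sets \<gamma>"
    by measurable
  have m: "(indicator {z \<in> space \<gamma>. qform g z = t} :: _ \<Rightarrow> ennreal) \<in> borel_measurable (PiM (insert i0 I) (\<lambda>_. D))"
    using S unfolding I(3) \<mu>[symmetric] by measurable
  have "emeasure \<gamma> {z \<in> space \<gamma>. qform g z = t}
      = (\<integral>\<^sup>+z. indicator {z \<in> space \<gamma>. qform g z = t} z \<partial>PiM (insert i0 I) (\<lambda>_. D))"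
    using S unfolding I(3) \<mu>[symmetric] by simp
  also have "\<dots> = (\<integral>\<^sup>+x. (\<integral>\<^sup>+y. indicator {z \<in> space \<gamma>. qform g z = t} (x(i0 := y)) \<partial>D) \<partial>PiM I (\<lambda>_. D))"
    by (rule product_nn_integral_insert[OF I(1,2) m])
  also have "\<dots> = (\<integral>\<^sup>+x. 0 \<partial>PiM I (\<lambda>_. D))"
  proof (rule nn_integral_cong)
    fix x
    let ?F = "{y. A * y\<^sup>2 + (\<Sum>j\<in>J. 2 * g j * e j $ i0 * (\<Sum>i\<in>I. x i * e j $ i)) * y
      + ((\<Sum>j\<in>J. g j * (\<Sum>i\<in>I. x i * e j $ i)\<^sup>2) - t) = 0}"
    have fin: "finite ?F" by (rule finite_quadratic_roots[OF A])
    have "(\<integral>\<^sup>+y. indicator {z \<in> space \<gamma>. qform g z = t} (x(i0 := y)) \<partial>D) \<le> (\<integral>\<^sup>+y. indicator ?F y \<partial>D)"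
      by (intro nn_integral_mono) (auto simp: indicator_def q)
    also have "\<dots> = emeasure D ?F"
      using fin by (intro nn_integral_indicator) (auto simp: D_def intro: borel_closed finite_imp_closed)
    also have "\<dots> = 0" by (rule null[OF fin])
    finally show "(\<integral>\<^sup>+y. indicator {z \<in> space \<gamma>. qform g z = t} (x(i0 := y)) \<partial>D) = 0" by simp
  qed
  finally show ?thesis by (simp add: measure_def)
qed

text \<open>Along the direction \<open>e j0\<close> the root of the form takes every nonnegative
  value, in particular the midpoint of \<open>s\<close> and \<open>t\<close>. By continuity an open
  box around that point is mapped into the interval, and boxes have positive Gaussian mass.\<close>

lemma qform_interval_pos:
  assumes g: "\<And>j. j \<in> J \<Longrightarrow> 0 \<le> g j" and j0: "j0 \<in> J" "0 < g j0" and st: "0 \<le> s" "s < t"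
  shows "0 < measure \<gamma> {z \<in> space \<gamma>. sqrt (qform g z) \<in> {s<..<t}}"
proof -
  interpret P: prob_space "\<gamma>" by (rule prob_space_std_normal_vec)
  define D where "D = density lborel (\<lambda>t. ennreal (std_normal_density t))"
  have \<mu>: "\<gamma> = PiM {..<N} (\<lambda>_. D)" by (simp add: std_normal_vec_def D_def)
  have "prob_space D" unfolding D_def by (rule prob_space_normal_density) simp
  then interpret product_sigma_finite "\<lambda>_. D"
    by (simp add: product_sigma_finite_def prob_space_imp_sigma_finite)
  have setsD: "sets D = sets borel" by (simp add: D_def)
  define z0 where "z0 i = ((s + t) / 2 / sqrt (g j0)) * e j0 $ i" for i
  have "vec N (\<lambda>i. e j0 $ i) = e j0" using e_dim[OF j0(1)] by auto
  then have "qform g (\<lambda>i. e j0 $ i) = (\<Sum>j\<in>J. if j = j0 then g j0 else 0)"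
    unfolding qform_def using j0 by (intro sum.cong) (auto simp: e_orth)
  then have "qform g z0 = ((s + t) / 2 / sqrt (g j0))\<^sup>2 * g j0"
    unfolding z0_def qform_scale using j0 finite_J by simp
  also have "\<dots> = ((s + t) / 2)\<^sup>2" using j0 by (simp add: power_divide)
  finally have z0: "sqrt (qform g z0) = (s + t) / 2" using st by simp
  define U where "U = {z. sqrt (qform g z) \<in> {s<..<t}}"
  have "continuous_on UNIV (\<lambda>z. sqrt (qform g z))"
    by (intro continuous_intros qform_continuous)
  then have "open U" unfolding U_def
    using open_vimage[of "{s<..<t}" "\<lambda>z. sqrt (qform g z)"] by (simp add: vimage_def)
  then have "openin (product_topology (\<lambda>_. euclidean) UNIV) U" by (simp add: open_fun_def)
  moreover have "z0 \<in> U" using st z0 by (simp add: U_def)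
  ultimately obtain X where X: "z0 \<in> Pi\<^sub>E UNIV X" "\<And>i. open (X i)" "Pi\<^sub>E UNIV X \<subseteq> U"
    using product_topology_open_contains_basis[of "\<lambda>_. euclidean" UNIV U z0] by auto
  have sub: "Pi\<^sub>E {..<N} X \<subseteq> {z \<in> space \<gamma>. sqrt (qform g z) \<in> {s<..<t}}"
  proof
    fix z assume z: "z \<in> Pi\<^sub>E {..<N} X"
    \<comment> \<open>The topology is that of functions on all of \<open>nat\<close>, whereas the
      measure lives on the first \<open>N\<close> coordinates; the remaining ones are filled in from
      \<open>z0\<close>, which leaves \<open>qform\<close> unchanged.\<close>
    have "(\<lambda>i. if i < N then z i else z0 i) \<in> Pi\<^sub>E UNIV X"
      using z X(1) by (auto simp: PiE_iff)
    then have "(\<lambda>i. if i < N then z i else z0 i) \<in> U" using X(3) by blast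
    moreover have "qform g (\<lambda>i. if i < N then z i else z0 i) = qform g z"
      by (rule qform_cong) simp
    ultimately show "z \<in> {z \<in> space \<gamma>. sqrt (qform g z) \<in> {s<..<t}}"
      using z by (auto simp: U_def \<mu> space_PiM D_def PiE_iff)
  qed
  have "emeasure \<gamma> (Pi\<^sub>E {..<N} X) = (\<Prod>i<N. emeasure D (X i))"
    unfolding \<mu> using X(2) by (intro emeasure_PiM) (auto simp: setsD)
  also have "\<dots> \<noteq> 0"
  proof -
    have "emeasure D (X i) \<noteq> 0" for i
    proof -
      have "z0 i \<in> X i" using X(1) by (auto simp: PiE_iff)
      from std_normal_open_pos[OF X(2) this] show ?thesis by (simp add: D_def)
    qed
    then show ?thesis by simp
  qed
  finally have "0 < measure \<gamma> (Pi\<^sub>E {..<N} X)"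
    by (simp add: P.emeasure_eq_measure zero_less_measure_iff)
  also have "\<dots> \<le> measure \<gamma> {z \<in> space \<gamma>. sqrt (qform g z) \<in> {s<..<t}}"
    by (intro P.finite_measure_mono sub) measurable
  finally show ?thesis .
qed

lemma qform_quantile:
  assumes g: "\<And>j. j \<in> J \<Longrightarrow> 0 \<le> g j" and j0: "j0 \<in> J" "0 < g j0" and \<eta>: "0 < \<eta>" "\<eta> < 1"
  shows "\<exists>!r. 0 \<le> r \<and> qcdf g r = \<eta>"
proof -
  interpret P: prob_space "\<gamma>" by (rule prob_space_std_normal_vec)
  define \<nu> where "\<nu> = distr \<gamma> borel (\<lambda>z. sqrt (qform g z))"
  have m [measurable]: "(\<lambda>z. sqrt (qform g z)) \<in> borel_measurable \<gamma>" by measurable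
  have \<nu>: "measure \<nu> A = measure \<gamma> {z \<in> space \<gamma>. sqrt (qform g z) \<in> A}"
    if "A \<in> sets borel" for A
    unfolding \<nu>_def using that by (simp add: measure_distr[OF m] vimage_def Int_def conj_commute)
  have "real_distribution \<nu>"
    unfolding \<nu>_def real_distribution_def real_distribution_axioms_def
    using P.prob_space_distr[OF m] by simp
  moreover have "measure \<nu> {x} = 0" for x
  proof -
    have "measure \<nu> {x} \<le> measure \<gamma> {z \<in> space \<gamma>. qform g z = x\<^sup>2}"
      unfolding \<nu>[OF borel_singleton[OF sets.empty_sets]] using qform_nonneg[of g, OF g]
      by (intro P.finite_measure_mono) auto
    then show ?thesis using qform_atom[of g j0 "x\<^sup>2", OF g j0] measure_nonneg[of \<nu> "{x}"] by simp
  qed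
  moreover have "measure \<nu> {..<0} = 0"
  proof -
    have "{z \<in> space \<gamma>. sqrt (qform g z) \<in> {..<0}} = {}"
      using qform_nonneg[of g, OF g] by (auto simp: not_less)
    then show ?thesis by (simp only: \<nu>[OF borel_open[OF open_lessThan]] measure_empty)
  qed
  moreover have "0 < measure \<nu> {s<..<t}" if "0 \<le> s" "s < t" for s t
    unfolding \<nu>[OF borel_open[OF open_greaterThanLessThan]] by (rule qform_interval_pos[of g j0 s t, OF g j0 that])
  ultimately have "\<exists>!r. 0 \<le> r \<and> measure \<nu> {..<r} = \<eta>"
    using \<eta> by (rule unique_quantile)
  then show ?thesis by (simp add: \<nu>)
qed

lemma mv_normal_ball:
  assumes g: "\<And>j. j \<in> J \<Longrightarrow> 0 \<le> g j"
  shows "measure (mv_normal N (0\<^sub>v N) (spec g)) {y \<in> space (\<Pi>\<^sub>M i\<in>{..<N}. borel). vnorm (vec N y) < r}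
    = qcdf g r"
proof -
  let ?B = "psd_sqrt N (spec g)"
  let ?T = "\<lambda>z. \<lambda>i\<in>{..<N}. (0\<^sub>v N + ?B *\<^sub>v vec N z) $ i"
  note B = psd_sqrt_spec[of g, OF g]
  have comp: "?T z i = (\<Sum>k<N. ?B $$ (i, k) * z k)" if "i < N" for z i
    using that B(1) by (simp add: scalar_prod_def lessThan_atLeast0)
  have T: "?T \<in> measurable \<gamma> (\<Pi>\<^sub>M i\<in>{..<N}. borel)"
  proof (rule measurable_restrict)
    fix i assume i: "i \<in> {..<N}"
    have "(\<lambda>z. \<Sum>k<N. ?B $$ (i, k) * z k) \<in> borel_measurable (\<Pi>\<^sub>M i\<in>{..<N}. borel)"
      by measurable
    then have "(\<lambda>z. \<Sum>k<N. ?B $$ (i, k) * z k) \<in> borel_measurable \<gamma>"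
      using measurable_cong_sets[OF sets_std_normal_vec refl] by blast
    moreover have "(\<lambda>z. (0\<^sub>v N + ?B *\<^sub>v vec N z) $ i) = (\<lambda>z. \<Sum>k<N. ?B $$ (i, k) * z k)"
      using comp i by (auto simp: fun_eq_iff)
    ultimately show "(\<lambda>z. (0\<^sub>v N + ?B *\<^sub>v vec N z) $ i) \<in> borel_measurable \<gamma>"
      by simp
  qed
  have nrm: "vnorm (vec N (?T z)) = sqrt (qform g z)" for z
  proof -
    have "vec N (?T z) = ?B *\<^sub>v vec N z" using B(1) by (auto intro!: eq_vecI)
    then show ?thesis
      using norm_psd_sqrt_mult_vec[of g "vec N z", OF g] by (simp add: vnorm_def qform_def)
  qed
  have "(\<lambda>y. vnorm (vec N y)) \<in> borel_measurable (\<Pi>\<^sub>M i\<in>{..<N}. borel)"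
    unfolding vnorm_def scalar_prod_def by (simp add: lessThan_atLeast0[symmetric]) measurable
  then have S: "{y \<in> space (\<Pi>\<^sub>M i\<in>{..<N}. borel). vnorm (vec N y) < r} \<in> sets (\<Pi>\<^sub>M i\<in>{..<N}. borel)"
    by measurable
  have "measure (mv_normal N (0\<^sub>v N) (spec g)) {y \<in> space (\<Pi>\<^sub>M i\<in>{..<N}. borel). vnorm (vec N y) < r}
     = measure \<gamma> (?T -` {y \<in> space (\<Pi>\<^sub>M i\<in>{..<N}. borel). vnorm (vec N y) < r} \<inter> space \<gamma>)"
    unfolding mv_normal_def by (rule measure_distr[OF T S])
  also have "?T -` {y \<in> space (\<Pi>\<^sub>M i\<in>{..<N}. borel). vnorm (vec N y) < r} \<inter> space \<gamma>
    = {z \<in> space \<gamma>. sqrt (qform g z) < r}"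
    using measurable_space[OF T] nrm by auto
  finally show ?thesis .
qed

text \<open>Larger weights give a stochastically larger form. If \<open>r'\<close> were smaller than
  \<open>r\<close>, both would be \<open>\<eta>\<close>-quantiles for the weights \<open>g\<close>,
  against uniqueness. The purpose is monotonicity of the radius in \<open>c\<close>.\<close>

lemma quantile_mono:
  assumes g: "\<And>j. j \<in> J \<Longrightarrow> 0 \<le> g j" and j0: "j0 \<in> J" "0 < g j0"
    and gh: "\<And>j. j \<in> J \<Longrightarrow> g j \<le> h j" and \<eta>: "0 < \<eta>" "\<eta> < 1"
    and r: "qcdf g r = \<eta>" "0 \<le> r"
    and r': "qcdf h r' = \<eta>" "0 \<le> r'"
  shows "r \<le> r'"
proof (rule ccontr)
  interpret P: prob_space "\<gamma>" by (rule prob_space_std_normal_vec)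
  assume "\<not> r \<le> r'"
  then have lt: "r' < r" by simp
  have le: "qform g z \<le> qform h z" for z
    unfolding qform_def by (intro sum_mono mult_right_mono gh) auto
  have "\<eta> \<le> qcdf g r'"
    unfolding r'(1)[symmetric] using le
    by (intro P.finite_measure_mono) (auto intro: le_less_trans[OF real_sqrt_le_mono])
  moreover have "qcdf g r' \<le> \<eta>"
    unfolding r(1)[symmetric] using lt by (intro P.finite_measure_mono) auto
  ultimately have "qcdf g r' = \<eta>"
    by simp
  then have "r' = r" using qform_quantile[of g j0 \<eta>, OF g j0 \<eta>] r r' by blast
  then show False using lt by simp
qed

end

section \<open>The model in spectral coordinates\<close>

text \<open>Twice the Kullback-Leibler divergence KL(N(0,1) || N(0,1+x)).
  \<open>D2 Likelihood\<close> sums it over the eigenvalues of \<open>c U\<close>.\<close>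

definition kl :: "real \<Rightarrow> real" where
  "kl x = ln (1 + x) - x / (1 + x)"

lemma kl_deriv:
  assumes "0 \<le> x"
  shows "(kl has_real_derivative x / (1 + x)\<^sup>2) (at x)"
proof -
  have "1 / (1 + x) - (1 * (1 + x) - x * 1) / ((1 + x) * (1 + x)) = x / (1 + x)\<^sup>2"
    using assms by (simp add: divide_simps) (simp add: power2_eq_square algebra_simps)
  moreover have "(kl has_real_derivative 1 / (1 + x) - (1 * (1 + x) - x * 1) / ((1 + x) * (1 + x))) (at x)"
    unfolding kl_def[abs_def] using assms
    by (intro DERIV_diff DERIV_divide) (auto intro!: derivative_eq_intros)
  ultimately show ?thesis by simp
qed

lemma nonneg_if_deriv_nonneg:
  fixes h :: "real \<Rightarrow> real"
  assumes "0 \<le> x" "h 0 = 0" and h: "\<And>t. 0 \<le> t \<Longrightarrow> \<exists>d\<ge>0. (h has_real_derivative d) (at t)"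
  shows "0 \<le> h x"
proof -
  have "h 0 \<le> h x"
    by (rule DERIV_nonneg_imp_nondecreasing[OF assms(1)]) (use h in blast)
  then show ?thesis using assms(2) by simp
qed

lemma kl_0 [simp]: "kl 0 = 0" by (simp add: kl_def)

lemma kl_nonneg:
  assumes "0 \<le> x"
  shows "0 \<le> kl x"
proof (rule nonneg_if_deriv_nonneg[where h = kl, OF assms kl_0])
  fix t :: real assume t: "0 \<le> t"
  show "\<exists>d\<ge>0. (kl has_real_derivative d) (at t)"
    by (rule exI[of _ "t / (1 + t)\<^sup>2"]) (use t kl_deriv[OF t] in simp)
qed

lemma kl_mono:
  assumes "0 \<le> x" "x \<le> y"
  shows "kl x \<le> kl y"
proof (rule DERIV_nonneg_imp_nondecreasing[OF assms(2)])
  fix t assume "x \<le> t" "t \<le> y"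
  then have t: "0 \<le> t" using assms by simp
  show "\<exists>d. (kl has_real_derivative d) (at t) \<and> 0 \<le> d"
    by (rule exI[of _ "t / (1 + t)\<^sup>2"]) (use t kl_deriv[OF t] in simp)
qed

text \<open>The exponent 2 reflects that \<open>kl x\<close> behaves like x^2/2 at 0. The difference
  of the two sides vanishes at 0 and its derivative contains the factor 1/(1+t)^2 - 1/(1+Kt)^2,
  which is nonnegative.\<close>

lemma kl_scale:
  assumes "0 \<le> x" "1 \<le> K"
  shows "kl (K * x) \<le> K\<^sup>2 * kl x"
proof -
  have "0 \<le> K\<^sup>2 * kl x - kl (K * x)"
  proof (rule nonneg_if_deriv_nonneg[OF assms(1)])
    fix t :: real assume t: "0 \<le> t"
    have "((\<lambda>x. K\<^sup>2 * kl x - kl (K * x)) has_real_derivative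
        K\<^sup>2 * (t / (1 + t)\<^sup>2) - (K * t) / (1 + K * t)\<^sup>2 * K) (at t)"
    proof (intro DERIV_diff DERIV_cmult kl_deriv t)
      have "((*) K has_real_derivative K) (at t)" by (auto intro!: derivative_eq_intros)
      then show "((\<lambda>x. kl (K * x)) has_real_derivative (K * t) / (1 + K * t)\<^sup>2 * K) (at t)"
        using t assms by (intro DERIV_chain2[OF kl_deriv]) auto
    qed
    moreover have "K\<^sup>2 * (t / (1 + t)\<^sup>2) - (K * t) / (1 + K * t)\<^sup>2 * K
       = K\<^sup>2 * t * (1 / (1 + t)\<^sup>2 - 1 / (1 + K * t)\<^sup>2)"
      by (simp add: power2_eq_square algebra_simps)
    moreover have "1 / (1 + K * t)\<^sup>2 \<le> 1 / (1 + t)\<^sup>2"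
      using t assms mult_right_mono[of 1 K t] by (intro divide_left_mono power_mono) auto
    ultimately show "\<exists>d\<ge>0. ((\<lambda>x. K\<^sup>2 * kl x - kl (K * x)) has_real_derivative d) (at t)"
      using t by (intro exI[of _ "K\<^sup>2 * t * (1 / (1 + t)\<^sup>2 - 1 / (1 + K * t)\<^sup>2)"]) auto
  qed simp
  then show ?thesis by simp
qed

text \<open>Both sides behave like x^2 at 0, and their derivatives 2x/(1+x)^3 and 2x/(1+x)^2 are
  ordered. It allows quantities of risk type to be charged to the likelihood criterion.\<close>

lemma sq_le_kl:
  assumes "0 \<le> x"
  shows "x\<^sup>2 / (1 + x)\<^sup>2 \<le> 2 * kl x"
proof -
  have "0 \<le> 2 * kl x - x\<^sup>2 / (1 + x)\<^sup>2"
  proof (rule nonneg_if_deriv_nonneg[OF assms])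
    fix t :: real assume t: "0 \<le> t"
    have "((\<lambda>x. x / (1 + x)) has_real_derivative (1 * (1 + t) - t * 1) / ((1 + t) * (1 + t))) (at t)"
      using t by (intro DERIV_divide) (auto intro!: derivative_eq_intros)
    then have "((\<lambda>x. x / (1 + x)) has_real_derivative 1 / (1 + t)\<^sup>2) (at t)"
      by (simp add: power2_eq_square)
    from DERIV_power[OF this, of 2]
    have "((\<lambda>x. 2 * kl x - (x / (1 + x))\<^sup>2) has_real_derivative
        2 * (t / (1 + t)\<^sup>2) - 2 * (t / (1 + t)) * (1 / (1 + t)\<^sup>2)) (at t)"
      by (intro DERIV_diff DERIV_cmult kl_deriv t) (simp add: mult_ac)
    then have "((\<lambda>x. 2 * kl x - x\<^sup>2 / (1 + x)\<^sup>2) has_real_derivative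
        2 * (t / (1 + t)\<^sup>2) - 2 * (t / (1 + t)) * (1 / (1 + t)\<^sup>2)) (at t)"
      by (simp add: power_divide)
    moreover have "2 * (t / (1 + t)) * (1 / (1 + t)\<^sup>2) \<le> 2 * t * (1 / (1 + t)\<^sup>2)"
      using t by (intro mult_right_mono) (auto simp: field_simps)
    ultimately show "\<exists>d\<ge>0. ((\<lambda>x. 2 * kl x - x\<^sup>2 / (1 + x)\<^sup>2) has_real_derivative d) (at t)"
      by (intro exI[of _ "2 * (t / (1 + t)\<^sup>2) - 2 * (t / (1 + t)) * (1 / (1 + t)\<^sup>2)"]) auto
  qed simp
  then show ?thesis by simp
qed

lemma shrink_mono: "0 \<le> (x::real) \<Longrightarrow> x \<le> y \<Longrightarrow> x / (1 + x) \<le> y / (1 + y)"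
  by (simp add: field_simps)

lemma sq_shrink: "(x::real)\<^sup>2 / (1 + x)\<^sup>2 = (x / (1 + x))\<^sup>2"
  by (simp add: power_divide)

lemma square_integrable_normal_rv:
  assumes "prob_space M" and "normal_rv M X 0 \<sigma>"
  shows "integrable M (\<lambda>\<omega>. (X \<omega>)\<^sup>2)"
proof (cases "\<sigma> = 0")
  case True
  then have [measurable]: "X \<in> borel_measurable M" and ae: "AE \<omega> in M. X \<omega> = 0"
    using assms(2) by (auto simp: normal_rv_def)
  have "AE \<omega> in M. (X \<omega>)\<^sup>2 = 0" using ae by eventually_elim simp
  then show ?thesis by (subst integrable_cong_AE[where g = "\<lambda>_. 0"]) auto
next
  case False
  then have \<sigma>: "0 < \<sigma>" "distributed M lborel X (normal_density 0 \<sigma>)"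
    using assms(2) by (auto simp: normal_rv_def)
  interpret prob_space M by fact
  show ?thesis
    using distributed_integrable[OF \<sigma>(2), of "\<lambda>x. x\<^sup>2"] integrable_normal_moment[OF \<sigma>(1), of 0 2]
    by simp
qed

section \<open>Matrices, criteria and posterior error in the eigenbasis\<close>

locale regression_at =
  fixes S :: "('x, 'v, 'w, 'j) regression" and n :: nat
  assumes model: "regression_model S"
begin

abbreviation P :: "'w measure" where "P \<equiv> noise_space S n"
abbreviation J :: "'j set" where "J \<equiv> idx S n"
abbreviation lam :: "'j \<Rightarrow> real" where "lam \<equiv> eigval S n"
abbreviation Z :: "'w \<Rightarrow> 'j \<Rightarrow> real" where "Z \<equiv> zcoef S n"
abbreviation wt :: "real \<Rightarrow> 'j \<Rightarrow> real" where "wt c j \<equiv> c * lam j / (1 + c * lam j)"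

abbreviation N :: nat where "N \<equiv> npts S n"
abbreviation F :: "('x \<Rightarrow> real) \<Rightarrow> 'j \<Rightarrow> real" where "F f \<equiv> fcoef S f n"
abbreviation Dt :: "est \<Rightarrow> real \<Rightarrow> ('x \<Rightarrow> real) \<Rightarrow> real" where "Dt k \<equiv> Dtot k S n"
abbreviation err :: "('x \<Rightarrow> real) \<Rightarrow> real \<Rightarrow> 'w \<Rightarrow> real" where
  "err f c \<omega> \<equiv> \<Sum>j\<in>J. (F f j / (1 + c * lam j) - wt c j * Z \<omega> j)\<^sup>2"

sublocale onb N J "eigvec S n"
  using model by unfold_locales (auto simp: regression_model_def)

sublocale noise: gaussian_noise P N "noise S n"
  using model by (auto simp: regression_model_def gaussian_noise_def gaussian_noise_axioms_def)

lemma Umat_spec: "Umat S n = spec (lam)"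
  using model by (intro spec_eigenI) (auto simp: regression_model_def Umat_def)

text \<open>An eigenvalue is the quadratic form of the covariance matrix at a unit eigenvector, that
  is, the variance of a linear combination of the prior process at the design points.\<close>

lemma eigval_nonneg:
  assumes j: "j \<in> J"
  shows "0 \<le> lam j"
proof -
  let ?P = "prior_space S" and ?e = "eigvec S n j" and ?N = "N"
  have gp: "centered_gaussian_process ?P (prior_process S)"
    using model by (simp add: regression_model_def)
  then interpret P: prob_space ?P by (simp add: centered_gaussian_process_def)
  define W where "W i = prior_process S (design S n i)" for i
  have [measurable]: "W i \<in> borel_measurable ?P" for i
    using gp by (simp add: centered_gaussian_process_def W_def)
  have W2: "integrable ?P (\<lambda>\<omega>. (W i \<omega>)\<^sup>2)" for i
  proof -
    have "finite T \<Longrightarrow> \<exists>\<sigma>. normal_rv ?P (\<lambda>\<omega>. \<Sum>t\<in>T. a t * prior_process S t \<omega>) 0 \<sigma>" for T a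
      using gp unfolding centered_gaussian_process_def by blast
    from this[of "{design S n i}" "\<lambda>_. 1"]
    show ?thesis
      using square_integrable_normal_rv[OF P.prob_space_axioms] by (auto simp: W_def)
  qed
  have W1: "integrable ?P (W i)" for i
    using P.square_integrable_imp_integrable[OF _ W2[of i]] by simp
  define X where "X i \<omega> = W i \<omega> - (\<integral>\<omega>'. W i \<omega>' \<partial>?P)" for i \<omega>
  have X2: "integrable ?P (\<lambda>\<omega>. (X i \<omega>)\<^sup>2)" for i
    unfolding X_def power2_diff using W1 W2 by (intro Bochner_Integration.integrable_add Bochner_Integration.integrable_diff) auto
  have [measurable]: "X i \<in> borel_measurable ?P" for i unfolding X_def[abs_def] by measurable
  \<comment> \<open>Products of square integrable variables are dominated by the sum of the squares;
    with this, sum and integral may be exchanged.\<close>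
  have XX: "integrable ?P (\<lambda>\<omega>. X i \<omega> * X k \<omega>)" for i k
  proof (rule Bochner_Integration.integrable_bound)
    show "integrable ?P (\<lambda>\<omega>. (X i \<omega>)\<^sup>2 + (X k \<omega>)\<^sup>2)" using X2 by simp
    show "AE \<omega> in ?P. norm (X i \<omega> * X k \<omega>) \<le> norm ((X i \<omega>)\<^sup>2 + (X k \<omega>)\<^sup>2)"
    proof (rule AE_I2)
      fix \<omega>
      have "2 * (\<bar>X i \<omega>\<bar> * \<bar>X k \<omega>\<bar>) \<le> (X i \<omega>)\<^sup>2 + (X k \<omega>)\<^sup>2"
        using sum_squares_bound[of "\<bar>X i \<omega>\<bar>" "\<bar>X k \<omega>\<bar>"] by simp
      moreover have "0 \<le> \<bar>X i \<omega>\<bar> * \<bar>X k \<omega>\<bar>" by (intro mult_nonneg_nonneg) auto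
      ultimately have "\<bar>X i \<omega>\<bar> * \<bar>X k \<omega>\<bar> \<le> (X i \<omega>)\<^sup>2 + (X k \<omega>)\<^sup>2" by linarith
      then show "norm (X i \<omega> * X k \<omega>) \<le> norm ((X i \<omega>)\<^sup>2 + (X k \<omega>)\<^sup>2)"
        by (simp add: abs_mult)
    qed
  qed measurable
  have "?e \<bullet> (Umat S n *\<^sub>v ?e) = lam j"
    using model j e_orth[OF j j] e_carrier[OF j] by (simp add: regression_model_def)
  moreover have "?e \<bullet> (Umat S n *\<^sub>v ?e) = (\<Sum>i<?N. \<Sum>k<?N. ?e $ i * ?e $ k * (\<integral>\<omega>. X i \<omega> * X k \<omega> \<partial>?P))"
    using e_dim[OF j]
    by (simp add: scalar_prod_def Umat_def lessThan_atLeast0[symmetric] covariance_def X_def W_def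
        sum_distrib_left mult_ac)
  moreover have "\<dots> = (\<integral>\<omega>. (\<Sum>i<?N. \<Sum>k<?N. ?e $ i * ?e $ k * (X i \<omega> * X k \<omega>)) \<partial>?P)"
    using XX by (simp add: Bochner_Integration.integral_sum)
  moreover have "\<dots> = (\<integral>\<omega>. (\<Sum>i<?N. ?e $ i * X i \<omega>)\<^sup>2 \<partial>?P)"
    by (simp add: power2_eq_square sum_product mult_ac)
  moreover have "0 \<le> \<dots>" by (rule integral_nonneg_AE) simp
  ultimately show ?thesis by simp
qed

lemma one_plus_pos: "0 \<le> c \<Longrightarrow> j \<in> J \<Longrightarrow> 0 < 1 + c * lam j"
  using eigval_nonneg[of j] by (simp add: add_pos_nonneg)

lemma SigmaMat_spec: "SigmaMat S n c = spec (\<lambda>j. 1 + c * lam j)"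
  by (simp add: SigmaMat_def Umat_spec spec_smult spec_add spec_one[symmetric])

lemma minv_SigmaMat:
  assumes "0 \<le> c"
  shows "minv (SigmaMat S n c) = spec (\<lambda>j. 1 / (1 + c * lam j))"
  unfolding SigmaMat_spec using one_plus_pos[OF assms] by (intro minv_spec) force

lemma post_cov_spec:
  assumes "0 \<le> c"
  shows "post_cov S n c = spec (\<lambda>j. wt c j)"
proof -
  have "post_cov S n c = spec (\<lambda>j. 1 - 1 / (1 + c * lam j))"
    by (simp add: post_cov_def minv_SigmaMat[OF assms] spec_diff spec_one[symmetric])
  also have "\<dots> = spec (\<lambda>j. wt c j)"
  proof (rule spec_cong)
    fix j assume j: "j \<in> J"
    show "1 - 1 / (1 + c * lam j) = wt c j"
      using one_plus_pos[OF assms j] by (simp add: divide_simps)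
  qed
  finally show ?thesis .
qed

lemma fvec_carrier: "fvec S f n \<in> carrier_vec N"
  and noise_vec_carrier: "noise_vec S n \<omega> \<in> carrier_vec N"
  and obs_carrier: "obs S f n \<omega> \<in> carrier_vec N"
  by (simp_all add: fvec_def noise_vec_def obs_def)

lemma obs_coef:
  assumes "j \<in> J"
  shows "obs S f n \<omega> \<bullet> eigvec S n j = F f j + Z \<omega> j"
  unfolding obs_def fcoef_def zcoef_def
  by (rule add_scalar_prod_distrib[OF fvec_carrier noise_vec_carrier e_carrier[OF assms]])

text \<open>Split each squared noise coefficient into its centred part and its mean 1. In the risk
  criterion the trace of the squared inverse cancels the mean part; in the likelihood criterion the
  mean part turns \<open>ln (1 + c * lam j)\<close> into the summand of \<open>D2\<close>. The last
  sum is free of \<open>c\<close>, so it does not affect minimisers.\<close>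

lemma criterion_eq:
  assumes c: "0 \<le> c"
  shows "criterion k S n (obs S f n \<omega>) c = Dt k c f + R1 k S n c f \<omega> + R2 k S n c \<omega>
    + (\<Sum>j\<in>J. (Z \<omega> j)\<^sup>2 - (if k = Risk then 1 else 0))"
proof (cases k)
  case Risk
  have "criterion Risk S n (obs S f n \<omega>) c = (\<Sum>j\<in>J.
      (wt c j)\<^sup>2 - 1 / (1 + c * lam j)\<^sup>2
      + (F f j + Z \<omega> j)\<^sup>2 / (1 + c * lam j)\<^sup>2)"
    using c by (simp add: minv_SigmaMat post_cov_spec spec_mult trace_spec
        quad_spec[OF obs_carrier obs_carrier] obs_coef sum.distrib sum_subtractf
        power2_eq_square mult.assoc cong: sum.cong)
  also have "\<dots> = (\<Sum>j\<in>J. (F f j)\<^sup>2 / (1 + c * lam j)\<^sup>2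
      + (c * lam j)\<^sup>2 / (1 + c * lam j)\<^sup>2
      + 2 * (Z \<omega> j * F f j / (1 + c * lam j)\<^sup>2)
      + ((Z \<omega> j)\<^sup>2 - 1) * (1 / (1 + c * lam j)\<^sup>2 - 1) + ((Z \<omega> j)\<^sup>2 - 1))"
    by (intro sum.cong refl)
      (simp add: power_divide power2_sum add_divide_distrib diff_divide_distrib algebra_simps)
  finally show ?thesis
    by (simp add: Risk Dtot_def sum.distrib sum_distrib_left)
next
  case Likelihood
  have "criterion Likelihood S n (obs S f n \<omega>) c = (\<Sum>j\<in>J. ln (1 + c * lam j)
      + (F f j + Z \<omega> j)\<^sup>2 / (1 + c * lam j))"
  proof -
    have "ln (\<Prod>j\<in>J. 1 + c * lam j) = (\<Sum>j\<in>J. ln (1 + c * lam j))"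
      using one_plus_pos[OF c] by (intro ln_prod[OF finite_J]) force
    then show ?thesis
      using c by (simp add: SigmaMat_spec[of c] det_spec minv_SigmaMat[unfolded SigmaMat_spec]
          quad_spec[OF obs_carrier obs_carrier] obs_coef sum.distrib
          power2_eq_square mult.assoc cong: sum.cong)
  qed
  also have "\<dots> = (\<Sum>j\<in>J. (F f j)\<^sup>2 / (1 + c * lam j)
      + (ln (1 + c * lam j) - wt c j)
      + 2 * (Z \<omega> j * F f j / (1 + c * lam j))
      - ((Z \<omega> j)\<^sup>2 - 1) * (c * lam j) / (1 + c * lam j) + (Z \<omega> j)\<^sup>2)"
  proof (intro sum.cong refl)
    fix j assume j: "j \<in> J"
    have *: "wt c j = 1 - 1 / (1 + c * lam j)"
      using one_plus_pos[OF c j] by (simp add: field_simps)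
    have **: "((Z \<omega> j)\<^sup>2 - 1) * (c * lam j) / (1 + c * lam j)
       = ((Z \<omega> j)\<^sup>2 - 1) * (1 - 1 / (1 + c * lam j))"
      unfolding *[symmetric] by simp
    show "ln (1 + c * lam j)
      + (F f j + Z \<omega> j)\<^sup>2 / (1 + c * lam j) = (F f j)\<^sup>2 / (1 + c * lam j)
      + (ln (1 + c * lam j) - wt c j)
      + 2 * (Z \<omega> j * F f j / (1 + c * lam j))
      - ((Z \<omega> j)\<^sup>2 - 1) * (c * lam j) / (1 + c * lam j) + (Z \<omega> j)\<^sup>2"
      unfolding * ** by (simp add: power2_sum add_divide_distrib algebra_simps)
  qed
  finally show ?thesis
    by (simp add: Likelihood Dtot_def sum.distrib sum_subtractf sum_distrib_left)
qed

lemma post_error_eq: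
  assumes c: "0 \<le> c"
  shows "(vnorm (fvec S f n - post_mean S n c (obs S f n \<omega>)))\<^sup>2
    = err f c \<omega>"
proof -
  let ?v = "fvec S f n - post_mean S n c (obs S f n \<omega>)"
  have pm: "post_mean S n c (obs S f n \<omega>) \<in> carrier_vec N"
    unfolding post_mean_def post_cov_spec[OF c] by (rule mult_mat_vec_carrier[OF spec_carrier obs_carrier])
  have v: "?v \<in> carrier_vec N" using fvec_carrier pm by simp
  have "(vnorm ?v)\<^sup>2 = ?v \<bullet> ?v"
    unfolding vnorm_def using parseval[OF v] by (simp add: sum_nonneg)
  also have "\<dots> = (\<Sum>j\<in>J. (?v \<bullet> eigvec S n j)\<^sup>2)" by (rule parseval[OF v])
  also have "\<dots> = err f c \<omega>"
  proof (intro sum.cong refl)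
    fix j assume j: "j \<in> J"
    have "?v \<bullet> eigvec S n j = F f j - wt c j * (F f j + Z \<omega> j)"
      using minus_scalar_prod_distrib[OF fvec_carrier pm e_carrier[OF j]] j
      by (simp add: fcoef_def[symmetric] post_mean_def post_cov_spec[OF c] spec_mult_vec_coef[OF obs_carrier] obs_coef)
    also have "\<dots> = F f j / (1 + c * lam j) - wt c j * Z \<omega> j"
    proof -
      have *: "wt c j = 1 - 1 / (1 + c * lam j)"
        using one_plus_pos[OF c j] by (simp add: field_simps)
      show ?thesis unfolding * by (simp add: algebra_simps)
    qed
    finally show "(?v \<bullet> eigvec S n j)\<^sup>2 = (F f j / (1 + c * lam j)
        - wt c j * Z \<omega> j)\<^sup>2" by simp
  qed
  finally show ?thesis .
qed

text \<open>The expansion of the squared error produces the risk functions whichever criterion has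
  selected \<open>c\<close>; \<open>Dtot_Risk_le\<close> leads back to the criterion at
  hand.\<close>

lemma post_error_decomp:
  assumes c: "0 \<le> c"
  shows "(vnorm (fvec S f n - post_mean S n c (obs S f n \<omega>)))\<^sup>2
    = Dt Risk c f + R3 S n c f \<omega> + R4 S n c \<omega>"
proof -
  have "(vnorm (fvec S f n - post_mean S n c (obs S f n \<omega>)))\<^sup>2
    = (\<Sum>j\<in>J. (F f j)\<^sup>2 / (1 + c * lam j)\<^sup>2
      + (c * lam j)\<^sup>2 / (1 + c * lam j)\<^sup>2
      + - 2 * (c * lam j * Z \<omega> j * F f j / (1 + c * lam j)\<^sup>2)
      + (c * lam j)\<^sup>2 * ((Z \<omega> j)\<^sup>2 - 1) / (1 + c * lam j)\<^sup>2)"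
    unfolding post_error_eq[OF c]
    by (intro sum.cong refl) (simp add: power2_diff power_divide power_mult_distrib algebra_simps
        diff_divide_distrib power2_eq_square)
  then show ?thesis
    by (simp add: Dtot_def R3_def R4_def sum.distrib sum_distrib_left sum_negf sum_subtractf)
qed

lemma zcoef_lin: "j \<in> J \<Longrightarrow> Z \<omega> j = noise.lin (\<lambda>i. eigvec S n j $ i) \<omega>"
  by (simp add: zcoef_def noise_vec_def vec_inner_e noise.lin_def mult.commute)

lemma zcoef_measurable [measurable]: "j \<in> J \<Longrightarrow> (\<lambda>\<omega>. Z \<omega> j) \<in> borel_measurable P"
  using noise.lin_measurable by (simp add: zcoef_lin)

end

section \<open>Monotonicity and comparison of the bias and variance functions\<close>

context regression_at
begin

lemma eigval_mult_nonneg: "0 \<le> c \<Longrightarrow> j \<in> J \<Longrightarrow> 0 \<le> c * lam j"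
  using eigval_nonneg by simp

lemma D2_Likelihood: "D2 Likelihood S n c = (\<Sum>j\<in>J. kl (c * lam j))"
  by (simp add: kl_def)

lemma D2_nonneg: "0 \<le> c \<Longrightarrow> 0 \<le> D2 k S n c"
  by (cases k) (auto simp: kl_def[symmetric] intro!: sum_nonneg kl_nonneg eigval_mult_nonneg)

lemma D1_nonneg: "0 \<le> c \<Longrightarrow> 0 \<le> D1 k S n c f"
  by (cases k) (auto intro!: sum_nonneg divide_nonneg_nonneg add_nonneg_nonneg eigval_mult_nonneg)

lemma Dtot_nonneg: "0 \<le> c \<Longrightarrow> 0 \<le> Dt k c f"
  by (simp add: Dtot_def D1_nonneg D2_nonneg)

lemma D2_mono:
  assumes "0 \<le> c" "c \<le> c'"
  shows "D2 k S n c \<le> D2 k S n c'"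
proof -
  have le: "0 \<le> c * lam j" "c * lam j \<le> c' * lam j" if "j \<in> J" for j
    using assms eigval_nonneg[OF that] by (auto intro: mult_right_mono)
  show ?thesis
    by (cases k) (auto simp: kl_def[symmetric] sq_shrink intro!: sum_mono kl_mono power_mono shrink_mono le divide_nonneg_nonneg add_nonneg_nonneg)
qed

lemma D2_scale:
  assumes "0 \<le> c" "1 \<le> K"
  shows "D2 k S n (K * c) \<le> K\<^sup>2 * D2 k S n c"
proof (cases k)
  case Likelihood
  have "(\<Sum>j\<in>J. kl (K * (c * lam j))) \<le> (\<Sum>j\<in>J. K\<^sup>2 * kl (c * lam j))"
    using assms by (intro sum_mono kl_scale eigval_mult_nonneg)
  then show ?thesis unfolding Likelihood D2_Likelihood by (simp add: sum_distrib_left mult.assoc)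
next
  case Risk
  have "(K * c * lam j)\<^sup>2 / (1 + K * c * lam j)\<^sup>2
     \<le> K\<^sup>2 * ((c * lam j)\<^sup>2 / (1 + c * lam j)\<^sup>2)" if j: "j \<in> J" for j
  proof -
    have x: "0 \<le> c * lam j" using eigval_mult_nonneg assms j by blast
    have "c * lam j \<le> K * (c * lam j)" using mult_right_mono[of 1 K, OF _ x] assms by simp
    then have "(K * (c * lam j))\<^sup>2 / (1 + K * (c * lam j))\<^sup>2
        \<le> (K * (c * lam j))\<^sup>2 / (1 + c * lam j)\<^sup>2"
      using x by (intro divide_left_mono power_mono mult_pos_pos zero_less_power) auto
    then show ?thesis by (simp add: power_mult_distrib mult.assoc)
  qed
  then have "(\<Sum>j\<in>J. (K * c * lam j)\<^sup>2 / (1 + K * c * lam j)\<^sup>2)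
     \<le> (\<Sum>j\<in>J. K\<^sup>2 * ((c * lam j)\<^sup>2 / (1 + c * lam j)\<^sup>2))"
    by (rule sum_mono)
  then show ?thesis unfolding Risk by (simp add: sum_distrib_left)
qed

lemma D1_le_sum:
  assumes "0 \<le> c"
  shows "D1 k S n c f \<le> (\<Sum>j\<in>J. (F f j)\<^sup>2)"
proof -
  have "x / (1 + c * lam j) \<le> x" "x / (1 + c * lam j)\<^sup>2 \<le> x" if "j \<in> J" "0 \<le> x" for x j
  proof -
    have "1 \<le> 1 + c * lam j" using eigval_mult_nonneg[OF assms that(1)] by simp
    then show "x / (1 + c * lam j) \<le> x" "x / (1 + c * lam j)\<^sup>2 \<le> x"
      using that(2) one_le_power[of "1 + c * lam j" 2]
        divide_left_mono[of 1 "1 + c * lam j" x] divide_left_mono[of 1 "(1 + c * lam j)\<^sup>2" x]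
      by simp_all
  qed
  then show ?thesis by (cases k) (auto intro!: sum_mono)
qed

lemma D1_Risk_le:
  assumes "0 \<le> c"
  shows "D1 Risk S n c f \<le> D1 k S n c f"
proof -
  have "(F f j)\<^sup>2 / (1 + c * lam j)\<^sup>2 \<le> (F f j)\<^sup>2 / (1 + c * lam j)"
    if "j \<in> J" for j
  proof -
    have "1 \<le> 1 + c * lam j" using eigval_mult_nonneg[OF assms that(1)] by simp
    then have "1 + c * lam j \<le> (1 + c * lam j)\<^sup>2"
      by (simp add: power2_eq_square mult_le_cancel_left1)
    then show ?thesis using one_plus_pos[OF assms that] by (intro divide_left_mono) auto
  qed
  then show ?thesis by (cases k) (auto intro!: sum_mono)
qed

lemma D2_Risk_le:
  assumes "0 \<le> c"
  shows "D2 Risk S n c \<le> 2 * D2 k S n c"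
proof (cases k)
  case Risk
  then show ?thesis using D2_nonneg[OF assms, of Risk] by simp
next
  case Likelihood
  show ?thesis unfolding Likelihood D2_Likelihood D2.simps(1) sum_distrib_left
    by (intro sum_mono sq_le_kl eigval_mult_nonneg assms)
qed

lemma Dtot_Risk_le: "0 \<le> c \<Longrightarrow> Dt Risk c f \<le> 2 * Dt k c f"
  using D1_Risk_le[of c f k] D2_Risk_le[of c k] D1_nonneg[of c k f] by (simp add: Dtot_def)

lemma D2_Risk_le_s2:
  assumes "0 \<le> c"
  shows "D2 Risk S n c \<le> s2 S n c"
  unfolding s2_def D2.simps sq_shrink
proof (rule sum_mono)
  fix j assume "j \<in> J"
  then have "0 \<le> c * lam j" using eigval_mult_nonneg assms by blast
  then have "0 \<le> wt c j" "wt c j \<le> 1"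
    by (auto simp: divide_le_eq)
  from mult_left_mono[OF this(2,1)]
  show "(wt c j)\<^sup>2 \<le> wt c j"
    by (simp only: power2_eq_square mult_1_right)
qed

subsection \<open>The radius\<close>

lemma wt_nonneg: "0 \<le> c \<Longrightarrow> j \<in> J \<Longrightarrow> 0 \<le> wt c j"
  using eigval_mult_nonneg by simp

lemma wt_pos: "0 < c \<Longrightarrow> 0 < lam j \<Longrightarrow> 0 < wt c j"
  by (simp add: add_pos_pos)

lemma radius_quantile:
  assumes c: "0 < c" and j0: "j0 \<in> J" "0 < lam j0" and \<eta>: "0 < \<eta>" "\<eta> < 1"
  shows "0 \<le> radius S n c \<eta>"
    and "qcdf (wt c) (radius S n c \<eta>) = \<eta>"
proof -
  have nn: "0 \<le> wt c j" if "j \<in> J" for j using wt_nonneg[of c] c that by simp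
  have "radius S n c \<eta> = (THE r. 0 \<le> r \<and> qcdf (wt c) r = \<eta>)"
  proof -
    have "measure (mv_normal N (0\<^sub>v N) (spec (wt c)))
        {y \<in> space (\<Pi>\<^sub>M i\<in>{..<N}. borel). vnorm (vec N y) < r}
      = qcdf (wt c) r" for r
      by (rule mv_normal_ball) (rule nn)
    then show ?thesis by (simp only: radius_def post_cov_spec[OF less_imp_le[OF c]])
  qed
  moreover have "\<exists>!r. 0 \<le> r \<and> qcdf (wt c) r = \<eta>"
    by (rule qform_quantile[of "wt c" j0, OF nn j0(1) wt_pos[OF c j0(2)] \<eta>])
  ultimately show "0 \<le> radius S n c \<eta>"
    and "qcdf (wt c) (radius S n c \<eta>) = \<eta>"
    using theI'[of "\<lambda>r. 0 \<le> r \<and> qcdf (wt c) r = \<eta>"] by simp_all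
qed

lemma radius_mono:
  assumes c: "0 < c" "c \<le> c'" and j0: "j0 \<in> J" "0 < lam j0" and \<eta>: "0 < \<eta>" "\<eta> < 1"
  shows "radius S n c \<eta> \<le> radius S n c' \<eta>"
proof -
  have c': "0 < c'" using c by simp
  show ?thesis
  proof (rule quantile_mono[of "wt c" j0 "wt c'", OF _ j0(1) wt_pos[OF c(1) j0(2)] _ \<eta>
        radius_quantile(2)[OF c(1) j0 \<eta>] radius_quantile(1)[OF c(1) j0 \<eta>]
        radius_quantile(2)[OF c' j0 \<eta>] radius_quantile(1)[OF c' j0 \<eta>]])
    fix j assume j: "j \<in> J"
    show "0 \<le> wt c j" using wt_nonneg[of c j] c j by simp
    show "wt c j \<le> wt c' j"
      using c j by (intro shrink_mono eigval_mult_nonneg mult_right_mono eigval_nonneg) auto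
  qed
qed

text \<open>The radius refers to a Gaussian ball, concentration to the noise. They meet here because
  \<open>Nstat\<close> is the quadratic form with weights \<open>wt c\<close> evaluated at the
  noise.\<close>

lemma Nstat_law:
  assumes "0 < N"
  shows "measure P {\<omega> \<in> space P. Nstat S n c \<omega> < t}
    = measure \<gamma> {z \<in> space \<gamma>. qform (wt c) z < t}"
proof -
  let ?T = "\<lambda>\<omega>. \<lambda>i\<in>{..<N}. noise S n i \<omega>"
  have T: "?T \<in> measurable P (\<Pi>\<^sub>M i\<in>{..<N}. borel)"
    by (intro measurable_restrict noise.eps_measurable) simp
  have q: "qform (wt c) (?T \<omega>) = Nstat S n c \<omega>" for \<omega>
  proof -
    have "vec N (?T \<omega>) = noise_vec S n \<omega>" unfolding noise_vec_def by auto
    then show ?thesis by (simp add: qform_def Nstat_def zcoef_def mult.assoc)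
  qed
  have S: "{z \<in> space (\<Pi>\<^sub>M i\<in>{..<N}. borel). qform (wt c) z < t} \<in> sets (\<Pi>\<^sub>M i\<in>{..<N}. borel)"
    by measurable
  have "measure \<gamma> {z \<in> space \<gamma>. qform (wt c) z < t}
     = measure P (?T -` {z \<in> space (\<Pi>\<^sub>M i\<in>{..<N}. borel). qform (wt c) z < t} \<inter> space P)"
    unfolding space_std_normal_vec noise.distr_eps[OF assms, symmetric] by (simp add: measure_distr[OF T S])
  also have "?T -` {z \<in> space (\<Pi>\<^sub>M i\<in>{..<N}. borel). qform (wt c) z < t} \<inter> space P
    = {\<omega> \<in> space P. Nstat S n c \<omega> < t}"
    using measurable_space[OF T] q by auto
  finally show ?thesis ..
qed

text \<open>The squared radius is the \<open>\<eta>\<close>-quantile of the law of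
  \<open>Nstat\<close>; if it were below \<open>t\<close>, the event \<open>Nstat < t\<close> would
  have probability at least \<open>\<eta>\<close>.\<close>

lemma radius_lower:
  assumes c: "0 < c" and j0: "j0 \<in> J" "0 < lam j0" and \<eta>: "0 < \<eta>" "\<eta> < 1"
    and less: "measure P {\<omega> \<in> space P. Nstat S n c \<omega> < t} < \<eta>"
  shows "t \<le> (radius S n c \<eta>)\<^sup>2"
proof (rule ccontr)
  interpret P: prob_space "\<gamma>" by (rule prob_space_std_normal_vec)
  assume "\<not> ?thesis"
  then have lt: "(radius S n c \<eta>)\<^sup>2 < t" by simp
  note r = radius_quantile[OF c j0 \<eta>]
  have "0 < N" using card_J finite_J j0 by (metis card_gt_0_iff empty_iff)
  note law = Nstat_law[OF this, of c t]
  have "qcdf (wt c) (radius S n c \<eta>)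
    \<le> measure \<gamma> {z \<in> space \<gamma>. qform (wt c) z < t}"
  proof (rule P.finite_measure_mono)
    show "{z \<in> space \<gamma>. sqrt (qform (wt c) z) < radius S n c \<eta>}
      \<subseteq> {z \<in> space \<gamma>. qform (wt c) z < t}"
    proof safe
      fix z assume "sqrt (qform (wt c) z) < radius S n c \<eta>"
      then have "sqrt (qform (wt c) z) < sqrt ((radius S n c \<eta>)\<^sup>2)" using r(1) by simp
      then show "qform (wt c) z < t" using lt unfolding real_sqrt_less_iff by simp
    qed
  qed measurable
  then show False using less law r(2) by simp
qed

lemma s2_pos_imp:
  assumes "0 < s2 S n c" "0 \<le> c"
  obtains j0 where "j0 \<in> J" "0 < lam j0"
proof -
  have "\<exists>j\<in>J. lam j \<noteq> 0"
  proof (rule ccontr)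
    assume "\<not> ?thesis"
    then have "s2 S n c = 0" by (simp add: s2_def)
    then show False using assms by simp
  qed
  then show thesis using that eigval_nonneg by (metis less_eq_real_def)
qed

text \<open>The random \<open>c\<close> enters both the centre and the radius. The error is a
  rational expression in \<open>h \<omega>\<close> and the noise coefficients; the radius is Borel
  because it is monotone in \<open>c\<close>.\<close>

lemma credible_event_measurable:
  assumes chat: "h \<in> borel_measurable P" and pos: "\<And>\<omega>. \<omega> \<in> space P \<Longrightarrow> 0 < h \<omega>"
    and j0: "j0 \<in> J" "0 < lam j0" and \<eta>: "0 < \<eta>" "\<eta> < 1"
  shows "{\<omega> \<in> space P. f \<in> credible_set S n \<eta> M (h \<omega>) (obs S f n \<omega>)} \<in> sets P"
proof -
  \<comment> \<open>At \<open>c \<le> 0\<close> nothing is known about the radius; the value 0 there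
    makes \<open>\<rho>\<close> monotone on the whole line.\<close>
  define \<rho> where "\<rho> c = (if 0 < c then radius S n c \<eta> else 0)" for c
  have "mono \<rho>"
    by (rule monoI) (auto simp: \<rho>_def radius_mono[OF _ _ j0 \<eta>] radius_quantile(1)[OF _ j0 \<eta>])
  then have [measurable]: "\<rho> \<in> borel_measurable borel" by (rule borel_measurable_mono)
  note [measurable] = chat
  have m: "(\<lambda>\<omega>. \<Sum>j\<in>J. (F f j / (1 + h \<omega> * lam j)
        - wt (h \<omega>) j * Z \<omega> j)\<^sup>2) \<in> borel_measurable P"
    by measurable
  have nn: "0 \<le> vnorm v" for v
    unfolding vnorm_def scalar_prod_def by (intro real_sqrt_ge_zero sum_nonneg) simp
  have "{\<omega> \<in> space P. f \<in> credible_set S n \<eta> M (h \<omega>) (obs S f n \<omega>)}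
    = {\<omega> \<in> space P. sqrt (err f (h \<omega>) \<omega>) < M * \<rho> (h \<omega>)}"
  proof (intro Collect_cong conj_cong refl)
    fix \<omega> assume \<omega>: "\<omega> \<in> space P"
    have "sqrt (err f (h \<omega>) \<omega>)
      = vnorm (fvec S f n - post_mean S n (h \<omega>) (obs S f n \<omega>))"
      using post_error_eq[OF less_imp_le[OF pos[OF \<omega>]], of f \<omega>, symmetric] nn
      by (simp only: real_sqrt_abs abs_of_nonneg)
    then show "(f \<in> credible_set S n \<eta> M (h \<omega>) (obs S f n \<omega>)) = (sqrt (err f (h \<omega>) \<omega>) < M * \<rho> (h \<omega>))"
      using pos[OF \<omega>] by (simp only: credible_set_def \<rho>_def mem_Collect_eq if_True)
  qed
  also have "\<dots> \<in> sets P" using m by measurable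
  finally show ?thesis .
qed

section \<open>From uniform remainder bounds to coverage\<close>

text \<open>The criterion is \<open>Dtot\<close> up to small remainders and a constant, so a minimiser nearly minimises \<open>Dtot\<close>.
  Comparing it with \<open>K\<close> times the minimiser, the good bias condition bounds the bias part \<open>D1\<close> by \<open>D2\<close>;
  if that point leaves the range, the bound on the sum of squares does.\<close>

lemma bias_le_variance:
  assumes c: "0 < l" "{l..u} = Iset S m n" "c \<in> {l..u}"
    and min: "\<And>c'. c' \<in> {l..u} \<Longrightarrow> criterion k S n (obs S f n \<omega>) c \<le> criterion k S n (obs S f n \<omega>) c'"
    and rem: "\<And>c. c \<in> {l..u} \<Longrightarrow> \<bar>R1 k S n c f \<omega>\<bar> + \<bar>R2 k S n c \<omega>\<bar> \<le> Dt k c f / 3"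
    and K: "1 < K" "D1 k S n (K * c) f \<le> D1 k S n c f / 4"
    and sum: "(\<Sum>j\<in>J. (F f j)\<^sup>2) \<le> (SUP c\<in>{l..u}. D2 k S n c)"
  shows "D1 k S n c f \<le> 4 * K\<^sup>2 * D2 k S n c"
proof -
  have c0: "0 < c" and K0: "1 \<le> K" using c(1,3) K by auto
  have scale: "D2 k S n (K * c) \<le> K\<^sup>2 * D2 k S n c" using D2_scale[of c K k] c0 K0 by simp
  show ?thesis
  proof (cases "K * c \<le> u")
    case True
    have "c \<le> K * c" using K0 c0 by simp
    moreover have "l \<le> c" using c(3) by simp
    ultimately have "l \<le> K * c" by linarith
    then have I: "K * c \<in> {l..u}" using True by auto
    then have "0 \<le> K * c" using c(1) by auto
    \<comment> \<open>Up to the common term free of \<open>c\<close>, the criterion lies between 2/3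
      and 4/3 of \<open>Dt\<close>, so minimality costs a factor 2.\<close>
    then have "Dt k c f \<le> 2 * Dt k (K * c) f"
      using min[OF I] rem[OF I] rem[OF c(3)] criterion_eq[of c k f \<omega>] criterion_eq[of "K * c" k f \<omega>] c0
      by simp
    \<comment> \<open>With all functions taken at \<open>c\<close>,
      \<open>D1 + D2 \<le> 2 * (D1 / 4 + K\<^sup>2 * D2)\<close>, and half of \<open>D1\<close> can
      be moved to the left.\<close>
    then show ?thesis using K(2) scale D2_nonneg[of c k] D1_nonneg[of c k f] c0 by (simp add: Dtot_def)
  next
    case False
    have bdd: "D2 k S n x \<le> D2 k S n (K * c)" if "x \<in> {l..u}" for x
      using False c(1,3) that by (intro D2_mono) auto
    have "D1 k S n c f \<le> (SUP c\<in>{l..u}. D2 k S n c)"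
      using D1_le_sum[of c k f] c0 sum by simp
    also have "\<dots> \<le> D2 k S n (K * c)"
      using c(3) bdd by (intro cSUP_least) auto
    also note scale
    also have "K\<^sup>2 * D2 k S n c \<le> 4 * K\<^sup>2 * D2 k S n c"
      using D2_nonneg[of c k] c0 by simp
    finally show ?thesis .
  qed
qed

end

lemma eventually_measure_ge_imp_tendsto_1:
  assumes "\<And>n. prob_space (P n)" and lim: "(\<lambda>n. measure (P n) (E n)) \<longlonglongrightarrow> 1"
    and ev: "\<forall>\<^sub>F n in sequentially. E n \<subseteq> A n \<and> A n \<in> sets (P n)"
  shows "(\<lambda>n. measure (P n) (A n)) \<longlonglongrightarrow> 1"
proof (rule tendsto_sandwich[OF _ _ lim tendsto_const])
  show "\<forall>\<^sub>F n in sequentially. measure (P n) (E n) \<le> measure (P n) (A n)"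
    using ev
  proof eventually_elim
    case (elim n)
    interpret prob_space "P n" by fact
    show ?case using elim by (intro finite_measure_mono) auto
  qed
  show "\<forall>\<^sub>F n in sequentially. measure (P n) (A n) \<le> 1"
    using assms(1) prob_space.prob_le_1 by (intro always_eventually) blast
qed

abbreviation small_remainders ::
  "est \<Rightarrow> ('x, 'v, 'w, 'j) regression \<Rightarrow> nat \<Rightarrow> ('x \<Rightarrow> real) \<Rightarrow> real \<Rightarrow> 'w \<Rightarrow> bool" where
  "small_remainders k S n f c \<omega> \<equiv>
     \<bar>R1 k S n c f \<omega>\<bar> + \<bar>R2 k S n c \<omega>\<bar> \<le> Dtot k S n c f / 3 \<and>
     \<bar>R3 S n c f \<omega>\<bar> + \<bar>R4 S n c \<omega>\<bar> \<le> Dtot k S n c f"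

abbreviation prob_small_Nstat :: "('x, 'v, 'w, 'j) regression \<Rightarrow> nat \<Rightarrow> real \<Rightarrow> real" where
  "prob_small_Nstat S n c \<equiv>
     measure (noise_space S n) {\<omega> \<in> space (noise_space S n). Nstat S n c \<omega> < s2 S n c / 4}"

text \<open>Both routes to coverage end here. On the event \<open>E\<close> the argument is
  deterministic and holds for every \<open>c\<close> that the estimator may take; the radius enters
  only through the law of \<open>Nstat\<close> at fixed \<open>c\<close>.\<close>

lemma coverage:
  fixes S :: "('x, 'v, 'w, 'j) regression"
  assumes model: "regression_model S" and est: "is_estimator k S m f chat" and bias: "bias_cond k S m f"
    and npts: "\<And>n. n \<le> npts S n"
    and E: "(\<lambda>n. measure (noise_space S n) (E n)) \<longlonglongrightarrow> 1" "\<And>n. E n \<subseteq> space (noise_space S n)"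
    and rem: "\<forall>\<^sub>F n in sequentially. \<forall>\<omega>\<in>E n. \<forall>c\<in>Iset S m n.
      small_remainders k S n f c \<omega>"
    and var: "\<forall>\<^sub>F n in sequentially. \<forall>c\<in>Iset S m n. D2 k S n c \<le> C * s2 S n c \<and> 0 < s2 S n c"
    and rad: "\<And>\<eta>. 0 < \<eta> \<Longrightarrow> \<eta> < 1 \<Longrightarrow> \<forall>\<^sub>F n in sequentially. \<forall>c\<in>Iset S m n.
      prob_small_Nstat S n c < \<eta>"
  shows "covers S f chat"
proof -
  obtain a where a: "0 < a" and gb: "\<And>n c K. n \<ge> 2 \<Longrightarrow> c \<in> Iset S m n \<Longrightarrow> K > 1 \<Longrightarrow>
      D1 k S n (K * c) f \<le> K powr (- a) * D1 k S n c f"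
    using bias unfolding bias_cond_def good_bias_def by blast
  define K :: real where "K = 4 powr (1 / a)"
  have "K powr (- a) = 4 powr (- 1)" using a by (simp only: K_def powr_powr) simp
  then have K: "1 < K" "K powr (- a) = 1 / 4"
    using a by (simp_all add: K_def powr_minus gr_one_powr)
  \<comment> \<open>15 = 3 * 5: the squared error is at most \<open>3 * Dtot\<close>, twice for
    \<open>Dtot Risk\<close> and once for \<open>R3\<close> and \<open>R4\<close>, while
    \<open>Dtot\<close> is at most
    \<open>(4 * K\<^sup>2 + 1) * D2 \<le> 5 * K\<^sup>2 * D2\<close>.\<close>
  define B where "B = 15 * K\<^sup>2 * C"
  have prob: "prob_space (noise_space S n)" for n using model by (simp add: regression_model_def)
  have "\<forall>\<eta>\<in>{0<..<1}. (\<lambda>n. measure (noise_space S n) {\<omega> \<in> space (noise_space S n).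
        f \<in> credible_set S n \<eta> M (chat n \<omega>) (obs S f n \<omega>)}) \<longlonglongrightarrow> 1" if M: "M > 4 * \<bar>B\<bar> + 1" for M
  proof
    fix \<eta> :: real assume "\<eta> \<in> {0<..<1}"
    then have \<eta>: "0 < \<eta>" "\<eta> < 1" by auto
    \<comment> \<open>The 4 undoes the quarter of \<open>s2\<close> by which the squared radius is
      bounded below. The threshold involves no \<open>\<eta>\<close>: a smaller
      \<open>\<eta>\<close> only delays the \<open>n\<close> from which that bound holds.\<close>
    have M2: "4 * B < M\<^sup>2"
    proof -
      have "M * 1 \<le> M * M" using M by (intro mult_left_mono) auto
      then show ?thesis using M by (simp add: power2_eq_square)
    qed
    show "(\<lambda>n. measure (noise_space S n) {\<omega> \<in> space (noise_space S n).
        f \<in> credible_set S n \<eta> M (chat n \<omega>) (obs S f n \<omega>)}) \<longlonglongrightarrow> 1"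
    proof (rule eventually_measure_ge_imp_tendsto_1[OF prob E(1)])
      show "\<forall>\<^sub>F n in sequentially. E n \<subseteq> {\<omega> \<in> space (noise_space S n).
          f \<in> credible_set S n \<eta> M (chat n \<omega>) (obs S f n \<omega>)} \<and>
        {\<omega> \<in> space (noise_space S n). f \<in> credible_set S n \<eta> M (chat n \<omega>) (obs S f n \<omega>)} \<in> sets (noise_space S n)"
        using rem var rad[OF \<eta>] eventually_ge_at_top[of 2]
      proof eventually_elim
        case (elim n)
        interpret regression_at S n by unfold_locales (rule model)
        define l where "l = ln (real (npts S n)) / real (npts S n)"
        define u where "u = real (npts S n) powr (m - 1)"
        have I: "{l..u} = Iset S m n" by (simp add: Iset_def c_range_def l_def u_def)
        have "2 \<le> npts S n" using npts[of n] elim by simp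
        then have l: "0 < l" by (simp add: l_def)
        have ch: "chat n \<in> borel_measurable (noise_space S n)"
          and am: "\<And>\<omega>. \<omega> \<in> space (noise_space S n) \<Longrightarrow>
            is_arg_min (criterion k S n (obs S f n \<omega>)) (\<lambda>c. c \<in> Iset S m n) (chat n \<omega>)"
          using est elim(4) unfolding is_estimator_def by auto
        have chI: "chat n \<omega> \<in> {l..u}" if "\<omega> \<in> space (noise_space S n)" for \<omega>
          using am[OF that] unfolding I is_arg_min_def by simp
        have chpos: "0 < chat n \<omega>" if "\<omega> \<in> space (noise_space S n)" for \<omega>
          using chI[OF that] l by simp
        \<comment> \<open>A sample point is used to exhibit an element of the range, where
          \<open>s2 > 0\<close> yields a positive eigenvalue. If all eigenvalues vanished, the form
          would be 0 and would have no quantile.\<close>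
        obtain \<omega>0 where "\<omega>0 \<in> space (noise_space S n)"
          using prob_space.not_empty[OF prob] by blast
        then obtain j0 where j0: "j0 \<in> idx S n" "0 < eigval S n j0"
          using s2_pos_imp[of "chat n \<omega>0"] elim(2) chI chpos I by (metis less_imp_le)
        have "f \<in> credible_set S n \<eta> M (chat n \<omega>) (obs S f n \<omega>)" if \<omega>: "\<omega> \<in> E n" for \<omega>
        proof -
          have \<omega>S: "\<omega> \<in> space (noise_space S n)" using \<omega> E(2) by blast
          define c where "c = chat n \<omega>"
          have cI: "c \<in> {l..u}" and c0: "0 < c" using chI chpos \<omega>S by (auto simp: c_def)
          have cI': "c \<in> Iset S m n" using cI I by simp
          have "D1 k S n c f \<le> 4 * K\<^sup>2 * D2 k S n c"
          proof (rule bias_le_variance[OF l I cI])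
            fix c' assume "c' \<in> {l..u}"
            then show "criterion k S n (obs S f n \<omega>) c \<le> criterion k S n (obs S f n \<omega>) c'"
              using am[OF \<omega>S] unfolding I is_arg_min_def c_def by (auto simp: not_less)
          next
            show "D1 k S n (K * c) f \<le> D1 k S n c f / 4"
              using gb[OF elim(4) cI' K(1)] by (simp add: K(2))
            show "(\<Sum>j\<in>idx S n. (fcoef S f n j)\<^sup>2) \<le> (SUP c\<in>{l..u}. D2 k S n c)"
              unfolding I using bias elim(4) by (simp add: bias_cond_def)
          qed (use elim(1) \<omega> I K in auto)
          moreover have "1 \<le> K\<^sup>2" using K(1) by (intro one_le_power) simp
          then have "D2 k S n c \<le> K\<^sup>2 * D2 k S n c"
            using D2_nonneg[of c k] c0 by (simp add: mult_le_cancel_right1)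
          ultimately have D: "Dtot k S n c f \<le> 5 * K\<^sup>2 * D2 k S n c" by (simp add: Dtot_def)
          have "(vnorm (fvec S f n - post_mean S n c (obs S f n \<omega>)))\<^sup>2 \<le> 3 * Dtot k S n c f"
          proof -
            have "\<bar>R3 S n c f \<omega>\<bar> + \<bar>R4 S n c \<omega>\<bar> \<le> Dtot k S n c f" using elim(1) \<omega> cI' by blast
            then show ?thesis
              using Dtot_Risk_le[of c f k] c0 post_error_decomp[of c f \<omega>] by simp
          qed
          also have "\<dots> \<le> 15 * K\<^sup>2 * D2 k S n c" using D by (simp add: algebra_simps)
          also have "\<dots> \<le> 15 * K\<^sup>2 * (C * s2 S n c)"
            using elim(2) cI' by (intro mult_left_mono) auto
          also have "\<dots> = B * s2 S n c" by (simp add: B_def)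
          also have "\<dots> < M\<^sup>2 * (s2 S n c / 4)"
            using M2 elim(2) cI' by simp
          also have "\<dots> \<le> M\<^sup>2 * (radius S n c \<eta>)\<^sup>2"
            using elim(3) cI' by (intro mult_left_mono radius_lower[OF c0 j0 \<eta>]) auto
          finally have "(vnorm (fvec S f n - post_mean S n c (obs S f n \<omega>)))\<^sup>2 < (M * radius S n c \<eta>)\<^sup>2"
            by (simp add: power_mult_distrib)
          moreover have "0 \<le> M * radius S n c \<eta>"
            using M radius_quantile(1)[OF c0 j0 \<eta>] by simp
          ultimately show ?thesis
            unfolding credible_set_def c_def[symmetric] using power_less_imp_less_base by blast
        qed
        then show ?case
          using credible_event_measurable[OF ch chpos j0 \<eta>] E(2) by blast
      qed
    qed
  qed
  then show ?thesis
    unfolding covers_def using eventually_gt_at_top[of "4 * \<bar>B\<bar> + 1"] by (rule eventually_mono[rotated])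
qed

section \<open>Coverage under the uniform conditions\<close>

text \<open>By continuity in \<open>c\<close>, exceeding \<open>\<delta>\<close> somewhere means
  exceeding it on a countable dense subset, so the event is a countable union.\<close>

lemma SUP_exceedance_measurable:
  fixes g :: "real \<Rightarrow> 'w \<Rightarrow> real"
  assumes meas: "\<And>c. c \<in> {l..u} \<Longrightarrow> g c \<in> borel_measurable M"
    and cont: "\<And>\<omega>. \<omega> \<in> space M \<Longrightarrow> continuous_on {l..u} (\<lambda>c. g c \<omega>)"
    and nonneg: "\<And>c \<omega>. c \<in> {l..u} \<Longrightarrow> 0 \<le> g c \<omega>" and "l \<le> u"
  shows "{\<omega> \<in> space M. ereal \<delta> < \<bar>SUP c\<in>{l..u}. ereal (g c \<omega>)\<bar>} \<in> sets M"
proof -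
  have SUP: "\<bar>SUP c\<in>{l..u}. ereal (g c \<omega>)\<bar> = (SUP c\<in>{l..u}. ereal (g c \<omega>))" for \<omega>
  proof -
    have "0 \<le> (SUP c\<in>{l..u}. ereal (g c \<omega>))"
      using nonneg[of l \<omega>] \<open>l \<le> u\<close> by (intro SUP_upper2[of l]) auto
    then show ?thesis by simp
  qed
  obtain T where T: "countable T" "T \<subseteq> {l..u}" "{l..u} \<subseteq> closure T"
    using separable[of "{l..u}"] by blast
  have cl: "closure T = {l..u}" using T(2,3) closure_minimal[OF T(2)] by simp
  have "{\<omega> \<in> space M. ereal \<delta> < \<bar>SUP c\<in>{l..u}. ereal (g c \<omega>)\<bar>} = (\<Union>c\<in>T. {\<omega> \<in> space M. \<delta> < g c \<omega>})"
  proof (intro equalityI subsetI)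
    fix \<omega> assume "\<omega> \<in> {\<omega> \<in> space M. ereal \<delta> < \<bar>SUP c\<in>{l..u}. ereal (g c \<omega>)\<bar>}"
    then obtain c where \<omega>: "\<omega> \<in> space M" and c: "c \<in> {l..u}" "\<delta> < g c \<omega>"
      unfolding SUP by (auto simp: less_SUP_iff)
    have "\<exists>t\<in>T. \<delta> < g t \<omega>"
    proof (rule ccontr)
      assume "\<not> ?thesis"
      then have "g c \<omega> \<le> \<delta>"
        using continuous_le_on_closure[of T "\<lambda>c. g c \<omega>" c \<delta>] cont[OF \<omega>] c(1)
        unfolding cl by (simp add: not_less)
      then show False using c(2) by simp
    qed
    then show "\<omega> \<in> (\<Union>c\<in>T. {\<omega> \<in> space M. \<delta> < g c \<omega>})" using \<omega> by auto
  next
    fix \<omega> assume "\<omega> \<in> (\<Union>c\<in>T. {\<omega> \<in> space M. \<delta> < g c \<omega>})"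
    then show "\<omega> \<in> {\<omega> \<in> space M. ereal \<delta> < \<bar>SUP c\<in>{l..u}. ereal (g c \<omega>)\<bar>}"
      unfolding SUP using T(2) by (auto simp: less_SUP_iff)
  qed
  also have "\<dots> \<in> sets M"
  proof (rule sets.countable_UN''[OF T(1)])
    fix c assume "c \<in> T"
    then have [measurable]: "g c \<in> borel_measurable M" using meas T(2) by blast
    show "{\<omega> \<in> space M. \<delta> < g c \<omega>} \<in> sets M" by measurable
  qed
  finally show "{\<omega> \<in> space M. ereal \<delta> < \<bar>SUP c\<in>{l..u}. ereal (g c \<omega>)\<bar>} \<in> sets M" .
qed

lemma le_if_SUP_le:
  assumes "\<bar>SUP c\<in>I. ereal (g c)\<bar> \<le> ereal \<delta>" "c \<in> I"
  shows "g c \<le> \<delta>"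
proof -
  have "ereal (g c) \<le> (SUP c\<in>I. ereal (g c))" using assms(2) by (rule SUP_upper)
  also have "\<dots> \<le> \<bar>SUP c\<in>I. ereal (g c)\<bar>" by (cases "SUP c\<in>I. ereal (g c)") auto
  also note assms(1)
  finally show ?thesis by simp
qed

lemma measure_compl_tendsto_1:
  assumes "\<And>n. prob_space (P n)" and "\<forall>\<^sub>F n in sequentially. B n \<in> sets (P n)"
    and "(\<lambda>n. measure (P n) (B n)) \<longlonglongrightarrow> 0"
  shows "(\<lambda>n. measure (P n) (space (P n) - B n)) \<longlonglongrightarrow> 1"
proof -
  have "(\<lambda>n. 1 - measure (P n) (B n)) \<longlonglongrightarrow> 1 - 0"
    by (intro tendsto_intros assms)
  moreover have "\<forall>\<^sub>F n in sequentially. 1 - measure (P n) (B n) = measure (P n) (space (P n) - B n)"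
    using assms(2) by eventually_elim (simp add: prob_space.prob_compl[OF assms(1)])
  ultimately show ?thesis by (simp add: tendsto_cong)
qed

section \<open>Measurability in the noise and continuity in the scale\<close>

context regression_at
begin

lemma remainder_measurable [measurable]:
  "R1 k S n c f \<in> borel_measurable P"
  "R2 k S n c \<in> borel_measurable P"
  "R3 S n c f \<in> borel_measurable P"
  "R4 S n c \<in> borel_measurable P"
  "Nstat S n c \<in> borel_measurable P"
proof -
  have "(\<lambda>\<omega>. R1 k S n c f \<omega>) \<in> borel_measurable P"
    "(\<lambda>\<omega>. R2 k S n c \<omega>) \<in> borel_measurable P"
    by (cases k; simp; measurable)+
  then show "R1 k S n c f \<in> borel_measurable P"
    "R2 k S n c \<in> borel_measurable P" by simp_all
  show "R3 S n c f \<in> borel_measurable P"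
    "R4 S n c \<in> borel_measurable P"
    "Nstat S n c \<in> borel_measurable P"
    unfolding R3_def[abs_def] R4_def[abs_def] Nstat_def[abs_def] by measurable
qed

lemma continuous_in_c:
  assumes "0 \<le> l"
  shows "continuous_on {l..u} (\<lambda>c. R1 k S n c f \<omega>)" "continuous_on {l..u} (\<lambda>c. R2 k S n c \<omega>)"
    "continuous_on {l..u} (\<lambda>c. R3 S n c f \<omega>)" "continuous_on {l..u} (\<lambda>c. R4 S n c \<omega>)"
    "continuous_on {l..u} (\<lambda>c. Nstat S n c \<omega>)" "continuous_on {l..u} (s2 S n)"
    "continuous_on {l..u} (\<lambda>c. Dt k c f)"
proof -
  have nz: "1 + c * lam j \<noteq> 0" if "c \<in> {l..u}" "j \<in> J" for c j
    using one_plus_pos[of c j] that assms by auto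
  show "continuous_on {l..u} (\<lambda>c. R1 k S n c f \<omega>)" "continuous_on {l..u} (\<lambda>c. R2 k S n c \<omega>)"
    by (cases k; simp; intro continuous_intros; simp add: nz)+
  show "continuous_on {l..u} (\<lambda>c. R3 S n c f \<omega>)" "continuous_on {l..u} (\<lambda>c. R4 S n c \<omega>)"
    "continuous_on {l..u} (\<lambda>c. Nstat S n c \<omega>)" "continuous_on {l..u} (s2 S n)"
    unfolding R3_def R4_def Nstat_def s2_def[abs_def] by (intro continuous_intros; simp add: nz)+
  show "continuous_on {l..u} (\<lambda>c. Dt k c f)"
    unfolding Dtot_def by (cases k; simp; intro continuous_intros; simp add: nz)
qed

lemma s2_nonneg: "0 \<le> c \<Longrightarrow> 0 \<le> s2 S n c"
  unfolding s2_def by (intro sum_nonneg divide_nonneg_nonneg add_nonneg_nonneg eigval_mult_nonneg) auto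

end

lemma c_range_nonempty:
  assumes "1 \<le> m" "2 \<le> N"
  shows "0 < ln (real N) / real N" "ln (real N) / real N \<le> real N powr (m - 1)"
proof -
  have "ln (real N) \<le> real N" using assms by (intro less_imp_le ln_less_self) simp
  then have "ln (real N) / real N \<le> 1" using assms by (simp add: divide_le_eq)
  also have "1 \<le> real N powr (m - 1)" using assms by (intro ge_one_powr_ge_zero) auto
  finally show "ln (real N) / real N \<le> real N powr (m - 1)" .
  show "0 < ln (real N) / real N" using assms by simp
qed

abbreviation ratio12 where
  "ratio12 k S n f c \<omega> \<equiv> (\<bar>R1 k S n c f \<omega>\<bar> + \<bar>R2 k S n c \<omega>\<bar>) / Dtot k S n c f"

abbreviation ratio34 where
  "ratio34 k S n f c \<omega> \<equiv> (\<bar>R3 S n c f \<omega>\<bar> + \<bar>R4 S n c \<omega>\<bar>) / Dtot k S n c f"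

proposition coverage_uniform:
  fixes S :: "('x, 'v, 'w, 'j) regression"
  assumes model: "regression_model S" and est: "is_estimator k S m f chat" and bias: "bias_cond k S m f"
    and npts: "\<And>n. n \<le> npts S n" and m: "1 \<le> m"
    and rem: "remainder_cond k S m f" and rad: "radius_cond S m" and var: "variance_cond S m"
  shows "covers S f chat"
proof -
  define P where "P = noise_space S"
  have prob: "prob_space (P n)" for n using model by (simp add: regression_model_def P_def)
  obtain l1 u1 where lu1: "0 < l1" "\<forall>\<^sub>F n in sequentially. \<forall>c\<in>Iset S m n.
      l1 \<le> D2 Risk S n c / D2 Likelihood S n c \<and> D2 Risk S n c / D2 Likelihood S n c \<le> u1"
    using var unfolding variance_cond_def uniformly_asymp_def by blast
  obtain l2 u2 where lu2: "0 < l2" "\<forall>\<^sub>F n in sequentially. \<forall>c\<in>Iset S m n.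
      l2 \<le> D2 Likelihood S n c / s2 S n c \<and> D2 Likelihood S n c / s2 S n c \<le> u2"
    using var unfolding variance_cond_def uniformly_asymp_def by blast
  \<comment> \<open>In the maximum, \<open>u2\<close> serves the likelihood criterion and 1 the risk
    criterion, for which \<open>D2 Risk \<le> s2\<close> always holds.\<close>
  have pos: "\<forall>\<^sub>F n in sequentially. \<forall>c\<in>Iset S m n. D2 k S n c \<le> max u2 1 * s2 S n c \<and> 0 < s2 S n c \<and> 0 < Dtot k S n c f"
    using lu1(2) lu2(2) eventually_ge_at_top[of 2]
  proof eventually_elim
    case (elim n)
    interpret regression_at S n by unfold_locales (rule model)
    show ?case
    proof
      fix c assume c: "c \<in> Iset S m n"
      then have c0: "0 \<le> c"
        using c_range_nonempty(1)[OF m order_trans[OF elim(3) npts[of n]]] by (simp add: Iset_def c_range_def)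
      \<comment> \<open>A quotient by 0 is 0, so the positive lower bounds \<open>l1\<close> and
        \<open>l2\<close> exclude zeros in the denominators as well as in the numerators.\<close>
      have s: "s2 S n c \<noteq> 0" and L: "D2 Likelihood S n c \<noteq> 0" and R: "D2 Risk S n c \<noteq> 0"
        using elim(1,2) c lu1(1) lu2(1) by force+
      have s: "0 < s2 S n c" using s s2_nonneg[OF c0] by simp
      have LR: "0 < D2 Likelihood S n c" "0 < D2 Risk S n c"
        using L R D2_nonneg[OF c0, of Likelihood] D2_nonneg[OF c0, of Risk] by simp_all
      have "D2 Likelihood S n c \<le> u2 * s2 S n c"
        using elim(2) c s by (simp add: divide_le_eq del: D2.simps)
      also have "\<dots> \<le> max u2 1 * s2 S n c" using s by (intro mult_right_mono) auto
      finally have 1: "D2 Likelihood S n c \<le> max u2 1 * s2 S n c" .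
      have "D2 Risk S n c \<le> 1 * s2 S n c" using D2_Risk_le_s2[OF c0] by simp
      also have "\<dots> \<le> max u2 1 * s2 S n c" using s by (intro mult_right_mono) auto
      finally have 2: "D2 Risk S n c \<le> max u2 1 * s2 S n c" .
      have "0 < D2 k S n c" using LR by (cases k) simp_all
      then have "0 < Dtot k S n c f" using D1_nonneg[OF c0, of k f] by (simp add: Dtot_def)
      moreover have "D2 k S n c \<le> max u2 1 * s2 S n c" using 1 2 by (cases k) simp_all
      ultimately show "D2 k S n c \<le> max u2 1 * s2 S n c \<and> 0 < s2 S n c \<and> 0 < Dtot k S n c f"
        using s by simp
    qed
  qed
  \<comment> \<open>The thresholds are those of \<open>coverage\<close>; a relative deviation of at
    most 1/2 even gives \<open>Nstat \<ge> s2 / 2\<close>, more than the quarter required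
    there.\<close>
  define B1 where "B1 n = {\<omega> \<in> space (P n). ereal (1/3) < \<bar>SUP c\<in>Iset S m n.
       ereal (ratio12 k S n f c \<omega>)\<bar>}" for n
  define B2 where "B2 n = {\<omega> \<in> space (P n). ereal 1 < \<bar>SUP c\<in>Iset S m n.
       ereal (ratio34 k S n f c \<omega>)\<bar>}" for n
  define B3 where "B3 n = {\<omega> \<in> space (P n). ereal (1/2) < \<bar>SUP c\<in>Iset S m n.
       ereal \<bar>Nstat S n c \<omega> / s2 S n c - 1\<bar>\<bar>}" for n
  have lim: "(\<lambda>n. measure (P n) (B1 n)) \<longlonglongrightarrow> 0" "(\<lambda>n. measure (P n) (B2 n)) \<longlonglongrightarrow> 0" "(\<lambda>n. measure (P n) (B3 n)) \<longlonglongrightarrow> 0"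
    using rem rad unfolding remainder_cond_def radius_cond_def tends_to_0_in_prob_def B1_def B2_def B3_def P_def
    by simp_all
  have facts: "\<forall>\<^sub>F n in sequentially. B1 n \<in> sets (P n) \<and> B2 n \<in> sets (P n) \<and> B3 n \<in> sets (P n) \<and>
     (\<forall>\<omega>\<in>space (P n). \<forall>c\<in>Iset S m n.
       (\<omega> \<notin> B1 n \<longrightarrow> \<bar>R1 k S n c f \<omega>\<bar> + \<bar>R2 k S n c \<omega>\<bar> \<le> Dtot k S n c f / 3) \<and>
       (\<omega> \<notin> B2 n \<longrightarrow> \<bar>R3 S n c f \<omega>\<bar> + \<bar>R4 S n c \<omega>\<bar> \<le> Dtot k S n c f) \<and>
       (\<omega> \<notin> B3 n \<longrightarrow> s2 S n c / 4 \<le> Nstat S n c \<omega>))"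
    using pos eventually_ge_at_top[of 2]
  proof eventually_elim
    case (elim n)
    interpret regression_at S n by unfold_locales (rule model)
    define l where "l = ln (real (npts S n)) / real (npts S n)"
    define u where "u = real (npts S n) powr (m - 1)"
    have I: "Iset S m n = {l..u}" by (simp add: Iset_def c_range_def l_def u_def)
    have "2 \<le> npts S n" using npts[of n] elim by simp
    then have l: "0 \<le> l" "l \<le> u" using c_range_nonempty[OF m] by (auto simp: l_def u_def less_imp_le)
    have pos': "0 < s2 S n c" "0 < Dtot k S n c f" "Dtot k S n c f \<noteq> 0" "s2 S n c \<noteq> 0" if "c \<in> {l..u}" for c
      using elim(1) that I by force+
    note cont = continuous_in_c[OF l(1)]
    have s1: "(\<lambda>\<omega>. ratio12 k S n f c \<omega>) \<in> borel_measurable (P n)"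
      "(\<lambda>\<omega>. ratio34 k S n f c \<omega>) \<in> borel_measurable (P n)"
      "(\<lambda>\<omega>. \<bar>Nstat S n c \<omega> / s2 S n c - 1\<bar>) \<in> borel_measurable (P n)" for c
      unfolding P_def by measurable
    have s2: "continuous_on {l..u} (\<lambda>c. ratio12 k S n f c \<omega>)"
      "continuous_on {l..u} (\<lambda>c. ratio34 k S n f c \<omega>)"
      "continuous_on {l..u} (\<lambda>c. \<bar>Nstat S n c \<omega> / s2 S n c - 1\<bar>)" for \<omega>
      by (intro continuous_intros cont ballI; simp add: pos')+
    have s3: "0 \<le> ratio12 k S n f c \<omega>"
      "0 \<le> ratio34 k S n f c \<omega>"
      "0 \<le> \<bar>Nstat S n c \<omega> / s2 S n c - 1\<bar>" if "c \<in> {l..u}" for \<omega> c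
      using pos'[OF that] by (simp_all add: less_imp_le)
    note e1 = SUP_exceedance_measurable[of l u "\<lambda>c \<omega>. ratio12 k S n f c \<omega>" "P n", OF s1(1) s2(1) s3(1) l(2)]
    note e2 = SUP_exceedance_measurable[of l u "\<lambda>c \<omega>. ratio34 k S n f c \<omega>" "P n", OF s1(2) s2(2) s3(2) l(2)]
    note e3 = SUP_exceedance_measurable[of l u "\<lambda>c \<omega>. \<bar>Nstat S n c \<omega> / s2 S n c - 1\<bar>" "P n", OF s1(3) s2(3) s3(3) l(2)]
    have "s2 S n c / 4 \<le> Nstat S n c \<omega>" if c: "c \<in> {l..u}" and \<omega>: "\<omega> \<in> space (P n)" "\<omega> \<notin> B3 n" for c \<omega>
    proof -
      have "\<bar>Nstat S n c \<omega> / s2 S n c - 1\<bar> \<le> 1 / 2"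
        using le_if_SUP_le[of "\<lambda>c. \<bar>Nstat S n c \<omega> / s2 S n c - 1\<bar>" "{l..u}" "1/2" c] \<omega> c by (simp add: B3_def I not_less)
      then have "1 / 4 \<le> Nstat S n c \<omega> / s2 S n c" by linarith
      then show ?thesis using pos'(1)[OF c] by (simp add: le_divide_eq)
    qed
    moreover have "\<bar>R1 k S n c f \<omega>\<bar> + \<bar>R2 k S n c \<omega>\<bar> \<le> Dtot k S n c f / 3"
      if c: "c \<in> {l..u}" and \<omega>: "\<omega> \<in> space (P n)" "\<omega> \<notin> B1 n" for c \<omega>
      using le_if_SUP_le[of "\<lambda>c. ratio12 k S n f c \<omega>" "{l..u}" "1/3" c] \<omega> c pos'(2)[OF c] by (simp add: B1_def I not_less divide_le_eq)
    moreover have "\<bar>R3 S n c f \<omega>\<bar> + \<bar>R4 S n c \<omega>\<bar> \<le> Dtot k S n c f"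
      if c: "c \<in> {l..u}" and \<omega>: "\<omega> \<in> space (P n)" "\<omega> \<notin> B2 n" for c \<omega>
      using le_if_SUP_le[of "\<lambda>c. ratio34 k S n f c \<omega>" "{l..u}" 1 c] \<omega> c pos'(2)[OF c] by (simp add: B2_def I not_less divide_le_eq)
    ultimately show ?case
      using e1[of "1/3"] e2[of 1] e3[of "1/2"] unfolding B1_def[of n] B2_def[of n] B3_def[of n] I by blast
  qed
  \<comment> \<open>\<open>B3\<close> stays out of the exceptional event: at fixed \<open>c\<close>
    the radius is not random, and \<open>B3\<close> only bounds the probabilities
    \<open>prob_small_Nstat\<close>.\<close>
  have lim12: "(\<lambda>n. measure (P n) (B1 n \<union> B2 n)) \<longlonglongrightarrow> 0"
  proof (rule tendsto_sandwich[OF _ _ tendsto_const])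
    show "\<forall>\<^sub>F n in sequentially. measure (P n) (B1 n \<union> B2 n) \<le> measure (P n) (B1 n) + measure (P n) (B2 n)"
      using facts by eventually_elim (intro measure_Un_le; simp)
    show "(\<lambda>n. measure (P n) (B1 n) + measure (P n) (B2 n)) \<longlonglongrightarrow> 0"
      using tendsto_add[OF lim(1,2)] by simp
  qed simp
  show ?thesis
  proof (rule coverage[OF model est bias npts])
    have "\<forall>\<^sub>F n in sequentially. B1 n \<union> B2 n \<in> sets (P n)" using facts by eventually_elim auto
    from measure_compl_tendsto_1[OF prob this lim12]
    show "(\<lambda>n. measure (noise_space S n) (space (P n) - (B1 n \<union> B2 n))) \<longlonglongrightarrow> 1"
      by (simp add: P_def)
    show "space (P n) - (B1 n \<union> B2 n) \<subseteq> space (noise_space S n)" for n by (auto simp: P_def)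
    show "\<forall>\<^sub>F n in sequentially. \<forall>\<omega>\<in>space (P n) - (B1 n \<union> B2 n). \<forall>c\<in>Iset S m n.
      small_remainders k S n f c \<omega>"
      using facts by eventually_elim blast
    show "\<forall>\<^sub>F n in sequentially. \<forall>c\<in>Iset S m n. D2 k S n c \<le> max u2 1 * s2 S n c \<and> 0 < s2 S n c"
      using pos by eventually_elim blast
    show "\<forall>\<^sub>F n in sequentially. \<forall>c\<in>Iset S m n.
      prob_small_Nstat S n c < \<eta>"
      if "0 < \<eta>" for \<eta>
      using facts order_tendstoD(2)[OF lim(3) that]
    proof eventually_elim
      case (elim n)
      interpret prob_space "P n" by (rule prob)
      show ?case
      proof
        fix c assume c: "c \<in> Iset S m n"
        have "measure (P n) {\<omega> \<in> space (P n). Nstat S n c \<omega> < s2 S n c / 4} \<le> measure (P n) (B3 n)"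
          using elim c by (intro finite_measure_mono) (auto simp: not_less[symmetric])
        then show "prob_small_Nstat S n c < \<eta>"
          using elim(2) by (simp add: P_def)
      qed
    qed
  qed
qed

section \<open>A maximal inequality for sums of uncorrelated variables\<close>

text \<open>\<open>v c - v a\<close> is the integral of \<open>v'\<close>, and Cauchy-Schwarz bounds
  its square by a quantity that is the same for all \<open>c\<close> in the interval.\<close>

lemma square_le_integral_deriv:
  fixes v v' :: "real \<Rightarrow> real"
  assumes deriv: "\<And>t. t \<in> {a..b} \<Longrightarrow> (v has_real_derivative v' t) (at t)"
    and cont: "continuous_on {a..b} v'" and c: "c \<in> {a..b}"
  shows "(v c)\<^sup>2 \<le> 2 * (v a)\<^sup>2 + 2 * (b - a) * integral {a..b} (\<lambda>t. (v' t)\<^sup>2)"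
proof -
  define I where "I = integral {a..c} (\<lambda>t. (v' t)\<^sup>2)"
  define d where "d = v c - v a"
  have ac: "a \<le> c" "c \<le> b" using c by auto
  have cont_c: "continuous_on {a..c} v'" using cont ac by (rule_tac continuous_on_subset) auto
  have hd: "(v' has_integral d) {a..c}"
    unfolding d_def using deriv ac
    by (intro fundamental_theorem_of_calculus)
      (auto intro: has_field_derivative_at_within simp: has_real_derivative_iff_has_vector_derivative[symmetric])
  have hI: "((\<lambda>t. (v' t)\<^sup>2) has_integral I) {a..c}"
    unfolding I_def by (intro integrable_integral integrable_continuous_interval continuous_intros cont_c)
  have "d\<^sup>2 \<le> (c - a) * I"
  proof (cases "a = c")
    case True
    then show ?thesis by (simp add: d_def)
  next
    case False
    \<comment> \<open>Cauchy-Schwarz follows by integrating the square of \<open>v' - \<mu>\<close>,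
      where \<open>\<mu>\<close> is the mean of \<open>v'\<close> over
      \<open>{a..c}\<close>.\<close>
    define \<mu> where "\<mu> = d / (c - a)"
    have "((\<lambda>t. (v' t)\<^sup>2 - 2 * \<mu> * v' t + \<mu>\<^sup>2) has_integral (I - 2 * \<mu> * d + (c - a) * \<mu>\<^sup>2)) {a..c}"
      using ac by (intro has_integral_add has_integral_diff has_integral_mult_right hI hd)
        (use has_integral_const_real[of "\<mu>\<^sup>2" a c] in simp)
    then have "0 \<le> I - 2 * \<mu> * d + (c - a) * \<mu>\<^sup>2"
    proof (rule has_integral_nonneg)
      fix t show "0 \<le> (v' t)\<^sup>2 - 2 * \<mu> * v' t + \<mu>\<^sup>2"
        using zero_le_power2[of "v' t - \<mu>"] by (simp add: power2_diff algebra_simps)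
    qed
    moreover have \<mu>: "\<mu> * (c - a) = d" using False by (simp add: \<mu>_def)
    then have "(c - a) * \<mu>\<^sup>2 = \<mu> * d" by (simp add: power2_eq_square mult_ac)
    ultimately have "\<mu> * d \<le> I" by simp
    have "(c - a) * (\<mu> * d) = \<mu> * (c - a) * d" by (simp only: mult_ac)
    also have "\<dots> = d\<^sup>2" unfolding \<mu> by (simp only: power2_eq_square)
    finally show ?thesis
      using mult_left_mono[OF \<open>\<mu> * d \<le> I\<close>, of "c - a"] ac by simp
  qed
  also have "\<dots> \<le> (b - a) * integral {a..b} (\<lambda>t. (v' t)\<^sup>2)"
  proof (rule mult_mono)
    show "I \<le> integral {a..b} (\<lambda>t. (v' t)\<^sup>2)"
      unfolding I_def using ac
      by (intro integral_subset_le integrable_continuous_interval continuous_intros cont cont_c) auto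
    show "0 \<le> I" unfolding I_def by (intro integral_nonneg integrable_continuous_interval continuous_intros cont_c) auto
  qed (use ac in auto)
  finally have "d\<^sup>2 \<le> (b - a) * integral {a..b} (\<lambda>t. (v' t)\<^sup>2)" .
  moreover have "(v c)\<^sup>2 \<le> 2 * (v a)\<^sup>2 + 2 * d\<^sup>2"
    using zero_le_power2[of "v a - d"] unfolding d_def by (simp add: power2_eq_square algebra_simps)
  ultimately show ?thesis unfolding mult.assoc by linarith
qed

text \<open>\<open>square_le_integral_deriv\<close> majorises the squared supremum by one quadratic
  form \<open>Q\<close> in the \<open>W j\<close>. Uncorrelatedness leaves only the diagonal of its
  expectation, and Markov's inequality concludes.\<close>

lemma (in prob_space) uncorrelated_maximal_inequality:
  fixes W :: "'j \<Rightarrow> 'a \<Rightarrow> real" and g g' :: "'j \<Rightarrow> real \<Rightarrow> real"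
  assumes J: "finite J"
    and WW: "\<And>j k. j \<in> J \<Longrightarrow> k \<in> J \<Longrightarrow> integrable M (\<lambda>\<omega>. W j \<omega> * W k \<omega>)"
    and cov: "\<And>j k. j \<in> J \<Longrightarrow> k \<in> J \<Longrightarrow> expectation (\<lambda>\<omega>. W j \<omega> * W k \<omega>) = (if j = k then \<tau> else 0)"
    and deriv: "\<And>j t. j \<in> J \<Longrightarrow> t \<in> {a..b} \<Longrightarrow> (g j has_real_derivative g' j t) (at t)"
    and cont: "\<And>j. j \<in> J \<Longrightarrow> continuous_on {a..b} (g' j)"
    and ab: "a \<le> b" and \<tau>: "0 \<le> \<tau>" and \<delta>: "0 < \<delta>"
    and G1: "(\<Sum>j\<in>J. (g j a)\<^sup>2) \<le> G1" and G2: "\<And>t. t \<in> {a..b} \<Longrightarrow> (\<Sum>j\<in>J. (g' j t)\<^sup>2) \<le> G2"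
  shows "\<exists>B\<in>sets M. prob B \<le> 2 * \<tau> * (G1 + (b - a)\<^sup>2 * G2) / \<delta>\<^sup>2 \<and>
    (\<forall>\<omega>\<in>space M - B. \<forall>c\<in>{a..b}. \<bar>\<Sum>j\<in>J. W j \<omega> * g j c\<bar> \<le> \<delta>)"
proof -
  \<comment> \<open>The integral over \<open>t\<close> is absorbed into deterministic coefficients.
    The expectation is then that of a finite sum, without any exchange of integration over
    \<open>t\<close> and \<open>\<omega>\<close>.\<close>
  define A where "A j k = 2 * (g j a * g k a) + 2 * (b - a) * integral {a..b} (\<lambda>t. g' j t * g' k t)" for j k
  define Q where "Q \<omega> = (\<Sum>j\<in>J. \<Sum>k\<in>J. A j k * (W j \<omega> * W k \<omega>))" for \<omega>
  have int: "(\<lambda>t. g' j t * g' k t) integrable_on {a..b}" if "j \<in> J" "k \<in> J" for j k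
    using that by (intro integrable_continuous_interval continuous_intros cont)
  have Q: "2 * (\<Sum>j\<in>J. W j \<omega> * g j a)\<^sup>2 + 2 * (b - a) * integral {a..b} (\<lambda>t. (\<Sum>j\<in>J. W j \<omega> * g' j t)\<^sup>2) = Q \<omega>" for \<omega>
  proof -
    have "integral {a..b} (\<lambda>t. (\<Sum>j\<in>J. W j \<omega> * g' j t)\<^sup>2)
       = integral {a..b} (\<lambda>t. \<Sum>j\<in>J. \<Sum>k\<in>J. W j \<omega> * W k \<omega> * (g' j t * g' k t))"
      by (simp add: power2_eq_square sum_product mult_ac)
    also have "\<dots> = (\<Sum>j\<in>J. \<Sum>k\<in>J. W j \<omega> * W k \<omega> * integral {a..b} (\<lambda>t. g' j t * g' k t))"
    proof -
      have "((\<lambda>t. \<Sum>j\<in>J. \<Sum>k\<in>J. W j \<omega> * W k \<omega> * (g' j t * g' k t)) has_integral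
          (\<Sum>j\<in>J. \<Sum>k\<in>J. W j \<omega> * W k \<omega> * integral {a..b} (\<lambda>t. g' j t * g' k t))) {a..b}"
        using J int by (intro has_integral_sum has_integral_mult_right integrable_integral) auto
      then show ?thesis by (rule integral_unique)
    qed
    finally show ?thesis
      unfolding Q_def A_def
      by (simp add: power2_eq_square sum_product sum_distrib_left sum.distrib[symmetric] algebra_simps)
  qed
  have Qint: "integrable M Q"
    unfolding Q_def[abs_def] using WW by (intro Bochner_Integration.integrable_sum integrable_mult_right) auto
  have Qnn: "0 \<le> Q \<omega>" for \<omega>
    unfolding Q[symmetric] using ab cont
    by (intro add_nonneg_nonneg mult_nonneg_nonneg integral_nonneg integrable_continuous_interval continuous_intros) auto
  have "expectation Q = (\<Sum>j\<in>J. \<Sum>k\<in>J. A j k * (if j = k then \<tau> else 0))"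
    unfolding Q_def[abs_def] using WW cov by (simp add: Bochner_Integration.integral_sum)
  also have "\<dots> = (\<Sum>j\<in>J. A j j * \<tau>)"
    using J by (intro sum.cong refl) (simp add: if_distrib cong: if_cong)
  also have "\<dots> = 2 * \<tau> * ((\<Sum>j\<in>J. (g j a)\<^sup>2) + (b - a) * (\<Sum>j\<in>J. integral {a..b} (\<lambda>t. (g' j t)\<^sup>2)))"
  proof -
    have "(\<Sum>j\<in>J. A j j * \<tau>) = (\<Sum>j\<in>J. 2 * \<tau> * ((g j a)\<^sup>2 + (b - a) * integral {a..b} (\<lambda>t. (g' j t)\<^sup>2)))"
      unfolding A_def by (intro sum.cong refl) (simp add: power2_eq_square algebra_simps)
    then show ?thesis by (simp only: sum_distrib_left[symmetric] sum.distrib)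
  qed
  also have "\<dots> \<le> 2 * \<tau> * (G1 + (b - a) * ((b - a) * G2))"
  proof -
    have "(\<Sum>j\<in>J. integral {a..b} (\<lambda>t. (g' j t)\<^sup>2)) = integral {a..b} (\<lambda>t. \<Sum>j\<in>J. (g' j t)\<^sup>2)"
      using int J by (intro integral_sum[symmetric]) (auto simp: power2_eq_square)
    also have "\<dots> \<le> integral {a..b} (\<lambda>t. G2)"
      using G2 cont by (intro integral_le integrable_continuous_interval continuous_intros) auto
    also have "\<dots> = (b - a) * G2" using ab by simp
    finally show ?thesis using G1 ab \<tau> by (intro mult_left_mono add_mono) auto
  qed
  finally have EQ: "expectation Q \<le> 2 * \<tau> * (G1 + (b - a)\<^sup>2 * G2)" by (simp add: power2_eq_square mult.assoc)
  define B where "B = {\<omega> \<in> space M. \<delta>\<^sup>2 \<le> Q \<omega>}"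
  have "B \<in> sets M" using Qint unfolding B_def by measurable
  moreover have "prob B \<le> expectation Q / \<delta>\<^sup>2"
    unfolding B_def using Qint Qnn \<delta> by (intro integral_Markov_inequality_measure[where A = "space M"]) auto
  then have "prob B \<le> 2 * \<tau> * (G1 + (b - a)\<^sup>2 * G2) / \<delta>\<^sup>2"
    using EQ \<delta> by (elim order_trans) (intro divide_right_mono, auto)
  moreover have "\<bar>\<Sum>j\<in>J. W j \<omega> * g j c\<bar> \<le> \<delta>" if \<omega>: "\<omega> \<in> space M - B" and c: "c \<in> {a..b}" for \<omega> c
  proof -
    have "(\<Sum>j\<in>J. W j \<omega> * g j c)\<^sup>2 \<le> Q \<omega>"
      unfolding Q[symmetric]
    proof (rule square_le_integral_deriv[OF _ _ c])
      show "((\<lambda>c. \<Sum>j\<in>J. W j \<omega> * g j c) has_real_derivative (\<Sum>j\<in>J. W j \<omega> * g' j t)) (at t)" if "t \<in> {a..b}" for t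
        using that by (intro DERIV_sum DERIV_cmult deriv)
      show "continuous_on {a..b} (\<lambda>t. \<Sum>j\<in>J. W j \<omega> * g' j t)"
        by (intro continuous_intros cont)
    qed
    also have "Q \<omega> \<le> \<delta>\<^sup>2" using \<omega> by (auto simp: B_def)
    finally show ?thesis using \<delta> by (simp add: abs_le_square_iff[symmetric])
  qed
  ultimately show ?thesis by blast
qed

section \<open>Remainders on a dyadic block\<close>

context regression_at
begin

lemma D1_antimono:
  assumes "0 \<le> c" "c \<le> c'"
  shows "D1 k S n c' f \<le> D1 k S n c f"
proof -
  have le: "(F f j)\<^sup>2 / (1 + c' * lam j) \<le> (F f j)\<^sup>2 / (1 + c * lam j)"
    "(F f j)\<^sup>2 / (1 + c' * lam j)\<^sup>2 \<le> (F f j)\<^sup>2 / (1 + c * lam j)\<^sup>2"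
    if j: "j \<in> J" for j
  proof -
    have 1: "1 + c * lam j \<le> 1 + c' * lam j"
      using mult_right_mono[OF assms(2) eigval_nonneg[OF j]] by simp
    have 2: "0 < 1 + c * lam j" using one_plus_pos[OF assms(1) j] .
    have 3: "(1 + c * lam j)\<^sup>2 \<le> (1 + c' * lam j)\<^sup>2" using 1 2 by (intro power_mono) auto
    show "(F f j)\<^sup>2 / (1 + c' * lam j) \<le> (F f j)\<^sup>2 / (1 + c * lam j)"
      using 1 2 by (intro divide_left_mono mult_pos_pos) auto
    show "(F f j)\<^sup>2 / (1 + c' * lam j)\<^sup>2 \<le> (F f j)\<^sup>2 / (1 + c * lam j)\<^sup>2"
      using 1 2 3 by (intro divide_left_mono mult_pos_pos zero_less_power) auto
  qed
  show ?thesis by (cases k) (simp_all add: sum_mono le)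
qed

lemma D1_doubling:
  assumes "0 \<le> c" "c' \<le> 2 * c" "0 \<le> c'"
  shows "D1 k S n c f \<le> 4 * D1 k S n c' f"
proof -
  have le: "(F f j)\<^sup>2 / (1 + c * lam j) \<le> 4 * ((F f j)\<^sup>2 / (1 + c' * lam j))"
     "(F f j)\<^sup>2 / (1 + c * lam j)\<^sup>2 \<le> 4 * ((F f j)\<^sup>2 / (1 + c' * lam j)\<^sup>2)"
    if "j \<in> J" for j
  proof -
    have pos: "0 < 1 + c * lam j" "0 < 1 + c' * lam j"
      using one_plus_pos[OF _ that] assms by auto
    have le: "1 + c' * lam j \<le> 2 * (1 + c * lam j)"
      using mult_right_mono[OF assms(2) eigval_nonneg[OF that]] by simp
    have inv: "1 / (1 + c * lam j) \<le> 2 * (1 / (1 + c' * lam j))"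
      using le pos by (simp add: field_simps)
    have "(1 / (1 + c * lam j))\<^sup>2 \<le> (2 * (1 / (1 + c' * lam j)))\<^sup>2"
      using pos by (intro power_mono inv) simp
    then have inv2: "1 / (1 + c * lam j)\<^sup>2 \<le> 4 * (1 / (1 + c' * lam j)\<^sup>2)"
      by (simp add: power_divide power_mult_distrib)
    have "0 \<le> 1 / (1 + c' * lam j)" using pos by simp
    then have "1 / (1 + c * lam j) \<le> 4 * (1 / (1 + c' * lam j))" using inv by linarith
    from mult_left_mono[OF this, of "(F f j)\<^sup>2"] mult_left_mono[OF inv2, of "(F f j)\<^sup>2"]
    show "(F f j)\<^sup>2 / (1 + c * lam j) \<le> 4 * ((F f j)\<^sup>2 / (1 + c' * lam j))"
     "(F f j)\<^sup>2 / (1 + c * lam j)\<^sup>2 \<le> 4 * ((F f j)\<^sup>2 / (1 + c' * lam j)\<^sup>2)"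
      by (simp_all add: mult.commute)
  qed
  show ?thesis by (cases k) (simp_all only: D1.simps sum_distrib_left sum_mono le)
qed

text \<open>Doubling \<open>c\<close> changes \<open>D1\<close> and \<open>D2\<close> by at most the
  factor 2^2 = 4. On a block \<open>[a, 2a]\<close> the value at \<open>a\<close> may therefore
  stand for all the others.\<close>

lemma Dtot_comparable:
  assumes "0 \<le> a" "a \<le> c" "c \<le> 2 * a"
  shows "Dt k a f \<le> 4 * Dt k c f" "Dt k c f \<le> 4 * Dt k a f"
proof -
  have c: "0 \<le> c" using assms by simp
  show "Dt k a f \<le> 4 * Dt k c f"
    using D1_doubling[OF assms(1,3) c, of k f] D2_mono[OF assms(1,2), of k] D2_nonneg[OF c, of k] by (simp add: Dtot_def)
  show "Dt k c f \<le> 4 * Dt k a f"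
    using D1_antimono[OF assms(1,2), of k f] D2_mono[OF c assms(3), of k] D2_scale[OF assms(1), of 2 k] D1_nonneg[OF assms(1), of k f]
    by (simp add: Dtot_def)
qed

text \<open>The factor by which the signal coefficient survives as bias; its complement is the
  weight \<open>wt c j\<close> of the noise.\<close>

definition rc :: "real \<Rightarrow> 'j \<Rightarrow> real" where
  "rc c j = 1 / (1 + c * lam j)"

lemma rc_bounds: "0 \<le> c \<Longrightarrow> j \<in> J \<Longrightarrow> 0 \<le> rc c j" "0 \<le> c \<Longrightarrow> j \<in> J \<Longrightarrow> rc c j \<le> 1"
  using one_plus_pos[of c j] eigval_mult_nonneg[of c j] by (auto simp: rc_def)

lemma one_minus_rc: "0 \<le> c \<Longrightarrow> j \<in> J \<Longrightarrow> 1 - rc c j = wt c j"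
  using one_plus_pos[of c j] by (simp add: rc_def field_simps)

lemma rc_deriv:
  assumes "0 \<le> c" "j \<in> J"
  shows "((\<lambda>c. rc c j) has_real_derivative - (lam j * (rc c j)\<^sup>2)) (at c)"
proof -
  have "((\<lambda>c. 1 / (1 + c * lam j)) has_real_derivative
      (0 * (1 + c * lam j) - 1 * lam j) / ((1 + c * lam j) * (1 + c * lam j))) (at c)"
    using one_plus_pos[OF assms] by (intro DERIV_divide) (auto intro!: derivative_eq_intros)
  then show ?thesis by (simp add: rc_def[abs_def] power_divide power2_eq_square)
qed

text \<open>All remainders have the form \<open>\<Sum>j. W j * (\<alpha> j * p (rc c j))\<close>; since \<open>c\<close> times the derivative of \<open>rc c j\<close>
  is \<open>- rc c j * (1 - rc c j)\<close>, the derivative bounds reduce to polynomial inequalities on the unit interval.\<close>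

lemma dyadic_block:
  fixes W :: "'j \<Rightarrow> 'w \<Rightarrow> real"
  assumes WW: "\<And>j k. j \<in> J \<Longrightarrow> k \<in> J \<Longrightarrow> integrable P (\<lambda>\<omega>. W j \<omega> * W k \<omega>)"
    and cov: "\<And>j k. j \<in> J \<Longrightarrow> k \<in> J \<Longrightarrow>
      (\<integral>\<omega>. W j \<omega> * W k \<omega> \<partial>P) = (if j = k then \<tau> else 0)" and \<tau>: "0 \<le> \<tau>" "\<tau> \<le> 2"
    and a: "0 < a" and D: "0 < Dt k a f"
    and p: "\<And>r. (p has_real_derivative p' r) (at r)" "continuous_on UNIV p'"
    and b1: "\<And>c. 0 < c \<Longrightarrow> (\<Sum>j\<in>J. (\<alpha> j)\<^sup>2 * (p (rc c j))\<^sup>2) \<le> 16 * Dt k c f"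
    and b2: "\<And>c. 0 < c \<Longrightarrow> (\<Sum>j\<in>J. (\<alpha> j)\<^sup>2 * (p' (rc c j) * rc c j * (1 - rc c j))\<^sup>2) \<le> 16 * Dt k c f"
  shows "\<exists>B\<in>sets P. measure P B \<le> 184320 / Dt k a f \<and>
    (\<forall>\<omega>\<in>space P - B. \<forall>c\<in>{a..2 * a}. \<bar>\<Sum>j\<in>J. W j \<omega> * (\<alpha> j * p (rc c j))\<bar> \<le> Dt k c f / 6)"
proof -
  \<comment> \<open>24 = 6 * 4, because \<open>Dt a \<le> 4 * Dt c\<close> on the block. In
    \<open>G2\<close>, 64 = 16 * 4 by the converse comparison, and the division by
    \<open>a\<^sup>2\<close> comes from differentiating in \<open>c\<close>, which costs a factor
    \<open>1 / t\<close> per derivative.\<close>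
  define \<delta> where "\<delta> = Dt k a f / 24"
  define G2 where "G2 = 64 * Dt k a f / a\<^sup>2"
  have "\<exists>B\<in>sets P. measure P B
      \<le> 2 * \<tau> * (16 * Dt k a f + (2 * a - a)\<^sup>2 * G2) / \<delta>\<^sup>2 \<and>
    (\<forall>\<omega>\<in>space P - B. \<forall>c\<in>{a..2 * a}. \<bar>\<Sum>j\<in>J. W j \<omega> * (\<alpha> j * p (rc c j))\<bar> \<le> \<delta>)"
  proof (rule noise.uncorrelated_maximal_inequality[where \<tau> = \<tau>
        and g' = "\<lambda>j t. \<alpha> j * (p' (rc t j) * - (lam j * (rc t j)\<^sup>2))", OF finite_J WW cov])
    fix j t assume j: "j \<in> J" and t: "t \<in> {a..2 * a}"
    then have t0: "0 \<le> t" using a by simp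
    show "((\<lambda>c. \<alpha> j * p (rc c j)) has_real_derivative \<alpha> j * (p' (rc t j) * - (lam j * (rc t j)\<^sup>2))) (at t)"
      by (intro DERIV_cmult DERIV_chain2[OF p(1)] rc_deriv t0 j)
  next
    fix j assume j: "j \<in> J"
    have nz: "1 + c * lam j \<noteq> 0" if "c \<in> {a..2 * a}" for c
      using one_plus_pos[OF _ j, of c] that a by auto
    have "continuous_on {a..2 * a} (\<lambda>t. rc t j)"
      unfolding rc_def using nz by (intro continuous_intros) auto
    then show "continuous_on {a..2 * a} (\<lambda>t. \<alpha> j * (p' (rc t j) * - (lam j * (rc t j)\<^sup>2)))"
      using continuous_on_compose2[OF p(2)] by (intro continuous_intros) auto
  next
    fix t assume t: "t \<in> {a..2 * a}"
    then have t0: "0 < t" "0 \<le> t" using a by auto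
    have "t\<^sup>2 * (\<Sum>j\<in>J. (\<alpha> j * (p' (rc t j) * - (lam j * (rc t j)\<^sup>2)))\<^sup>2)
      = (\<Sum>j\<in>J. (\<alpha> j)\<^sup>2 * (p' (rc t j) * rc t j * (1 - rc t j))\<^sup>2)"
      unfolding sum_distrib_left
    proof (intro sum.cong refl)
      fix j assume j: "j \<in> J"
      have *: "1 - rc t j = t * lam j * rc t j"
        using one_minus_rc[OF t0(2) j] by (simp add: rc_def)
      show "t\<^sup>2 * (\<alpha> j * (p' (rc t j) * - (lam j * (rc t j)\<^sup>2)))\<^sup>2
        = (\<alpha> j)\<^sup>2 * (p' (rc t j) * rc t j * (1 - rc t j))\<^sup>2"
        unfolding * by (simp add: power2_eq_square)
    qed
    also have "\<dots> \<le> 16 * Dt k t f" by (rule b2[OF t0(1)])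
    also have "\<dots> \<le> 64 * Dt k a f" using Dtot_comparable(2)[of a t k f] t a by simp
    finally have *: "(\<Sum>j\<in>J. (\<alpha> j * (p' (rc t j) * - (lam j * (rc t j)\<^sup>2)))\<^sup>2) \<le> 64 * Dt k a f / t\<^sup>2"
      using t0 by (simp add: pos_le_divide_eq mult.commute)
    also have "\<dots> \<le> G2"
      unfolding G2_def using t a D by (intro divide_left_mono power_mono mult_pos_pos zero_less_power) auto
    finally show "(\<Sum>j\<in>J. (\<alpha> j * (p' (rc t j) * - (lam j * (rc t j)\<^sup>2)))\<^sup>2) \<le> G2" .
  next
    show "(\<Sum>j\<in>J. (\<alpha> j * p (rc a j))\<^sup>2) \<le> 16 * Dt k a f"
      using b1[OF a] by (simp add: power_mult_distrib)
  qed (use a \<tau> D in \<open>auto simp: \<delta>_def\<close>)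
  then obtain B where B: "B \<in> sets P"
    "measure P B \<le> 2 * \<tau> * (16 * Dt k a f + (2 * a - a)\<^sup>2 * G2) / \<delta>\<^sup>2"
    "\<And>\<omega> c. \<omega> \<in> space P - B \<Longrightarrow> c \<in> {a..2 * a} \<Longrightarrow> \<bar>\<Sum>j\<in>J. W j \<omega> * (\<alpha> j * p (rc c j))\<bar> \<le> \<delta>"
    by blast
  \<comment> \<open>92160 = 2 * (16 + 64) * 24^2; the bound \<open>\<tau> \<le> 2\<close> doubles it
    to 184320.\<close>
  have "2 * \<tau> * (16 * Dt k a f + (2 * a - a)\<^sup>2 * G2) / \<delta>\<^sup>2 = \<tau> * 92160 / Dt k a f"
    using D a by (simp add: G2_def \<delta>_def power2_eq_square field_simps)
  also have "\<dots> \<le> 184320 / Dt k a f"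
    using \<tau> D by (intro divide_right_mono) auto
  finally have "measure P B \<le> 184320 / Dt k a f" using B(2) by simp
  moreover have "\<bar>\<Sum>j\<in>J. W j \<omega> * (\<alpha> j * p (rc c j))\<bar> \<le> Dt k c f / 6"
    if "\<omega> \<in> space P - B" "c \<in> {a..2 * a}" for \<omega> c
    using B(3)[OF that] Dtot_comparable(1)[of a c k f] that(2) a by (simp add: \<delta>_def)
  ultimately show ?thesis using B(1) by blast
qed

end

section \<open>The four remainders as polynomials in the shrinkage factor\<close>

context regression_at
begin

lemma zcoef_uncorrelated:
  assumes "j \<in> J" "k \<in> J"
  shows "integrable P (\<lambda>\<omega>. Z \<omega> j * Z \<omega> k)"
    and "(\<integral>\<omega>. Z \<omega> j * Z \<omega> k \<partial>P) = (if j = k then 1 else 0)"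
  using assms by (simp_all add: zcoef_lin noise.integrable_lin_prod noise.expectation_lin_prod sum_e)

lemma zcoef_sq_uncorrelated:
  assumes j: "j \<in> J" and k: "k \<in> J"
  shows "integrable P (\<lambda>\<omega>. ((Z \<omega> j)\<^sup>2 - 1) * ((Z \<omega> k)\<^sup>2 - 1))"
    and "(\<integral>\<omega>. ((Z \<omega> j)\<^sup>2 - 1) * ((Z \<omega> k)\<^sup>2 - 1) \<partial>P) = (if j = k then 2 else 0)"
proof -
  have sq: "noise.sq (\<lambda>i. eigvec S n j $ i) = 1" if "j \<in> J" for j
    using sum_e[OF that that] by (simp add: power2_eq_square)
  note * = noise.expectation_centred_sq_prod[of "\<lambda>i. eigvec S n j $ i" "\<lambda>i. eigvec S n k $ i",
      unfolded sq[OF j] sq[OF k] sum_e[OF j k] zcoef_lin[OF j, symmetric] zcoef_lin[OF k, symmetric]]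
  show "integrable P (\<lambda>\<omega>. ((Z \<omega> j)\<^sup>2 - 1) * ((Z \<omega> k)\<^sup>2 - 1))"
    by (rule *(2))
  show "(\<integral>\<omega>. ((Z \<omega> j)\<^sup>2 - 1) * ((Z \<omega> k)\<^sup>2 - 1) \<partial>P) = (if j = k then 2 else 0)"
    using *(1) by simp
qed

lemma abs_mult_shrink_le:
  fixes q r :: real
  assumes "0 \<le> r" "r \<le> 1" "\<bar>q\<bar> \<le> 2"
  shows "\<bar>q * r * (1 - r)\<bar> \<le> 2 * r" "\<bar>q * r * (1 - r)\<bar> \<le> 2 * (1 - r)"
proof -
  have "\<bar>q\<bar> * (r * (1 - r)) \<le> 2 * (r * 1)" using assms by (intro mult_mono) auto
  then show "\<bar>q * r * (1 - r)\<bar> \<le> 2 * r" using assms by (simp add: abs_mult mult.assoc)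
  have "\<bar>q\<bar> * (r * (1 - r)) \<le> 2 * (1 * (1 - r))" using assms by (intro mult_mono) auto
  then show "\<bar>q * r * (1 - r)\<bar> \<le> 2 * (1 - r)" using assms by (simp add: abs_mult mult.assoc)
qed

text \<open>Terms linear in the noise carry the signal coefficients and have to be charged to the
  bias part of \<open>Dtot\<close>, whose summand contains \<open>(rc c j)\<^sup>2\<close>. Hence
  \<open>p\<close> must vanish at 0 at least linearly; the 16 of \<open>dyadic_block\<close> is the
  product of the two squared factors 2.\<close>

lemma linear_block:
  assumes a: "0 < a" and D: "0 < Dt k a f"
    and p: "\<And>r. (p has_real_derivative p' r) (at r)" "continuous_on UNIV p'"
    and pb: "\<And>r. 0 \<le> r \<Longrightarrow> r \<le> 1 \<Longrightarrow> \<bar>p r\<bar> \<le> 2 * r" "\<And>r. 0 \<le> r \<Longrightarrow> r \<le> 1 \<Longrightarrow> \<bar>p' r\<bar> \<le> 2"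
  shows "\<exists>B\<in>sets P. measure P B \<le> 184320 / Dt k a f \<and>
    (\<forall>\<omega>\<in>space P - B. \<forall>c\<in>{a..2 * a}.
      \<bar>\<Sum>j\<in>J. Z \<omega> j * (2 * F f j * p (rc c j))\<bar> \<le> Dt k c f / 6)"
proof (rule dyadic_block[OF zcoef_uncorrelated _ _ a D p])
  have *: "(\<Sum>j\<in>J. (2 * F f j)\<^sup>2 * (q (rc c j))\<^sup>2) \<le> 16 * Dt k c f"
    if c: "0 < c" and q: "\<And>r. 0 \<le> r \<Longrightarrow> r \<le> 1 \<Longrightarrow> \<bar>q r\<bar> \<le> 2 * r" for q c
  proof -
    have "(\<Sum>j\<in>J. (2 * F f j)\<^sup>2 * (q (rc c j))\<^sup>2) \<le> (\<Sum>j\<in>J. (2 * F f j)\<^sup>2 * (2 * rc c j)\<^sup>2)"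
    proof (intro sum_mono mult_left_mono)
      fix j assume j: "j \<in> J"
      show "(q (rc c j))\<^sup>2 \<le> (2 * rc c j)\<^sup>2"
        using q[of "rc c j"] rc_bounds[OF less_imp_le[OF c] j] by (intro abs_le_square_iff[THEN iffD1]) simp
    qed simp
    also have "\<dots> = 16 * D1 Risk S n c f"
      by (simp add: rc_def power_mult_distrib power_divide sum_distrib_left)
    also have "\<dots> \<le> 16 * Dt k c f"
      using D1_Risk_le[of c f k] D2_nonneg[of c k] c by (simp add: Dtot_def)
    finally show ?thesis .
  qed
  show "(\<Sum>j\<in>J. (2 * F f j)\<^sup>2 * (p (rc c j))\<^sup>2) \<le> 16 * Dt k c f" if "0 < c" for c
    by (rule *[OF that pb(1)])
  show "(\<Sum>j\<in>J. (2 * F f j)\<^sup>2 * (p' (rc c j) * rc c j * (1 - rc c j))\<^sup>2) \<le> 16 * Dt k c f"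
    if "0 < c" for c
    using *[OF that, of "\<lambda>r. p' r * r * (1 - r)"] abs_mult_shrink_le(1) pb(2) by simp
qed simp_all

text \<open>Centred squares carry no signal and are charged to the variance part, whose summand in
  the risk case is \<open>(1 - rc c j)\<^sup>2\<close>; so \<open>p\<close> must now vanish at 1.
  Their variance 2 is the largest \<open>\<tau>\<close> that \<open>dyadic_block\<close>
  admits.\<close>

lemma square_block:
  assumes a: "0 < a" and D: "0 < Dt k a f"
    and p: "\<And>r. (p has_real_derivative p' r) (at r)" "continuous_on UNIV p'"
    and pb: "\<And>r. 0 \<le> r \<Longrightarrow> r \<le> 1 \<Longrightarrow> \<bar>p r\<bar> \<le> 2 * (1 - r)" "\<And>r. 0 \<le> r \<Longrightarrow> r \<le> 1 \<Longrightarrow> \<bar>p' r\<bar> \<le> 2"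
  shows "\<exists>B\<in>sets P. measure P B \<le> 184320 / Dt k a f \<and>
    (\<forall>\<omega>\<in>space P - B. \<forall>c\<in>{a..2 * a}.
      \<bar>\<Sum>j\<in>J. ((Z \<omega> j)\<^sup>2 - 1) * (1 * p (rc c j))\<bar> \<le> Dt k c f / 6)"
proof (rule dyadic_block[OF zcoef_sq_uncorrelated _ _ a D p])
  have *: "(\<Sum>j\<in>J. 1\<^sup>2 * (q (rc c j))\<^sup>2) \<le> 16 * Dt k c f"
    if c: "0 < c" and q: "\<And>r. 0 \<le> r \<Longrightarrow> r \<le> 1 \<Longrightarrow> \<bar>q r\<bar> \<le> 2 * (1 - r)" for q c
  proof -
    have "(\<Sum>j\<in>J. 1\<^sup>2 * (q (rc c j))\<^sup>2) \<le> (\<Sum>j\<in>J. 1\<^sup>2 * (2 * (1 - rc c j))\<^sup>2)"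
    proof (intro sum_mono mult_left_mono)
      fix j assume j: "j \<in> J"
      show "(q (rc c j))\<^sup>2 \<le> (2 * (1 - rc c j))\<^sup>2"
        using q[of "rc c j"] rc_bounds[OF less_imp_le[OF c] j] by (intro abs_le_square_iff[THEN iffD1]) simp
    qed simp
    also have "\<dots> = 4 * D2 Risk S n c"
      using one_minus_rc[OF less_imp_le[OF c]] by (simp add: power_mult_distrib power_divide sum_distrib_left)
    also have "\<dots> \<le> 16 * Dt k c f"
      using D2_Risk_le[of c k] D1_nonneg[of c k f] D2_nonneg[of c k] c by (simp add: Dtot_def)
    finally show ?thesis .
  qed
  show "(\<Sum>j\<in>J. 1\<^sup>2 * (p (rc c j))\<^sup>2) \<le> 16 * Dt k c f" if "0 < c" for c
    by (rule *[OF that pb(1)])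
  show "(\<Sum>j\<in>J. 1\<^sup>2 * (p' (rc c j) * rc c j * (1 - rc c j))\<^sup>2) \<le> 16 * Dt k c f"
    if "0 < c" for c
    using *[OF that, of "\<lambda>r. p' r * r * (1 - r)"] abs_mult_shrink_le(2) pb(2) by simp
qed simp_all

lemma remainder_rc:
  "R1 Risk S n c f \<omega> = (\<Sum>j\<in>J. Z \<omega> j * (2 * F f j * (rc c j)\<^sup>2))"
  "R1 Likelihood S n c f \<omega> = (\<Sum>j\<in>J. Z \<omega> j * (2 * F f j * rc c j))"
  "R2 Risk S n c \<omega> = (\<Sum>j\<in>J. ((Z \<omega> j)\<^sup>2 - 1) * (1 * ((rc c j)\<^sup>2 - 1)))"
  by (simp_all add: rc_def sum_distrib_left power_divide mult_ac)

text \<open>Here a quotient with numerator \<open>c * lam j\<close> is rewritten as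
  \<open>1 - rc c j\<close>, which takes a nonzero denominator and hence the sign of
  \<open>c\<close>.\<close>

lemma remainder_rc':
  assumes c: "0 \<le> c"
  shows "R2 Likelihood S n c \<omega> = (\<Sum>j\<in>J. ((Z \<omega> j)\<^sup>2 - 1) * (1 * (rc c j - 1)))"
    "R3 S n c f \<omega> = (\<Sum>j\<in>J. Z \<omega> j * (2 * F f j * (rc c j * (rc c j - 1))))"
    "R4 S n c \<omega> = (\<Sum>j\<in>J. ((Z \<omega> j)\<^sup>2 - 1) * (1 * (1 - rc c j)\<^sup>2))"
proof -
  have r: "rc c j - 1 = - (c * lam j * rc c j)" if "j \<in> J" for j
    using one_minus_rc[OF c that] by (simp add: rc_def)
  have "R2 Likelihood S n c \<omega> = (\<Sum>j\<in>J. ((Z \<omega> j)\<^sup>2 - 1) * (1 * - (c * lam j * rc c j)))"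
    by (simp add: rc_def sum_negf mult_ac)
  then show "R2 Likelihood S n c \<omega> = (\<Sum>j\<in>J. ((Z \<omega> j)\<^sup>2 - 1) * (1 * (rc c j - 1)))"
    using r by (simp only: cong: sum.cong)
  have "R3 S n c f \<omega> = (\<Sum>j\<in>J. Z \<omega> j * (2 * F f j * (rc c j * - (c * lam j * rc c j))))"
    unfolding R3_def sum_distrib_left by (intro sum.cong refl) (simp add: rc_def power2_eq_square mult_ac)
  then show "R3 S n c f \<omega> = (\<Sum>j\<in>J. Z \<omega> j * (2 * F f j * (rc c j * (rc c j - 1))))"
    using r by (simp only: cong: sum.cong)
  have r': "(1 - rc c j)\<^sup>2 = (c * lam j * rc c j)\<^sup>2" if "j \<in> J" for j
    using one_minus_rc[OF c that] by (simp add: rc_def)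
  have "R4 S n c \<omega> = (\<Sum>j\<in>J. ((Z \<omega> j)\<^sup>2 - 1) * (1 * (c * lam j * rc c j)\<^sup>2))"
    unfolding R4_def by (intro sum.cong refl) (simp add: rc_def power_mult_distrib power_divide mult_ac)
  then show "R4 S n c \<omega> = (\<Sum>j\<in>J. ((Z \<omega> j)\<^sup>2 - 1) * (1 * (1 - rc c j)\<^sup>2))"
    using r' by (simp only: cong: sum.cong)
qed

text \<open>737280 = 4 * 184320, one exceptional set for each remainder. Two bounds by a sixth add
  up to the third in \<open>small_remainders\<close>.\<close>

lemma remainder_block:
  assumes a: "0 < a" and D: "0 < Dt k a f"
  shows "\<exists>B\<in>sets P. measure P B \<le> 737280 / Dt k a f \<and>
    (\<forall>\<omega>\<in>space P - B. \<forall>c\<in>{a..2 * a}.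
      small_remainders k S n f c \<omega>)"
proof -
  define good where "good R B \<longleftrightarrow> B \<in> sets P \<and> measure P B \<le> 184320 / Dt k a f \<and>
    (\<forall>\<omega>\<in>space P - B. \<forall>c\<in>{a..2 * a}. \<bar>R c \<omega>\<bar> \<le> Dt k c f / 6)" for R B
  have c0: "0 \<le> c" if "c \<in> {a..2 * a}" for c using that a by simp
  have "\<exists>B. good (\<lambda>c. R1 k S n c f) B"
  proof (cases k)
    case Risk
    have "((\<lambda>r. r\<^sup>2) has_real_derivative 2 * r) (at r)" for r :: real
      by (auto intro!: derivative_eq_intros)
    moreover have "\<bar>r\<^sup>2\<bar> \<le> 2 * r" if "0 \<le> r" "r \<le> 1" for r :: real
      using that mult_right_mono[of r 2 r] by (simp add: power2_eq_square)
    ultimately have "\<exists>B\<in>sets P. measure P B \<le> 184320 / Dt k a f \<and>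
      (\<forall>\<omega>\<in>space P - B. \<forall>c\<in>{a..2 * a}.
      \<bar>\<Sum>j\<in>J. Z \<omega> j * (2 * F f j * (rc c j)\<^sup>2)\<bar> \<le> Dt k c f / 6)"
      by (intro linear_block[OF a D, of "\<lambda>r. r\<^sup>2" "\<lambda>r. 2 * r"]) (auto intro!: continuous_intros)
    then show ?thesis unfolding good_def Risk remainder_rc by blast
  next
    case Likelihood
    from linear_block[OF a D, of "\<lambda>r. r" "\<lambda>r. 1"] show ?thesis
      by (auto simp: good_def Likelihood remainder_rc simp del: R1.simps)
  qed
  moreover have "\<exists>B. good (R2 k S n) B"
  proof (cases k)
    case Risk
    have "((\<lambda>r. r\<^sup>2 - 1) has_real_derivative 2 * r) (at r)" for r :: real
      by (auto intro!: derivative_eq_intros)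
    moreover have "\<bar>r\<^sup>2 - 1\<bar> \<le> 2 * (1 - r)" if "0 \<le> r" "r \<le> 1" for r :: real
    proof -
      have "(1 - r) * (1 + r) \<le> (1 - r) * 2" using that by (intro mult_left_mono) auto
      moreover have "0 \<le> (1 - r) * (1 + r)" using that by (intro mult_nonneg_nonneg) auto
      ultimately
      show ?thesis by (simp add: power2_eq_square algebra_simps abs_le_iff)
    qed
    ultimately have "\<exists>B\<in>sets P. measure P B \<le> 184320 / Dt k a f \<and>
      (\<forall>\<omega>\<in>space P - B. \<forall>c\<in>{a..2 * a}.
      \<bar>\<Sum>j\<in>J. ((Z \<omega> j)\<^sup>2 - 1) * (1 * ((rc c j)\<^sup>2 - 1))\<bar> \<le> Dt k c f / 6)"
      by (intro square_block[OF a D, of "\<lambda>r. r\<^sup>2 - 1" "\<lambda>r. 2 * r"]) (auto intro!: continuous_intros)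
    then show ?thesis unfolding good_def Risk remainder_rc by blast
  next
    case Likelihood
    have "\<exists>B\<in>sets P. measure P B \<le> 184320 / Dt k a f \<and>
      (\<forall>\<omega>\<in>space P - B. \<forall>c\<in>{a..2 * a}.
      \<bar>\<Sum>j\<in>J. ((Z \<omega> j)\<^sup>2 - 1) * (1 * (rc c j - 1))\<bar> \<le> Dt k c f / 6)"
      by (intro square_block[OF a D, of "\<lambda>r. r - 1" "\<lambda>r. 1"]) (auto intro!: derivative_eq_intros)
    then show ?thesis unfolding good_def Likelihood using remainder_rc'(1)[OF c0] by (metis (no_types, lifting))
  qed
  moreover have "\<exists>B. good (\<lambda>c. R3 S n c f) B"
  proof -
    have "\<bar>r * (r - 1)\<bar> \<le> 2 * r" if "0 \<le> r" "r \<le> 1" for r :: real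
      using abs_mult_shrink_le(1)[OF that, of 1] by (simp add: abs_mult abs_minus_commute)
    moreover have "((\<lambda>r. r * (r - 1)) has_real_derivative 2 * r - 1) (at r)" for r :: real
      by (auto intro!: derivative_eq_intros)
    ultimately have "\<exists>B\<in>sets P. measure P B \<le> 184320 / Dt k a f \<and>
      (\<forall>\<omega>\<in>space P - B. \<forall>c\<in>{a..2 * a}.
      \<bar>\<Sum>j\<in>J. Z \<omega> j * (2 * F f j * (rc c j * (rc c j - 1)))\<bar> \<le> Dt k c f / 6)"
      by (intro linear_block[OF a D, of "\<lambda>r. r * (r - 1)" "\<lambda>r. 2 * r - 1"]) (auto intro!: continuous_intros)
    then show ?thesis unfolding good_def using remainder_rc'(2)[OF c0] by (metis (no_types, lifting))
  qed
  moreover have "\<exists>B. good (R4 S n) B"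
  proof -
    have "\<bar>(1 - r)\<^sup>2\<bar> \<le> 2 * (1 - r)" if "0 \<le> r" "r \<le> 1" for r :: real
    proof -
      have "(1 - r) * (1 - r) \<le> 2 * (1 - r)" using that by (intro mult_right_mono) auto
      then show ?thesis by (simp add: power2_eq_square)
    qed
    moreover have "((\<lambda>r. (1 - r)\<^sup>2) has_real_derivative 2 * r - 2) (at r)" for r :: real
      by (auto intro!: derivative_eq_intros)
    ultimately have "\<exists>B\<in>sets P. measure P B \<le> 184320 / Dt k a f \<and>
      (\<forall>\<omega>\<in>space P - B. \<forall>c\<in>{a..2 * a}.
      \<bar>\<Sum>j\<in>J. ((Z \<omega> j)\<^sup>2 - 1) * (1 * (1 - rc c j)\<^sup>2)\<bar> \<le> Dt k c f / 6)"
      by (intro square_block[OF a D, of "\<lambda>r. (1 - r)\<^sup>2" "\<lambda>r. 2 * r - 2"]) (auto intro!: continuous_intros)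
    then show ?thesis unfolding good_def using remainder_rc'(3)[OF c0] by (metis (no_types, lifting))
  qed
  ultimately obtain B1 B2 B3 B4 where B: "good (\<lambda>c. R1 k S n c f) B1" "good (R2 k S n) B2"
    "good (\<lambda>c. R3 S n c f) B3" "good (R4 S n) B4" by blast
  have "measure P (B1 \<union> B2 \<union> (B3 \<union> B4)) \<le> 4 * (184320 / Dt k a f)"
    using B measure_Un_le[of "B1 \<union> B2" "P" "B3 \<union> B4"] measure_Un_le[of B1 "P" B2]
      measure_Un_le[of B3 "P" B4]
    unfolding good_def by auto
  moreover have "small_remainders k S n f c \<omega>"
    if "\<omega> \<in> space P - (B1 \<union> B2 \<union> (B3 \<union> B4))" and c: "c \<in> {a..2 * a}" for \<omega> c
  proof -
    have "\<bar>R1 k S n c f \<omega>\<bar> \<le> Dt k c f / 6" "\<bar>R2 k S n c \<omega>\<bar> \<le> Dt k c f / 6"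
      "\<bar>R3 S n c f \<omega>\<bar> \<le> Dt k c f / 6" "\<bar>R4 S n c \<omega>\<bar> \<le> Dt k c f / 6"
      using B that unfolding good_def by blast+
    then show ?thesis using Dtot_nonneg[OF c0[OF c], of k f] by linarith
  qed
  ultimately show ?thesis using B unfolding good_def by (intro bexI[of _ "B1 \<union> B2 \<union> (B3 \<union> B4)"]) auto
qed

text \<open>Chebyshev's inequality, as the maximal inequality on the one-point interval
  \<open>{c..c}\<close>: \<open>Nstat - s2\<close> is a sum of centred squares with weights
  \<open>wt c j\<close>, whose squares sum to \<open>D2 Risk\<close>. Since \<open>s2\<close>
  dominates \<open>D2 Risk\<close>, the relative variance is of order
  \<open>1 / D2 Risk\<close>.\<close>

lemma Nstat_lower_tail:
  assumes c: "0 < c" and D: "0 < D2 Risk S n c"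
  shows "prob_small_Nstat S n c \<le> 16 / D2 Risk S n c"
proof -
  have c0: "0 \<le> c" using c by simp
  have s: "0 < s2 S n c" using D D2_Risk_le_s2[OF c0] by linarith
  have "\<exists>B\<in>sets P. measure P B \<le> 2 * 2 * (D2 Risk S n c + (c - c)\<^sup>2 * 0) / (s2 S n c / 2)\<^sup>2 \<and>
    (\<forall>\<omega>\<in>space P - B. \<forall>x\<in>{c..c}. \<bar>\<Sum>j\<in>J. ((Z \<omega> j)\<^sup>2 - 1) * wt c j\<bar> \<le> s2 S n c / 2)"
    by (rule noise.uncorrelated_maximal_inequality[where g = "\<lambda>j x. wt c j" and g' = "\<lambda>j x. 0",
          OF finite_J zcoef_sq_uncorrelated]) (use s in \<open>auto simp: power_divide\<close>)
  then obtain B where B: "B \<in> sets P"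
    "measure P B \<le> 2 * 2 * (D2 Risk S n c + (c - c)\<^sup>2 * 0) / (s2 S n c / 2)\<^sup>2"
    "\<And>\<omega>. \<omega> \<in> space P - B \<Longrightarrow> \<bar>\<Sum>j\<in>J. ((Z \<omega> j)\<^sup>2 - 1) * wt c j\<bar> \<le> s2 S n c / 2"
    by auto
  have "(\<Sum>j\<in>J. ((Z \<omega> j)\<^sup>2 - 1) * wt c j) = Nstat S n c \<omega> - s2 S n c" for \<omega>
    unfolding Nstat_def s2_def sum_subtractf[symmetric]
    by (intro sum.cong refl) (simp add: algebra_simps diff_divide_distrib)
  then have "\<bar>Nstat S n c \<omega> - s2 S n c\<bar> \<le> s2 S n c / 2" if "\<omega> \<in> space P - B" for \<omega>
    using B(3)[OF that] by simp
  note dev = this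
  have "s2 S n c / 4 \<le> Nstat S n c \<omega>" if "\<omega> \<in> space P - B" for \<omega>
    using dev[OF that] s by linarith
  then have "{\<omega> \<in> space P. Nstat S n c \<omega> < s2 S n c / 4} \<subseteq> B"
    by (auto simp: not_less[symmetric])
  then have "prob_small_Nstat S n c \<le> measure P B"
    using B(1) by (intro noise.finite_measure_mono)
  also have "\<dots> \<le> 16 * D2 Risk S n c / (s2 S n c)\<^sup>2" using B(2) by (simp add: power_divide)
  also have "\<dots> \<le> 16 * D2 Risk S n c / (D2 Risk S n c)\<^sup>2"
    using D s D2_Risk_le_s2[OF c0] by (intro divide_left_mono power_mono mult_pos_pos zero_less_power) auto
  also have "\<dots> = 16 / D2 Risk S n c" using D by (simp add: power2_eq_square)
  finally show ?thesis .
qed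

end

section \<open>Coverage under polynomial growth of the effective dimension\<close>

lemma exists_dyadic:
  fixes l c :: real
  assumes "0 < l" "l \<le> c"
  obtains i where "2 ^ i * l \<le> c" "c \<le> 2 * (2 ^ i * l)"
proof -
  obtain M where "c / l < 2 ^ M" using real_arch_pow[of 2 "c / l"] by auto
  then have M: "c < 2 ^ M * l" using assms(1) by (simp add: divide_less_eq)
  define k where "k = (LEAST k. c < 2 ^ k * l)"
  have k: "c < 2 ^ k * l" unfolding k_def by (rule LeastI[of "\<lambda>k. c < 2 ^ k * l", OF M])
  then have "k \<noteq> 0" using assms(2) by (cases k) auto
  then obtain i where i: "k = Suc i" by (cases k) auto
  then have "\<not> c < 2 ^ i * l" using not_less_Least[of i "\<lambda>k. c < 2 ^ k * l"] unfolding k_def[symmetric] by simp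
  then show thesis using that[of i] k i by simp
qed

text \<open>The failure probability of a block is inversely proportional to \<open>Dtot\<close> at
  its left end, so geometric growth turns the union bound into a convergent series, and the number
  of blocks drops out.\<close>

lemma (in regression_at) remainder_union:
  assumes l: "0 < l" and \<tau>: "0 < \<tau>" and \<beta>: "1 < \<beta>"
    and D: "\<And>i. 2 ^ i * l \<le> u \<Longrightarrow> \<tau> * \<beta> ^ i \<le> Dt k (2 ^ i * l) f"
  shows "\<exists>B\<in>sets P. measure P B \<le> 737280 / (\<tau> * (1 - 1 / \<beta>)) \<and>
    (\<forall>\<omega>\<in>space P - B. \<forall>c\<in>{l..u}.
      small_remainders k S n f c \<omega>)"
proof -
  obtain M where "u / l < 2 ^ M" using real_arch_pow[of 2 "u / l"] by auto
  then have M: "u < 2 ^ M * l" using l by (simp add: divide_less_eq)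
  \<comment> \<open>Growth is known only at left ends inside the range, so blocks that start beyond
    \<open>u\<close> are excluded.\<close>
  define F where "F = {i. i < M \<and> 2 ^ i * l \<le> u}"
  have F: "finite F" by (simp add: F_def)
  have "\<exists>B\<in>sets P. measure P B \<le> 737280 / Dt k (2 ^ i * l) f \<and>
    (\<forall>\<omega>\<in>space P - B. \<forall>c\<in>{2 ^ i * l..2 * (2 ^ i * l)}.
      small_remainders k S n f c \<omega>)" if "i \<in> F" for i
  proof (rule remainder_block)
    have "0 < \<tau> * \<beta> ^ i" using \<tau> \<beta> by simp
    also have "\<dots> \<le> Dt k (2 ^ i * l) f" using D that by (simp add: F_def)
    finally show "0 < Dt k (2 ^ i * l) f" .
  qed (use l in simp)
  then obtain B where B: "\<And>i. i \<in> F \<Longrightarrow> B i \<in> sets P"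
    "\<And>i. i \<in> F \<Longrightarrow> measure P (B i) \<le> 737280 / Dt k (2 ^ i * l) f"
    "\<And>i \<omega> c. i \<in> F \<Longrightarrow> \<omega> \<in> space P - B i \<Longrightarrow> c \<in> {2 ^ i * l..2 * (2 ^ i * l)} \<Longrightarrow>
      small_remainders k S n f c \<omega>"
    by metis
  have "measure P (\<Union>i\<in>F. B i) \<le> (\<Sum>i\<in>F. measure P (B i))"
    using B(1) F by (intro noise.finite_measure_subadditive_finite) auto
  also have "\<dots> \<le> (\<Sum>i\<in>F. 737280 / \<tau> * (1 / \<beta>) ^ i)"
  proof (rule sum_mono)
    fix i assume i: "i \<in> F"
    have p: "0 < \<tau> * \<beta> ^ i" using \<tau> \<beta> by simp
    have "737280 / Dt k (2 ^ i * l) f \<le> 737280 / (\<tau> * \<beta> ^ i)"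
      using p D[of i] i by (intro frac_le) (auto simp: F_def)
    then show "measure P (B i) \<le> 737280 / \<tau> * (1 / \<beta>) ^ i"
      using B(2)[OF i] by (simp add: power_divide)
  qed
  also have "\<dots> \<le> (\<Sum>i<M. 737280 / \<tau> * (1 / \<beta>) ^ i)"
    using \<tau> \<beta> by (intro sum_mono2) (auto simp: F_def)
  also have "\<dots> = 737280 / \<tau> * ((1 - (1 / \<beta>) ^ M) / (1 - 1 / \<beta>))"
    using \<beta> by (simp only: sum_distrib_left[symmetric]) (simp add: sum_gp_strict)
  also have "\<dots> \<le> 737280 / \<tau> * (1 / (1 - 1 / \<beta>))"
    using \<tau> \<beta> by (intro mult_left_mono divide_right_mono) auto
  also have "\<dots> = 737280 / (\<tau> * (1 - 1 / \<beta>))" by simp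
  finally have "measure P (\<Union>i\<in>F. B i) \<le> 737280 / (\<tau> * (1 - 1 / \<beta>))" .
  moreover have "(\<Union>i\<in>F. B i) \<in> sets P" using B(1) F by auto
  moreover have "small_remainders k S n f c \<omega>"
    if \<omega>: "\<omega> \<in> space P - (\<Union>i\<in>F. B i)" and c: "c \<in> {l..u}" for \<omega> c
  proof -
    obtain i where i: "2 ^ i * l \<le> c" "c \<le> 2 * (2 ^ i * l)" using exists_dyadic[of l c] l c by auto
    have "2 ^ i * l < 2 ^ M * l" using i(1) M c by simp
    then have "(2::real) ^ i < 2 ^ M" using l by (simp add: mult_less_cancel_right)
    then have "i < M" by simp
    then have "i \<in> F" using i(1) c by (simp add: F_def)
    then show ?thesis using B(3)[of i \<omega> c] \<omega> i by auto
  qed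
  ultimately show ?thesis by blast
qed

lemma power_powr_commute: "0 < x \<Longrightarrow> ((x::real) ^ i) powr p = (x powr p) ^ i"
  by (induction i) (simp_all add: powr_mult)

lemma powr_ln_at_top:
  assumes "0 < p" "\<And>n. n \<le> N n"
  shows "filterlim (\<lambda>n. ln (real (N n)) powr p) at_top sequentially"
proof -
  have "filterlim N at_top sequentially"
    using assms(2) by (intro filterlim_at_top_mono[OF filterlim_ident]) auto
  then have 1: "filterlim (\<lambda>n. ln (real (N n))) at_top sequentially"
    by (intro filterlim_compose[OF ln_at_top] filterlim_compose[OF filterlim_real_sequentially])
  show ?thesis unfolding filterlim_at_top
  proof
    fix Z :: real
    have "\<forall>\<^sub>F n in sequentially. max Z 1 powr (1 / p) \<le> ln (real (N n))"
      using 1 unfolding filterlim_at_top by blast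
    then show "\<forall>\<^sub>F n in sequentially. Z \<le> ln (real (N n)) powr p"
    proof eventually_elim
      case (elim n)
      have "(max Z 1 powr (1 / p)) powr p \<le> ln (real (N n)) powr p"
        using elim assms(1) by (intro powr_mono2) auto
      then show ?case using assms(1) by (simp add: powr_powr)
    qed
  qed
qed

text \<open>Growth is required of \<open>D2 Risk\<close> because it is the smallest of the
  variances: at most \<open>s2\<close> and at most \<open>2 * D2 k\<close>. The domination by
  \<open>s2\<close> concerns \<open>D2 Likelihood\<close>, since it holds for \<open>D2 Risk\<close>
  with constant 1.\<close>

proposition coverage_growth:
  fixes S :: "('x, 'v, 'w, 'j) regression"
  assumes model: "regression_model S" and est: "is_estimator k S m f chat" and bias: "bias_cond k S m f"
    and npts: "\<And>n. n \<le> npts S n" and m: "1 \<le> m" and \<kappa>: "0 < \<kappa>"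
    and growth: "\<forall>\<^sub>F n in sequentially. \<forall>c\<in>Iset S m n.
      \<kappa> * (c * real (npts S n)) powr (1 / m) \<le> D2 Risk S n c \<and> D2 Likelihood S n c \<le> C * s2 S n c"
  shows "covers S f chat"
proof -
  define X where "X n = ln (real (npts S n)) powr (1 / m)" for n
  have X: "filterlim X at_top sequentially"
    unfolding X_def using m npts by (intro powr_ln_at_top) auto
  have lim0: "(\<lambda>n. A / X n) \<longlonglongrightarrow> 0" for A
    by (intro tendsto_divide_0[OF tendsto_const] filterlim_at_top_imp_at_infinity X)
  define \<beta> where "\<beta> = (2::real) powr (1 / m)"
  have \<beta>: "1 < \<beta>" using m by (simp add: \<beta>_def gr_one_powr)
  have prob: "prob_space (noise_space S n)" for n using model by (simp add: regression_model_def)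
  have base: "\<forall>\<^sub>F n in sequentially. 0 < X n \<and> (\<forall>c\<in>Iset S m n. 0 < c \<and>
      \<kappa> * X n \<le> D2 Risk S n c \<and> D2 k S n c \<le> max C 1 * s2 S n c \<and> 0 < s2 S n c)"
    using growth eventually_ge_at_top[of 2]
  proof eventually_elim
    case (elim n)
    interpret regression_at S n by unfold_locales (rule model)
    have N: "2 \<le> npts S n" using npts[of n] elim by simp
    then have ln: "0 < ln (real (npts S n))" by simp
    then have X0: "0 < X n" by (simp add: X_def)
    have "0 < c \<and> \<kappa> * X n \<le> D2 Risk S n c \<and> D2 k S n c \<le> max C 1 * s2 S n c \<and> 0 < s2 S n c"
      if c: "c \<in> Iset S m n" for c
    proof -
      have "ln (real (npts S n)) / real (npts S n) \<le> c" using c by (simp add: Iset_def c_range_def)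
      then have 1: "ln (real (npts S n)) \<le> c * real (npts S n)" using N by (simp add: divide_le_eq)
      have c0: "0 < c" using 1 ln N by (metis less_le_trans of_nat_0_le_iff zero_less_mult_pos2 mult.commute zero_less_mult_iff not_less order_less_le)
      have "\<kappa> * X n \<le> \<kappa> * (c * real (npts S n)) powr (1 / m)"
        unfolding X_def using 1 ln \<kappa> m by (intro mult_left_mono powr_mono2) auto
      also have "\<dots> \<le> D2 Risk S n c" using elim(1) c by blast
      finally have 2: "\<kappa> * X n \<le> D2 Risk S n c" .
      have s: "0 < s2 S n c"
        using 2 X0 \<kappa> D2_Risk_le_s2[of c] c0 mult_pos_pos[OF \<kappa> X0] by linarith
      have "D2 Likelihood S n c \<le> C * s2 S n c" using elim(1) c by blast
      also have "\<dots> \<le> max C 1 * s2 S n c" using s by (intro mult_right_mono) auto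
      finally have 3: "D2 Likelihood S n c \<le> max C 1 * s2 S n c" .
      have "D2 Risk S n c \<le> 1 * s2 S n c" using D2_Risk_le_s2[of c] c0 by simp
      also have "\<dots> \<le> max C 1 * s2 S n c" using s by (intro mult_right_mono) auto
      finally have "D2 k S n c \<le> max C 1 * s2 S n c" using 3 by (cases k) simp_all
      then show ?thesis using c0 2 s by simp
    qed
    then show ?case using X0 by blast
  qed
  \<comment> \<open>The half of \<open>\<kappa>\<close> is the price of passing from
    \<open>D2 Risk\<close> to \<open>D2 k\<close>.\<close>
  define A where "A = 737280 / (\<kappa> / 2 * (1 - 1 / \<beta>))"
  define good where "good n B \<longleftrightarrow> B \<in> sets (noise_space S n) \<and> measure (noise_space S n) B \<le> A / X n \<and>
    (\<forall>\<omega>\<in>space (noise_space S n) - B. \<forall>c\<in>Iset S m n.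
      small_remainders k S n f c \<omega>)" for n B
  have "\<forall>\<^sub>F n in sequentially. \<exists>B. good n B"
    using base growth eventually_ge_at_top[of 2]
  proof eventually_elim
    case (elim n)
    interpret regression_at S n by unfold_locales (rule model)
    define l where "l = ln (real (npts S n)) / real (npts S n)"
    define u where "u = real (npts S n) powr (m - 1)"
    have I: "Iset S m n = {l..u}" by (simp add: Iset_def c_range_def l_def u_def)
    have N: "2 \<le> npts S n" using npts[of n] elim(3) by simp
    then have l: "0 < l" "l \<le> u" using c_range_nonempty[OF m] by (auto simp: l_def u_def)
    have "\<exists>B\<in>sets (noise_space S n). measure (noise_space S n) B \<le> 737280 / (\<kappa> / 2 * X n * (1 - 1 / \<beta>)) \<and>
      (\<forall>\<omega>\<in>space (noise_space S n) - B. \<forall>c\<in>{l..u}.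
      small_remainders k S n f c \<omega>)"
    proof (rule remainder_union[OF l(1) _ \<beta>])
      show "0 < \<kappa> / 2 * X n" using \<kappa> elim(1) by simp
      fix i assume i: "2 ^ i * l \<le> u"
      have "l \<le> 2 ^ i * l" using l by simp
      then have c: "2 ^ i * l \<in> Iset S m n" using i I by simp
      have "2 ^ i * l * real (npts S n) = 2 ^ i * ln (real (npts S n))" using N by (simp add: l_def)
      then have "(2 ^ i * l * real (npts S n)) powr (1 / m) = (2 ^ i * ln (real (npts S n))) powr (1 / m)"
        by (simp only:)
      also have "\<dots> = \<beta> ^ i * X n"
        using N by (simp add: powr_mult power_powr_commute \<beta>_def X_def)
      finally have "(2 ^ i * l * real (npts S n)) powr (1 / m) = \<beta> ^ i * X n" .
      then have "\<kappa> * (\<beta> ^ i * X n) \<le> D2 Risk S n (2 ^ i * l)" using elim(2) c by metis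
      also have "\<dots> \<le> 2 * D2 k S n (2 ^ i * l)" using D2_Risk_le l by simp
      finally show "\<kappa> / 2 * X n * \<beta> ^ i \<le> Dtot k S n (2 ^ i * l) f"
        using D1_nonneg[of "2 ^ i * l" k f] l by (simp add: Dtot_def mult_ac)
    qed
    moreover have "737280 / (\<kappa> / 2 * X n * (1 - 1 / \<beta>)) = A / X n" by (simp add: A_def mult_ac)
    ultimately show ?case unfolding good_def I by auto
  qed
  \<comment> \<open>Exceptional sets exist only for large \<open>n\<close>; a choice for every
    \<open>n\<close> turns them into a sequence.\<close>
  then have sel: "\<forall>\<^sub>F n in sequentially. good n (SOME B. good n B)"
    by eventually_elim (rule someI_ex)
  define B where "B n = (SOME B. good n B)" for n
  note sel = sel[folded B_def]
  show ?thesis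
  proof (rule coverage[OF model est bias npts])
    show "(\<lambda>n. measure (noise_space S n) (space (noise_space S n) - B n)) \<longlonglongrightarrow> 1"
    proof (rule measure_compl_tendsto_1[OF prob])
      show "\<forall>\<^sub>F n in sequentially. B n \<in> sets (noise_space S n)"
        using sel by eventually_elim (simp add: good_def)
      show "(\<lambda>n. measure (noise_space S n) (B n)) \<longlonglongrightarrow> 0"
      proof (rule tendsto_sandwich[OF _ _ tendsto_const lim0])
        show "\<forall>\<^sub>F n in sequentially. measure (noise_space S n) (B n) \<le> A / X n"
          using sel by eventually_elim (simp add: good_def)
      qed simp
    qed
    show "\<forall>\<^sub>F n in sequentially. \<forall>\<omega>\<in>space (noise_space S n) - B n. \<forall>c\<in>Iset S m n.
      small_remainders k S n f c \<omega>"
      using sel by eventually_elim (simp add: good_def)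
    show "\<forall>\<^sub>F n in sequentially. \<forall>c\<in>Iset S m n. D2 k S n c \<le> max C 1 * s2 S n c \<and> 0 < s2 S n c"
      using base by eventually_elim blast
    show "\<forall>\<^sub>F n in sequentially. \<forall>c\<in>Iset S m n.
      prob_small_Nstat S n c < \<eta>"
      if "0 < \<eta>" for \<eta>
      using base order_tendstoD(2)[OF lim0 that, of "16 / \<kappa>"]
    proof eventually_elim
      case (elim n)
      interpret regression_at S n by unfold_locales (rule model)
      show ?case
      proof
        fix c assume c: "c \<in> Iset S m n"
        have p: "0 < \<kappa> * X n" using \<kappa> elim(1) by simp
        have D: "\<kappa> * X n \<le> D2 Risk S n c" "0 < c" using elim(1) c by blast+
        have "prob_small_Nstat S n c \<le> 16 / D2 Risk S n c"
          using D p by (intro Nstat_lower_tail) linarith+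
        also have "\<dots> \<le> 16 / (\<kappa> * X n)"
          using D p by (intro frac_le) auto
        also have "\<dots> < \<eta>" using elim(2) by simp
        finally show "prob_small_Nstat S n c < \<eta>" .
      qed
    qed
  qed auto
qed

section \<open>Counting eigenvalues\<close>

lemma ln_le_2_sqrt: "0 < x \<Longrightarrow> ln x \<le> 2 * sqrt x"
  using ln_le_minus_one[of "sqrt x"] by (simp add: ln_sqrt)

text \<open>With \<open>T = (c N)\<^sup>1\<^sup>/\<^sup>m\<close>, the product \<open>c \<lambda>\<^sub>j\<close> is of order \<open>(T / w\<^sub>j)\<^sup>m\<close>, so the indices with
  \<open>w\<^sub>j \<le> T\<close> carry the variance; the second counting hypothesis absorbs the logarithms in \<open>D2 Likelihood\<close>.\<close>

lemma (in regression_at) weighted_growth: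
  fixes w :: "'j \<Rightarrow> real"
  assumes m: "1 \<le> m" and lo: "0 < lo" and hi: "0 \<le> hi" and c: "0 < c" and N: "0 < N"
    and T: "T = (c * real N) powr (1 / m)"
    and w: "\<And>j. j \<in> J \<Longrightarrow> 0 < w j"
    and ev: "\<And>j. j \<in> J \<Longrightarrow> lo * real N / w j powr m \<le> lam j"
      "\<And>j. j \<in> J \<Longrightarrow> lam j \<le> hi * real N / w j powr m"
    and H1: "T / 8 \<le> real (card {j \<in> J. w j \<le> T})"
    and H2: "(\<Sum>j | j \<in> J \<and> w j \<le> T. sqrt (T / w j)) \<le> H * real (card {j \<in> J. w j \<le> T})"
  shows "(lo / (1 + lo))\<^sup>2 / 8 * T \<le> D2 Risk S n c"
    and "D2 Likelihood S n c \<le> ((ln (1 + hi) + 2 * m * H) * ((1 + lo) / lo) + hi) * s2 S n c"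
proof -
  define A where "A = {j \<in> J. w j \<le> T}"
  have A: "finite A" "A \<subseteq> J" using finite_J by (auto simp: A_def)
  have T0: "0 < T" using c N by (simp add: T)
  have Tm: "T powr m = c * real N" using c N m by (simp add: T powr_powr)
  have x: "lo * (T / w j) powr m \<le> c * lam j" "c * lam j \<le> hi * (T / w j) powr m"
    if j: "j \<in> J" for j
  proof -
    have *: "(T / w j) powr m = c * real N / w j powr m"
      using T0 w[OF j] by (simp add: powr_divide Tm)
    show "lo * (T / w j) powr m \<le> c * lam j" "c * lam j \<le> hi * (T / w j) powr m"
      using mult_left_mono[OF ev(1)[OF j], of c] mult_left_mono[OF ev(2)[OF j], of c] c
      unfolding * by (simp_all add: mult_ac)
  qed
  have x0: "0 \<le> c * lam j" if "j \<in> J" for j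
    using eigval_mult_nonneg that c by simp
  have xA: "lo / (1 + lo) \<le> wt c j" if j: "j \<in> A" for j
  proof -
    have "1 \<le> T / w j" using j w[of j] A by (auto simp: A_def le_divide_eq)
    then have "1 \<le> (T / w j) powr m" using m by (intro ge_one_powr_ge_zero) auto
    then have "lo * 1 \<le> lo * (T / w j) powr m" using lo by (intro mult_left_mono) auto
    then have "lo \<le> c * lam j" using x(1)[of j] j A by force
    then show ?thesis using lo by (intro shrink_mono) auto
  qed
  have "(lo / (1 + lo))\<^sup>2 * (T / 8) \<le> (lo / (1 + lo))\<^sup>2 * real (card A)"
    using H1 by (intro mult_left_mono) (auto simp: A_def)
  also have "\<dots> = (\<Sum>j\<in>A. (lo / (1 + lo))\<^sup>2)" by simp
  also have "\<dots> \<le> (\<Sum>j\<in>A. (wt c j)\<^sup>2)"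
    using lo xA by (intro sum_mono power_mono) auto
  also have "\<dots> \<le> (\<Sum>j\<in>J. (wt c j)\<^sup>2)"
    using A finite_J by (intro sum_mono2) auto
  also have "\<dots> = D2 Risk S n c" by (simp add: power_divide)
  finally show "(lo / (1 + lo))\<^sup>2 / 8 * T \<le> D2 Risk S n c" by simp
  have cardA: "real (card A) \<le> (1 + lo) / lo * s2 S n c"
  proof -
    have "lo / (1 + lo) * real (card A) = (\<Sum>j\<in>A. lo / (1 + lo))" by simp
    also have "\<dots> \<le> (\<Sum>j\<in>A. wt c j)" using xA by (intro sum_mono) auto
    also have "\<dots> \<le> (\<Sum>j\<in>J. wt c j)"
      using A finite_J c by (intro sum_mono2 wt_nonneg) auto
    finally show ?thesis using lo by (simp add: s2_def field_simps)
  qed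
  \<comment> \<open>On \<open>A\<close> the logarithm of \<open>T / w j\<close> has no uniform
    bound. Replaced by a square root it is controlled on average, by the counting hypothesis
    \<open>H2\<close>.\<close>
  have klA: "kl (c * lam j) \<le> ln (1 + hi) + 2 * m * sqrt (T / w j)" if j: "j \<in> A" for j
  proof -
    have jI: "j \<in> J" using j A by auto
    have y1: "1 \<le> T / w j" using j w[of j] A by (auto simp: A_def le_divide_eq)
    then have y: "1 \<le> (T / w j) powr m" using m by (intro ge_one_powr_ge_zero) auto
    have "kl (c * lam j) \<le> ln (1 + c * lam j)"
      using x0[OF jI] by (simp add: kl_def)
    also have "\<dots> \<le> ln ((1 + hi) * (T / w j) powr m)"
    proof (rule ln_mono)
      show "1 + c * lam j \<le> (1 + hi) * (T / w j) powr m"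
        using x(2)[OF jI] y by (simp add: distrib_right)
      show "0 < 1 + c * lam j" using x0[OF jI] by simp
    qed
    also have "\<dots> = ln (1 + hi) + m * ln (T / w j)"
    proof -
      have "ln ((1 + hi) * (T / w j) powr m) = ln (1 + hi) + ln ((T / w j) powr m)"
        using hi y by (intro ln_mult_pos) auto
      moreover have "ln ((T / w j) powr m) = m * ln (T / w j)"
        by (rule ln_powr)
      ultimately show ?thesis by simp
    qed
    also have "\<dots> \<le> ln (1 + hi) + m * (2 * sqrt (T / w j))"
      using y1 m ln_le_2_sqrt[of "T / w j"] by (intro add_left_mono mult_left_mono) auto
    finally show ?thesis by simp
  qed
  \<comment> \<open>Outside \<open>A\<close> the argument \<open>x = c * lam j\<close> is at most
    \<open>hi\<close>, and \<open>kl x \<le> x - x / (1 + x) = x * (x / (1 + x))\<close>, so each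
    term is compared with its own term in \<open>s2\<close>.\<close>
  have klB: "kl (c * lam j) \<le> hi * wt c j" if j: "j \<in> J - A" for j
  proof -
    have jI: "j \<in> J" using j by auto
    have "T / w j \<le> 1" using j w[of j] by (auto simp: A_def divide_le_eq)
    then have "(T / w j) powr m \<le> 1" using T0 w[OF jI] m by (intro powr_le1) auto
    then have "hi * (T / w j) powr m \<le> hi * 1" using hi by (intro mult_left_mono) auto
    then have xu: "c * lam j \<le> hi" using x(2)[OF jI] by simp
    have "kl (c * lam j) \<le> c * lam j - wt c j"
      using ln_add_one_self_le_self[OF x0[OF jI]] by (simp add: kl_def)
    also have "\<dots> = c * lam j * wt c j"
      using one_plus_pos[OF _ jI, of c] c by (simp add: field_simps)
    also have "\<dots> \<le> hi * wt c j" using xu wt_nonneg[OF _ jI, of c] c by (intro mult_right_mono) auto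
    finally show ?thesis .
  qed
  have "D2 Likelihood S n c = (\<Sum>j\<in>A. kl (c * lam j)) + (\<Sum>j\<in>J - A. kl (c * lam j))"
    unfolding D2_Likelihood using A finite_J by (simp add: sum.subset_diff add.commute)
  also have "\<dots> \<le> (\<Sum>j\<in>A. ln (1 + hi) + 2 * m * sqrt (T / w j)) + (\<Sum>j\<in>J - A. hi * wt c j)"
    using klA klB by (intro add_mono sum_mono) auto
  also have "(\<Sum>j\<in>A. ln (1 + hi) + 2 * m * sqrt (T / w j)) = ln (1 + hi) * real (card A) + 2 * m * (\<Sum>j\<in>A. sqrt (T / w j))"
    by (simp add: sum.distrib sum_distrib_left)
  also have "\<dots> \<le> ln (1 + hi) * real (card A) + 2 * m * (H * real (card A))"
    using H2 m unfolding A_def by (intro add_left_mono mult_left_mono) auto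
  also have "\<dots> = (ln (1 + hi) + 2 * m * H) * real (card A)" by (simp add: algebra_simps)
  also have "\<dots> \<le> (ln (1 + hi) + 2 * m * H) * ((1 + lo) / lo * s2 S n c)"
  proof (rule mult_left_mono[OF cardA])
    \<comment> \<open>The sign of \<open>H\<close> follows from \<open>H2\<close>, whose left side
      is nonnegative, because \<open>H1\<close> makes the count positive.\<close>
    have "0 < real (card A)" using H1 T0 by (simp add: A_def)
    moreover have "0 \<le> H * real (card A)"
    proof -
      have "0 \<le> (\<Sum>j | j \<in> J \<and> w j \<le> T. sqrt (T / w j))"
        using T0 w by (intro sum_nonneg) (auto intro!: divide_nonneg_nonneg less_imp_le)
      then show ?thesis using H2 by (simp add: A_def)
    qed
    ultimately have "0 \<le> H" by (simp add: zero_le_mult_iff)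
    then show "0 \<le> ln (1 + hi) + 2 * m * H" using hi m by simp
  qed
  also have "(\<Sum>j\<in>J - A. hi * wt c j) \<le> (\<Sum>j\<in>J. hi * wt c j)"
    using finite_J hi c by (intro sum_mono2 mult_nonneg_nonneg wt_nonneg) auto
  also have "\<dots> = hi * s2 S n c" by (simp add: s2_def sum_distrib_left)
  finally show "D2 Likelihood S n c \<le> ((ln (1 + hi) + 2 * m * H) * ((1 + lo) / lo) + hi) * s2 S n c"
    by (simp only: distrib_right mult.assoc add.commute)
qed

text \<open>On the range, \<open>c N\<close> runs from ln N to N^m, so \<open>T\<close> runs from
  (ln N)^(1/m), which eventually exceeds 2, to \<open>N\<close>; the counting hypotheses concern
  exactly such \<open>T\<close>. The constant 8 is that of \<open>count_sobolev\<close>, the weakest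
  of the three counts.\<close>

proposition coverage_weights:
  fixes S :: "('x, 'v, 'w, 'j) regression" and w :: "nat \<Rightarrow> 'j \<Rightarrow> real"
  assumes model: "regression_model S" and est: "is_estimator k S m f chat" and bias: "bias_cond k S m f"
    and npts: "\<And>n. n \<le> npts S n" and m: "1 \<le> m" and lo: "0 < lo" and hi: "0 \<le> hi"
    and w: "\<And>n j. j \<in> idx S n \<Longrightarrow> 0 < w n j"
    and ev: "\<forall>\<^sub>F n in sequentially. \<forall>j\<in>idx S n. lo * real (npts S n) / w n j powr m \<le> eigval S n j \<and>
       eigval S n j \<le> hi * real (npts S n) / w n j powr m"
    and H1: "\<And>n T. 2 \<le> T \<Longrightarrow> T \<le> real (npts S n) \<Longrightarrow> T / 8 \<le> real (card {j \<in> idx S n. w n j \<le> T})"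
    and H2: "\<And>n T. 2 \<le> T \<Longrightarrow> T \<le> real (npts S n) \<Longrightarrow>
      (\<Sum>j | j \<in> idx S n \<and> w n j \<le> T. sqrt (T / w n j)) \<le> H * real (card {j \<in> idx S n. w n j \<le> T})"
  shows "covers S f chat"
proof (rule coverage_growth[OF model est bias npts m])
  show "0 < (lo / (1 + lo))\<^sup>2 / 8" using lo by simp
  have "\<forall>\<^sub>F n in sequentially. 2 \<le> ln (real (npts S n)) powr (1 / m)"
    using powr_ln_at_top[of "1 / m" "npts S"] m npts unfolding filterlim_at_top by simp
  then show "\<forall>\<^sub>F n in sequentially. \<forall>c\<in>Iset S m n.
      (lo / (1 + lo))\<^sup>2 / 8 * (c * real (npts S n)) powr (1 / m) \<le> D2 Risk S n c \<and>
      D2 Likelihood S n c \<le> ((ln (1 + hi) + 2 * m * H) * ((1 + lo) / lo) + hi) * s2 S n c"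
    using ev eventually_ge_at_top[of 2]
  proof eventually_elim
    case (elim n)
    interpret regression_at S n by unfold_locales (rule model)
    have N: "2 \<le> npts S n" using npts[of n] elim by simp
    show ?case
    proof
      fix c assume c: "c \<in> Iset S m n"
      define T where "T = (c * real (npts S n)) powr (1 / m)"
      have c1: "ln (real (npts S n)) / real (npts S n) \<le> c" "c \<le> real (npts S n) powr (m - 1)"
        using c by (auto simp: Iset_def c_range_def)
      have c0: "0 < c" using c1(1) c_range_nonempty(1)[OF m N] by linarith
      have "ln (real (npts S n)) \<le> c * real (npts S n)" using c1(1) N by (simp add: divide_le_eq)
      then have "ln (real (npts S n)) powr (1 / m) \<le> T"
        unfolding T_def using N m by (intro powr_mono2) auto
      then have T2: "2 \<le> T" using elim(1) by simp
      have "c * real (npts S n) \<le> real (npts S n) powr (m - 1) * real (npts S n)"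
        using c1(2) by (intro mult_right_mono) auto
      also have "\<dots> = real (npts S n) powr m" using N by (simp add: powr_mult_base powr_diff)
      finally have "T \<le> (real (npts S n) powr m) powr (1 / m)"
        unfolding T_def using c0 m by (intro powr_mono2) auto
      also have "\<dots> = real (npts S n)" using m N by (simp add: powr_powr)
      finally have TN: "T \<le> real (npts S n)" .
      have "0 < npts S n" using N by simp
      from weighted_growth[of m lo hi c T "w n" H, OF m lo hi c0 this T_def w _ _ H1[OF T2 TN] H2[OF T2 TN]] elim(2)
      show "(lo / (1 + lo))\<^sup>2 / 8 * (c * real (npts S n)) powr (1 / m) \<le> D2 Risk S n c \<and>
        D2 Likelihood S n c \<le> ((ln (1 + hi) + 2 * m * H) * ((1 + lo) / lo) + hi) * s2 S n c"
        unfolding T_def by blast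
    qed
  qed
qed

section \<open>Lattice point counts for the three index sets\<close>

lemma sum_inverse_sqrt: "(\<Sum>j=1..K. 1 / sqrt (real j)) \<le> 2 * sqrt (real K)"
proof (induction K)
  case (Suc K)
  \<comment> \<open>Comparison with a telescoping sum of differences of
    \<open>2 * sqrt\<close>.\<close>
  have "1 / sqrt (real (Suc K)) \<le> 2 * (sqrt (real (Suc K)) - sqrt (real K))"
  proof -
    have "(sqrt (real (Suc K)) - sqrt (real K)) * (sqrt (real (Suc K)) + sqrt (real K)) = 1"
      by (simp add: algebra_simps)
    then have "sqrt (real (Suc K)) - sqrt (real K) = 1 / (sqrt (real (Suc K)) + sqrt (real K))"
      by (simp add: eq_divide_eq add_pos_nonneg less_imp_neq[symmetric])
    moreover have "1 / (2 * sqrt (real (Suc K))) \<le> 1 / (sqrt (real (Suc K)) + sqrt (real K))"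
      by (intro frac_le) (auto simp: add_pos_nonneg)
    ultimately show ?thesis by simp
  qed
  then show ?case using Suc by simp
qed simp

lemma sum_sqrt_divide:
  assumes "0 \<le> T"
  shows "(\<Sum>j=1..K. sqrt (T / real j)) \<le> 2 * sqrt (T * real K)"
proof -
  have "(\<Sum>j=1..K. sqrt (T / real j)) = sqrt T * (\<Sum>j=1..K. 1 / sqrt (real j))"
    by (simp add: real_sqrt_divide sum_distrib_left)
  also have "\<dots> \<le> sqrt T * (2 * sqrt (real K))"
    using assms by (intro mult_left_mono sum_inverse_sqrt) auto
  finally show ?thesis by (simp add: real_sqrt_mult)
qed

lemma half_le_nat_floor:
  fixes x :: real
  assumes "1 \<le> x"
  shows "x / 2 \<le> real (nat \<lfloor>x\<rfloor>)"
proof -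
  have "1 \<le> \<lfloor>x\<rfloor>" using assms by linarith
  then have "real (nat \<lfloor>x\<rfloor>) = of_int \<lfloor>x\<rfloor>" "1 \<le> (of_int \<lfloor>x\<rfloor> :: real)" by simp_all
  then show ?thesis using floor_correct[of x] by linarith
qed

lemma count_single:
  assumes "2 \<le> T" "T \<le> real n"
  shows "T / 8 \<le> real (card {j \<in> {1..n}. real j \<le> T})"
    and "(\<Sum>j | j \<in> {1..n} \<and> real j \<le> T. sqrt (T / real j)) \<le> 4 * real (card {j \<in> {1..n}. real j \<le> T})"
proof -
  have eq: "{j. j \<in> {1..n} \<and> real j \<le> T} = {1..nat \<lfloor>T\<rfloor>}"
    using assms by (auto simp: le_nat_floor) linarith+
  have c: "T / 2 \<le> real (nat \<lfloor>T\<rfloor>)" using assms by (intro half_le_nat_floor) simp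
  show "T / 8 \<le> real (card {j \<in> {1..n}. real j \<le> T})"
    unfolding eq using c assms by simp
  have "(\<Sum>j=1..nat \<lfloor>T\<rfloor>. sqrt (T / real j)) \<le> 2 * sqrt (T * real (nat \<lfloor>T\<rfloor>))"
    using assms by (intro sum_sqrt_divide) simp
  also have "\<dots> \<le> 2 * sqrt (T * T)"
    using assms by (intro mult_left_mono real_sqrt_le_mono mult_left_mono) (auto simp: of_nat_floor)
  also have "\<dots> \<le> 4 * real (nat \<lfloor>T\<rfloor>)" using c assms by simp
  finally show "(\<Sum>j | j \<in> {1..n} \<and> real j \<le> T. sqrt (T / real j)) \<le> 4 * real (card {j \<in> {1..n}. real j \<le> T})"
    unfolding eq by simp
qed

lemma le_nat_floor_iff: "0 \<le> x \<Longrightarrow> real k \<le> x \<longleftrightarrow> k \<le> nat \<lfloor>x\<rfloor>"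
  by (simp add: le_nat_iff le_floor_iff)

text \<open>The lattice points under the hyperbola \<open>i * j \<le> T\<close> in a square of side
  \<open>n\<close> are counted row by row. For \<open>T \<le> n\<close> their number exceeds
  \<open>T\<close> by a logarithmic factor, and so does the sum of square roots; the second bound
  therefore has to compare rows and not just totals of order \<open>T\<close>.\<close>

lemma count_product:
  assumes T: "2 \<le> T" "T \<le> real (n\<^sup>2)"
  defines "A \<equiv> {p \<in> {1..n} \<times> {1..n}. real (fst p) * real (snd p) \<le> T}"
  shows "T / 8 \<le> real (card A)"
    and "(\<Sum>p\<in>A. sqrt (T / (real (fst p) * real (snd p)))) \<le> 36 * real (card A)"
proof -
  define L where "L i = min n (nat \<lfloor>T / real i\<rfloor>)" for i
  have A: "A = (SIGMA i:{1..n}. {1..L i})"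
  proof (intro equalityI subsetI)
    fix p assume "p \<in> A"
    then obtain i j where p: "p = (i, j)" "i \<in> {1..n}" "j \<in> {1..n}" "real i * real j \<le> T"
      by (cases p) (auto simp: A_def)
    then have "real j \<le> T / real i" by (simp add: le_divide_eq mult.commute)
    then show "p \<in> (SIGMA i:{1..n}. {1..L i})"
      using p T by (simp add: L_def le_nat_floor_iff[symmetric])
  next
    fix p assume "p \<in> (SIGMA i:{1..n}. {1..L i})"
    then obtain i j where p: "p = (i, j)" "i \<in> {1..n}" "j \<in> {1..L i}" by auto
    then have "real j \<le> T / real i" using T by (simp add: L_def le_nat_floor_iff)
    then show "p \<in> A" using p by (simp add: A_def L_def le_divide_eq mult.commute)
  qed
  have card: "card A = (\<Sum>i=1..n. L i)" unfolding A by simp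
  have n: "0 < n" using T by (cases n) auto
  \<comment> \<open>The rows up to \<open>K\<close> are full: there the hyperbola runs outside the
    square.\<close>
  define K where "K = nat \<lfloor>T / real n\<rfloor>"
  have "T / real n \<le> real n" using T n by (simp add: divide_le_eq power2_eq_square)
  then have Kn: "K \<le> n" unfolding K_def by (simp add: nat_le_iff floor_le_iff)
  have KT: "real K \<le> T / real n" unfolding K_def using T by (simp add: of_nat_floor)
  \<comment> \<open>If \<open>T \<le> n\<close>, the first row alone has enough points; otherwise
    the \<open>K\<close> full rows of length \<open>n\<close> do.\<close>
  have half: "T / 2 \<le> real (card A)"
  proof (cases "T \<le> real n")
    case True
    then have "L 1 = nat \<lfloor>T\<rfloor>" unfolding L_def by (simp add: nat_le_iff floor_le_iff)
    then have "T / 2 \<le> real (L 1)" using half_le_nat_floor[of T] T by simp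
    also have "\<dots> \<le> real (\<Sum>i=1..n. L i)"
      unfolding of_nat_le_iff using n by (intro member_le_sum) auto
    finally show ?thesis by (simp add: card)
  next
    case False
    then have "1 \<le> T / real n" using n by (simp add: le_divide_eq)
    then have "T / real n / 2 \<le> real K" unfolding K_def by (rule half_le_nat_floor)
    then have "T / 2 \<le> real (K * n)" using n by (simp add: field_simps)
    also have "\<dots> = real (\<Sum>i=1..K. n)" by simp
    also have "\<dots> \<le> real (\<Sum>i=1..K. L i)"
      unfolding of_nat_le_iff
    proof (rule sum_mono)
      fix i assume i: "i \<in> {1..K}"
      then have "real i \<le> T / real n" using KT by (meson atLeastAtMost_iff of_nat_le_iff order_trans)
      then have "real n \<le> T / real i" using i n by (simp add: le_divide_eq mult.commute)
      then show "n \<le> L i" unfolding L_def using T by (simp add: le_nat_floor_iff[symmetric])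
    qed
    also have "\<dots> \<le> real (\<Sum>i=1..n. L i)"
      unfolding of_nat_le_iff using Kn by (intro sum_mono2) auto
    finally show ?thesis by (simp add: card)
  qed
  then show "T / 8 \<le> real (card A)" using T by simp
  have "(\<Sum>p\<in>A. sqrt (T / (real (fst p) * real (snd p)))) = (\<Sum>i=1..n. \<Sum>j=1..L i. sqrt (T / real i / real j))"
    unfolding A by (subst sum.Sigma) (auto intro!: sum.cong)
  \<comment> \<open>A nonempty row ended by the hyperbola has \<open>T / i \<le> 2 * L i\<close> and
    is compared with its own length. Full rows give the extra term, whose sum over
    \<open>i \<le> K\<close> is of order \<open>T\<close> because
    \<open>K * n \<le> T\<close>.\<close>
  also have "\<dots> \<le> (\<Sum>i=1..n. 4 * real (L i) + (if i \<le> K then 2 * sqrt (T * real n / real i) else 0))"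
  proof (rule sum_mono)
    fix i assume i: "i \<in> {1..n}"
    have "(\<Sum>j=1..L i. sqrt (T / real i / real j)) \<le> 2 * sqrt (T / real i * real (L i))"
      using T by (intro sum_sqrt_divide) simp
    also have "\<dots> \<le> 4 * real (L i) + (if i \<le> K then 2 * sqrt (T * real n / real i) else 0)"
    proof (cases "nat \<lfloor>T / real i\<rfloor> \<le> n")
      case True
      then have L: "L i = nat \<lfloor>T / real i\<rfloor>" by (simp add: L_def)
      have "sqrt (T / real i * real (L i)) \<le> 2 * real (L i)"
      proof (cases "1 \<le> T / real i")
        case True
        have "T / real i * real (L i) \<le> (2 * real (L i)) * real (L i)"
          using half_le_nat_floor[OF True] L by (intro mult_right_mono) auto
        also have "\<dots> \<le> (2 * real (L i))\<^sup>2" by (simp add: power2_eq_square)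
        finally have "sqrt (T / real i * real (L i)) \<le> sqrt ((2 * real (L i))\<^sup>2)" by (rule real_sqrt_le_mono)
        also have "sqrt ((2 * real (L i))\<^sup>2) = 2 * real (L i)" by (simp only: real_sqrt_abs)
        finally show ?thesis .
      next
        case False
        then have "\<lfloor>T / real i\<rfloor> < 1" by (simp add: floor_less_iff)
        then have "L i = 0" unfolding L by simp
        then show ?thesis by simp
      qed
      moreover have "0 \<le> (if i \<le> K then 2 * sqrt (T * real n / real i) else 0)" using T by simp
      ultimately show ?thesis by linarith
    next
      case False
      then have L: "L i = n" and "n \<le> nat \<lfloor>T / real i\<rfloor>" by (auto simp: L_def)
      then have "real n \<le> T / real i" using T by (simp add: le_nat_floor_iff)
      then have "real i \<le> T / real n" using i n by (simp add: le_divide_eq mult.commute)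
      then have "i \<le> K" unfolding K_def using T by (simp add: le_nat_floor_iff)
      then show ?thesis using L by (simp add: mult.commute)
    qed
    finally show "(\<Sum>j=1..L i. sqrt (T / real i / real j))
      \<le> 4 * real (L i) + (if i \<le> K then 2 * sqrt (T * real n / real i) else 0)" .
  qed
  also have "\<dots> = 4 * real (card A) + (\<Sum>i=1..n. if i \<le> K then 2 * sqrt (T * real n / real i) else 0)"
    by (simp add: sum.distrib card sum_distrib_left)
  also have "(\<Sum>i=1..n. if i \<le> K then 2 * sqrt (T * real n / real i) else 0) = 2 * (\<Sum>i=1..K. sqrt (T * real n / real i))"
    unfolding sum_distrib_left using Kn by (intro sum.mono_neutral_cong_right) auto
  also have "2 * (\<Sum>i=1..K. sqrt (T * real n / real i)) \<le> 2 * (2 * sqrt (T * real n * real K))"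
    using T by (intro mult_left_mono sum_sqrt_divide) auto
  also have "sqrt (T * real n * real K) \<le> sqrt (T * T)"
    using T KT n by (intro real_sqrt_le_mono) (simp add: le_divide_eq mult_ac)
  also have "sqrt (T * T) = T" using T by simp
  finally show "(\<Sum>p\<in>A. sqrt (T / (real (fst p) * real (snd p)))) \<le> 36 * real (card A)"
    using half by simp
qed

text \<open>The quarter disc contains the square of side \<open>s\<close> and lies in the square of
  side \<open>r\<close>. Rounding down at most halves the side sqrt(T/2), which leaves T/8 points.
  In the sum, 2ij \<le> i^2 + j^2 separates the two variables.\<close>

lemma count_sobolev:
  assumes T: "2 \<le> T" "T \<le> real (n\<^sup>2)"
  defines "A \<equiv> {p \<in> {1..n} \<times> {1..n}. (real (fst p))\<^sup>2 + (real (snd p))\<^sup>2 \<le> T}"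
  shows "T / 8 \<le> real (card A)"
    and "(\<Sum>p\<in>A. sqrt (T / ((real (fst p))\<^sup>2 + (real (snd p))\<^sup>2))) \<le> 32 * real (card A)"
proof -
  have finA: "finite A" by (simp add: A_def)
  define s where "s = nat \<lfloor>sqrt (T / 2)\<rfloor>"
  have s: "real k \<le> sqrt (T / 2) \<longleftrightarrow> k \<le> s" for k
    unfolding s_def using T by (intro le_nat_floor_iff) simp
  have sn: "s \<le> n"
  proof -
    have "real s \<le> sqrt (T / 2)" using s by simp
    also have "\<dots> \<le> sqrt ((real n)\<^sup>2)" using T by (intro real_sqrt_le_mono) simp
    finally show ?thesis by simp
  qed
  have "{1..s} \<times> {1..s} \<subseteq> A"
  proof
    fix p assume "p \<in> {1..s} \<times> {1..s}"
    then obtain i j where p: "p = (i, j)" "i \<in> {1..s}" "j \<in> {1..s}" by auto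
    have "(real k)\<^sup>2 \<le> T / 2" if "k \<in> {1..s}" for k
    proof -
      have "(real k)\<^sup>2 \<le> (sqrt (T / 2))\<^sup>2" using s[of k] that by (intro power_mono) auto
      then show ?thesis using T by simp
    qed
    from this[OF p(2)] this[OF p(3)] show "p \<in> A" using p sn by (simp add: A_def)
  qed
  then have "card ({1..s} \<times> {1..s}) \<le> card A" by (rule card_mono[OF finA])
  then have cs: "(real s)\<^sup>2 \<le> real (card A)" by (simp add: power2_eq_square flip: of_nat_mult)
  have "1 \<le> sqrt (T / 2)" using T by simp
  then have "sqrt (T / 2) / 2 \<le> real s" unfolding s_def by (rule half_le_nat_floor)
  then have "(sqrt (T / 2) / 2)\<^sup>2 \<le> (real s)\<^sup>2" using T by (intro power_mono) auto
  moreover have "(sqrt (T / 2) / 2)\<^sup>2 = T / 8" using T by (simp add: power_divide)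
  ultimately show c8: "T / 8 \<le> real (card A)" using cs by linarith
  define r where "r = nat \<lfloor>sqrt T\<rfloor>"
  have r: "real k \<le> sqrt T \<longleftrightarrow> k \<le> r" for k
    unfolding r_def using T by (intro le_nat_floor_iff) simp
  have AR: "A \<subseteq> {1..r} \<times> {1..r}"
  proof
    fix p assume "p \<in> A"
    then obtain i j where p: "p = (i, j)" "1 \<le> i" "1 \<le> j" "(real i)\<^sup>2 + (real j)\<^sup>2 \<le> T"
      by (cases p) (auto simp: A_def)
    have "(real i)\<^sup>2 \<le> T" "(real j)\<^sup>2 \<le> T" using p(4) zero_le_power2[of "real i"] zero_le_power2[of "real j"] by linarith+
    then have "real i \<le> sqrt T" "real j \<le> sqrt T" by (simp_all add: real_le_rsqrt)
    then show "p \<in> {1..r} \<times> {1..r}" using p r by simp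
  qed
  have "(\<Sum>p\<in>A. sqrt (T / ((real (fst p))\<^sup>2 + (real (snd p))\<^sup>2)))
    \<le> (\<Sum>p\<in>A. sqrt T * (1 / sqrt (real (fst p)) * (1 / sqrt (real (snd p)))))"
  proof (rule sum_mono)
    fix p assume "p \<in> A"
    then have ij: "0 < real (fst p)" "0 < real (snd p)" by (auto simp: A_def)
    have "real (fst p) * real (snd p) \<le> 2 * real (fst p) * real (snd p)" using ij by simp
    also have "\<dots> \<le> (real (fst p))\<^sup>2 + (real (snd p))\<^sup>2" by (rule sum_squares_bound)
    finally have "T / ((real (fst p))\<^sup>2 + (real (snd p))\<^sup>2) \<le> T / (real (fst p) * real (snd p))"
      using ij T by (intro frac_le) auto
    then have "sqrt (T / ((real (fst p))\<^sup>2 + (real (snd p))\<^sup>2)) \<le> sqrt (T / (real (fst p) * real (snd p)))"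
      by (rule real_sqrt_le_mono)
    then show "sqrt (T / ((real (fst p))\<^sup>2 + (real (snd p))\<^sup>2))
      \<le> sqrt T * (1 / sqrt (real (fst p)) * (1 / sqrt (real (snd p))))"
      by (simp add: real_sqrt_divide real_sqrt_mult)
  qed
  also have "\<dots> \<le> (\<Sum>p\<in>{1..r} \<times> {1..r}. sqrt T * (1 / sqrt (real (fst p)) * (1 / sqrt (real (snd p)))))"
    using AR T by (intro sum_mono2) auto
  also have "\<dots> = sqrt T * ((\<Sum>i=1..r. 1 / sqrt (real i)) * (\<Sum>i=1..r. 1 / sqrt (real i)))"
  proof -
    have "(\<Sum>i=1..r. 1 / sqrt (real i)) * (\<Sum>i=1..r. 1 / sqrt (real i))
      = (\<Sum>p\<in>{1..r} \<times> {1..r}. 1 / sqrt (real (fst p)) * (1 / sqrt (real (snd p))))"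
      by (simp add: sum_product sum.cartesian_product case_prod_beta)
    then show ?thesis by (simp only: sum_distrib_left)
  qed
  also have "\<dots> \<le> sqrt T * ((2 * sqrt (real r)) * (2 * sqrt (real r)))"
    using T by (intro mult_left_mono mult_mono sum_inverse_sqrt sum_nonneg) auto
  also have "\<dots> = 4 * (sqrt T * real r)" by simp
  also have "\<dots> \<le> 4 * (sqrt T * sqrt T)"
    using r[of r] T by (intro mult_left_mono) auto
  also have "\<dots> \<le> 32 * real (card A)" using c8 T by simp
  finally show "(\<Sum>p\<in>A. sqrt (T / ((real (fst p))\<^sup>2 + (real (snd p))\<^sup>2))) \<le> 32 * real (card A)" .
qed

lemma uniformly_asymp_bounds:
  assumes "uniformly_asymp A a b" and b: "\<And>n p. p \<in> A n \<Longrightarrow> 1 \<le> n \<Longrightarrow> 0 < b n p"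
  obtains l u where "0 < l" "0 \<le> u" "\<forall>\<^sub>F n in sequentially. \<forall>p\<in>A n. l * b n p \<le> a n p \<and> a n p \<le> u * b n p"
proof -
  obtain l u where l: "0 < l" and ev: "\<forall>\<^sub>F n in sequentially. \<forall>p\<in>A n. l \<le> a n p / b n p \<and> a n p / b n p \<le> u"
    using assms(1) unfolding uniformly_asymp_def by blast
  have "\<forall>\<^sub>F n in sequentially. \<forall>p\<in>A n. l * b n p \<le> a n p \<and> a n p \<le> max u 0 * b n p"
    using ev eventually_ge_at_top[of 1]
  proof eventually_elim
    case (elim n)
    show ?case
    proof
      fix p assume p: "p \<in> A n"
      have bp: "0 < b n p" using b p elim(2) by blast
      have "l \<le> a n p / b n p" "a n p / b n p \<le> max u 0" using elim(1) p by force+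
      then show "l * b n p \<le> a n p \<and> a n p \<le> max u 0 * b n p"
        using bp by (simp add: pos_le_divide_eq pos_divide_le_eq)
    qed
  qed
  then show thesis using that[of l "max u 0"] l by simp
qed

section \<open>Coverage under each eigenvalue condition\<close>

lemma coverage_polynomial:
  assumes "regression_model S" "single_indexed S" "is_estimator k S m f chat" "bias_cond k S m f" "1 \<le> m"
    and pe: "polynomial_eigenvalues S m"
  shows "covers S f chat"
proof -
  have S: "npts S n = n" "idx S n = {1..n}" for n using assms(2) by (simp_all add: single_indexed_def)
  obtain l u where lu: "0 < l" "l \<le> u" and ev: "\<And>n j. j \<in> {1..n} \<Longrightarrow>
     l * real n / real j powr m \<le> eigval S n j \<and> eigval S n j \<le> u * real n / real j powr m"
    using pe unfolding polynomial_eigenvalues_def by blast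
  show ?thesis
  proof (rule coverage_weights[OF assms(1,3,4) _ assms(5) lu(1), where w = "\<lambda>n j. real j" and hi = u and H = 4])
    show "\<forall>\<^sub>F n in sequentially. \<forall>j\<in>idx S n. l * real (npts S n) / real j powr m \<le> eigval S n j \<and>
       eigval S n j \<le> u * real (npts S n) / real j powr m"
      using ev by (simp add: S)
    fix T n assume T: "2 \<le> T" "T \<le> real (npts S n)"
    show "T / 8 \<le> real (card {j \<in> idx S n. real j \<le> T})"
      "(\<Sum>j | j \<in> idx S n \<and> real j \<le> T. sqrt (T / real j)) \<le> 4 * real (card {j \<in> idx S n. real j \<le> T})"
      using count_single[of T n] T unfolding S by simp_all
  qed (use lu in \<open>auto simp: S\<close>)
qed

lemma coverage_product:
  assumes "regression_model S" "double_indexed S" "is_estimator k S m f chat" "bias_cond k S m f" "1 \<le> m"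
    and pe: "product_eigenvalues S m"
  shows "covers S f chat"
proof -
  have S: "npts S n = n\<^sup>2" "idx S n = {1..n} \<times> {1..n}" for n
    using assms(2) by (simp_all add: double_indexed_def)
  obtain l u where lu: "0 < l" "0 \<le> u" and ev: "\<forall>\<^sub>F n in sequentially. \<forall>p\<in>{1..n} \<times> {1..n}.
     l * (case p of (i, j) \<Rightarrow> (real n)\<^sup>2 / (real i powr m * real j powr m)) \<le> eigval S n p \<and>
     eigval S n p \<le> u * (case p of (i, j) \<Rightarrow> (real n)\<^sup>2 / (real i powr m * real j powr m))"
    by (rule uniformly_asymp_bounds[OF pe[unfolded product_eigenvalues_def]]) auto
  show ?thesis
  proof (rule coverage_weights[OF assms(1,3,4) _ assms(5) lu, where w = "\<lambda>n p. real (fst p) * real (snd p)" and H = 36])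
    show "\<forall>\<^sub>F n in sequentially. \<forall>p\<in>idx S n. l * real (npts S n) / (real (fst p) * real (snd p)) powr m \<le> eigval S n p \<and>
       eigval S n p \<le> u * real (npts S n) / (real (fst p) * real (snd p)) powr m"
      using ev by eventually_elim (auto simp: S powr_mult)
    fix T n assume T: "2 \<le> T" "T \<le> real (npts S n)"
    show "T / 8 \<le> real (card {p \<in> idx S n. real (fst p) * real (snd p) \<le> T})"
      "(\<Sum>p | p \<in> idx S n \<and> real (fst p) * real (snd p) \<le> T. sqrt (T / (real (fst p) * real (snd p))))
        \<le> 36 * real (card {p \<in> idx S n. real (fst p) * real (snd p) \<le> T})"
      using count_product[of T n] T unfolding S by blast+
  next
    show "n \<le> npts S n" for n by (simp add: S power2_eq_square)
  qed (auto simp: S)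
qed

lemma coverage_sobolev:
  assumes "regression_model S" "double_indexed S" "is_estimator k S m f chat" "bias_cond k S m f" "1 \<le> m"
    and pe: "sobolev_eigenvalues S m"
  shows "covers S f chat"
proof -
  have S: "npts S n = n\<^sup>2" "idx S n = {1..n} \<times> {1..n}" for n
    using assms(2) by (simp_all add: double_indexed_def)
  have pos: "0 < (real i)\<^sup>2 + (real j)\<^sup>2" if "1 \<le> i" for i j
    using that by (intro add_pos_nonneg) auto
  obtain l u where lu: "0 < l" "0 \<le> u" and ev: "\<forall>\<^sub>F n in sequentially. \<forall>p\<in>{1..n} \<times> {1..n}.
     l * (case p of (i, j) \<Rightarrow> (real n)\<^sup>2 / ((real i)\<^sup>2 + (real j)\<^sup>2) powr m) \<le> eigval S n p \<and>
     eigval S n p \<le> u * (case p of (i, j) \<Rightarrow> (real n)\<^sup>2 / ((real i)\<^sup>2 + (real j)\<^sup>2) powr m)"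
    by (rule uniformly_asymp_bounds[OF pe[unfolded sobolev_eigenvalues_def]]) (auto dest: pos)
  show ?thesis
  proof (rule coverage_weights[OF assms(1,3,4) _ assms(5) lu,
        where w = "\<lambda>n p. (real (fst p))\<^sup>2 + (real (snd p))\<^sup>2" and H = 32])
    show "\<forall>\<^sub>F n in sequentially. \<forall>p\<in>idx S n. l * real (npts S n) / ((real (fst p))\<^sup>2 + (real (snd p))\<^sup>2) powr m \<le> eigval S n p \<and>
       eigval S n p \<le> u * real (npts S n) / ((real (fst p))\<^sup>2 + (real (snd p))\<^sup>2) powr m"
      using ev by eventually_elim (auto simp: S)
    fix T n assume T: "2 \<le> T" "T \<le> real (npts S n)"
    show "T / 8 \<le> real (card {p \<in> idx S n. (real (fst p))\<^sup>2 + (real (snd p))\<^sup>2 \<le> T})"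
      "(\<Sum>p | p \<in> idx S n \<and> (real (fst p))\<^sup>2 + (real (snd p))\<^sup>2 \<le> T. sqrt (T / ((real (fst p))\<^sup>2 + (real (snd p))\<^sup>2)))
        \<le> 32 * real (card {p \<in> idx S n. (real (fst p))\<^sup>2 + (real (snd p))\<^sup>2 \<le> T})"
      using count_sobolev[of T n] T unfolding S by blast+
  next
    show "n \<le> npts S n" for n by (simp add: S power2_eq_square)
    show "0 < (real (fst p))\<^sup>2 + (real (snd p))\<^sup>2" if "p \<in> idx S n" for n p
      using that by (intro pos) (auto simp: S)
  qed
qed

theorem theorem17:
  fixes S :: "('x, 'v, 'w, nat) regression"
    and S' :: "('x', 'v', 'w', nat \<times> nat) regression"
    and f :: "'x \<Rightarrow> real" and f' :: "'x' \<Rightarrow> real"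
    and chat :: "nat \<Rightarrow> 'w \<Rightarrow> real" and chat' :: "nat \<Rightarrow> 'w' \<Rightarrow> real"
    and k :: est and m :: real
  assumes "m \<ge> 1"
  shows
    "(regression_model S \<and> single_indexed S \<and> is_estimator k S m f chat \<longrightarrow>
        (remainder_cond k S m f \<and> radius_cond S m \<and> variance_cond S m \<and> bias_cond k S m f
           \<longrightarrow> covers S f chat) \<and>
        (polynomial_eigenvalues S m \<and> bias_cond k S m f \<longrightarrow> covers S f chat)) \<and>
     (regression_model S' \<and> double_indexed S' \<and> is_estimator k S' m f' chat' \<longrightarrow>
        (product_eigenvalues S' m \<and> bias_cond k S' m f' \<longrightarrow> covers S' f' chat') \<and>
        (sobolev_eigenvalues S' m \<and> bias_cond k S' m f' \<longrightarrow> covers S' f' chat'))"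
  proof (intro conjI impI; elim conjE)
  assume S: "regression_model S" "single_indexed S" "is_estimator k S m f chat" and bias: "bias_cond k S m f"
  have "n \<le> npts S n" for n using S(2) by (simp add: single_indexed_def)
  then show "covers S f chat" if "remainder_cond k S m f" "radius_cond S m" "variance_cond S m"
    using coverage_uniform S bias \<open>m \<ge> 1\<close> that by blast
  show "covers S f chat" if "polynomial_eigenvalues S m"
    using coverage_polynomial S bias \<open>m \<ge> 1\<close> that by blast
next
  assume S: "regression_model S'" "double_indexed S'" "is_estimator k S' m f' chat'" and bias: "bias_cond k S' m f'"
  show "covers S' f' chat'" if "product_eigenvalues S' m"
    using coverage_product S bias \<open>m \<ge> 1\<close> that by blast
  show "covers S' f' chat'" if "sobolev_eigenvalues S' m"
    using coverage_sobolev S bias \<open>m \<ge> 1\<close> that by blast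
qed

end
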